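(* Let $n\ge 2$. The space $\mathcal P\otimes\mathcal C$ decomposes, under the action of $\mathfrak{sl}(2,\mathbb R)$, into the direct sum $$\mathcal P\otimes\mathcal C=\bigoplus_{l=0}^\infty\bigoplus_{j=0}^\infty X_s^j\mathcal M_l,\qquad \mathcal M_l=\mathcal M_l^+\oplus\mathcal M_l^-,$$ where each $X_s^j\mathcal M_l=X_s^j\mathcal M_l^+\oplus X_s^j\mathcal M_l^-$ and the summands $X_s^j\mathcal M_l^{+}$ and $X_s^j\mathcal M_l^{-}$ are simple weight $\mathfrak{sp}(2n,\mathbb R)$-modules. Moreover: (1) for each $k\in\mathbb N_0$ the space of homogeneous polynomials of degree $k$ with values in $\mathcal C$ decomposes as $$\mathcal P_k\otimes\mathcal C=\bigoplus_{l=0}^{k}X_s^{k-l}\mathcal M_l;$$ (2) for each $l\in\mathbb N_0$ the subspace $\bigoplus_{j=0}^\infty X_s^j\mathcal M_l$ is a lowest weight $\mathfrak{sl}(2,\mathbb R)$-module generated by $\mathcal M_l$.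
   Context: $\mathbb N_0=\{0,1,2,\dots\}$. Let $V=\mathbb R^{2n}$ with symplectic form $\omega$ and symplectic basis $e_1,f_1,\dots,e_n,f_n$: $\omega(e_i,e_j)=\omega(f_i,f_j)=0$, $\omega(e_i,f_j)=\delta_{ij}$. Let $x_1,\dots,x_{2n}$ be the coordinates for which a point of $V$ is $\sum_{j=1}^n(x_{2j-1}f_j+x_{2j}e_j)$. $\mathcal P=\mathbb C[x_1,\dots,x_{2n}]$, and $\mathcal P_k$ is its subspace of homogeneous polynomials of degree $k$. The Segal-Shale-Weil module is $\mathcal C=\mathbb C[q_1,\dots,q_n]$, on which the vectors $e_j,f_j$ act as operators with $[e_i,e_j]=[f_i,f_j]=0$, $e_if_j-f_je_i=\delta_{ij}$; concretely $e_j=\sqrt{-1}\,q_j$ and $f_j=\sqrt{-1}\,\partial_{q_j}$. Each $A\in\mathfrak{sp}(2n,\mathbb R)=\mathfrak{sp}(V,\omega)$ acts on $\mathcal C$ by the unique element $L(A)$ of the real span of $e_ie_j$, $f_if_j$, $e_if_j+f_je_i$ satisfying $[L(A),v]=Av$ for all $v\in V$; it acts on $\mathcal P$ by the natural (contragredient) action on polynomial functions on $V$, and on $\mathcal P\otimes\mathcal C$ by the tensor product action. Weights: the Cartan subalgebra has basis $H_i=\tfrac12(e_if_i+f_ie_i)$, acting on $\mathcal C$ as $-(q_i\partial_{q_i}+\tfrac12)$; $\epsilon_1,\dots,\epsilon_n$ is the dual basis; simple roots are $\epsilon_i-\epsilon_{i+1}$ ($1\le i\le n-1$, root space spanned by $q_{i+1}\partial_{q_i}$)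 and $2\epsilon_n$ (root space spanned by $\partial_{q_n}^2$); fundamental weights are $\omega_i=\epsilon_1+\dots+\epsilon_i$. $L(\mu)$ denotes the simple highest weight module of highest weight $\mu$. One has $\mathcal C=L(-\tfrac12\omega_n)\oplus L(\omega_{n-1}-\tfrac32\omega_n)$ (even and odd polynomials in $q$). Operators on $\mathcal P\otimes\mathcal C$, commuting with $\mathfrak{sp}(2n,\mathbb R)$: $$X_s=\sum_{j=1}^n(x_{2j-1}f_j+x_{2j}e_j),\quad D_s=\sum_{j=1}^n(\partial_{x_{2j-1}}e_j-\partial_{x_{2j}}f_j),\quad \mathbb E=\sum_{j=1}^{2n}x_j\partial_{x_j}.$$ $D_s$ is the symplectic Dirac operator. They satisfy $[\mathbb E,D_s]=-D_s$, $[\mathbb E,X_s]=X_s$, $[D_s,X_s]=\mathbb E+n$, so that $X_s$, $D_s$, $\mathbb E+n$ span a copy of $\mathfrak{sl}(2,\mathbb R)$. A lowest weight $\mathfrak{sl}(2,\mathbb R)$-module generated by a subspace means a module generated by a subspace that is annihilated by $D_s$ and on which $\mathbb E+n$ acts by a scalar. Symplectic monogenics of degree $l$: $\mathcal M_l^+$ (resp. $\mathcal M_l^-$) is the simple $\mathfrak{sp}(2n,\mathbb R)$-submodule of $\mathcal P_l\otimes\mathcal C$ isomorphic to $L(l\omega_1-\tfrac12\omega_n)$ (resp. $L(l\omega_1+\omega_{n-1}-\tfrac32\omega_n)$), and $\mathcal M_l=\mathcal M_l^+\oplus\mathcal M_l^-$, which is characterized by $\mathcal M_l=\mathrm{Ker}(D_s)\cap(\mathcal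 P_l\otimes\mathcal C)$. *)

theory Defs
  imports "HOL-Library.Poly_Mapping" "Jordan_Normal_Form.Matrix" Complex_Main
begin

section \<open>Vector spaces with a distinguished basis\<close>

text \<open>
  The type \<open>'a \<Rightarrow>\<^sub>0 complex\<close> of finitely supported functions is the complex vector space with
  basis \<open>'a\<close>; its scalar multiplication is pointwise.
\<close>

definition cscale :: "complex \<Rightarrow> ('a \<Rightarrow>\<^sub>0 complex) \<Rightarrow> ('a \<Rightarrow>\<^sub>0 complex)" (infixr "*\<^sub>c" 75)
  where "c *\<^sub>c p = Poly_Mapping.map ((*) c) p"

lemma lookup_cscale [simp]: "Poly_Mapping.lookup (c *\<^sub>c p) a = c * Poly_Mapping.lookup p a"
  unfolding cscale_def by transfer (simp add: when_def)

global_interpretation cvs: vector_space "cscale :: complex \<Rightarrow> ('a \<Rightarrow>\<^sub>0 complex) \<Rightarrow> _"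
  by unfold_locales (auto intro!: poly_mapping_eqI simp: lookup_add algebra_simps)

text \<open>Internal direct sum: \<open>U\<close> is the direct sum of the family of subspaces \<open>W i\<close>, \<open>i \<in> I\<close>.\<close>

definition is_direct_sum ::
    "'i set \<Rightarrow> ('i \<Rightarrow> ('a \<Rightarrow>\<^sub>0 complex) set) \<Rightarrow> ('a \<Rightarrow>\<^sub>0 complex) set \<Rightarrow> bool"
  where "is_direct_sum I W U \<longleftrightarrow>
    (\<forall>i\<in>I. cvs.subspace (W i)) \<and>
    U = cvs.span (\<Union>i\<in>I. W i) \<and>
    (\<forall>J w. finite J \<and> J \<subseteq> I \<and> (\<forall>j\<in>J. w j \<in> W j) \<and> (\<Sum>j\<in>J. w j) = 0
      \<longrightarrow> (\<forall>j\<in>J. w j = 0))"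

definition is_direct_sum2 ::
    "('a \<Rightarrow>\<^sub>0 complex) set \<Rightarrow> ('a \<Rightarrow>\<^sub>0 complex) set \<Rightarrow> ('a \<Rightarrow>\<^sub>0 complex) set \<Rightarrow> bool"
  where "is_direct_sum2 A B U \<longleftrightarrow>
    cvs.subspace A \<and> cvs.subspace B \<and> U = {a + b | a b. a \<in> A \<and> b \<in> B} \<and> A \<inter> B = {0}"

text \<open>
  The tensor product of the spaces with bases \<open>'a\<close> and \<open>'b\<close> is the space with basis \<open>'a \<times> 'b\<close>,
  the basis vector \<open>(a, b)\<close> being the tensor product of the basis vectors \<open>a\<close> and \<open>b\<close>.
\<close>

definition tensor :: "('a \<Rightarrow>\<^sub>0 complex) \<Rightarrow> ('b \<Rightarrow>\<^sub>0 complex) \<Rightarrow> ('a \<times> 'b \<Rightarrow>\<^sub>0 complex)"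
  where "tensor p c = (\<Sum>a\<in>Poly_Mapping.keys p. \<Sum>b\<in>Poly_Mapping.keys c.
    Poly_Mapping.single (a, b) (Poly_Mapping.lookup p a * Poly_Mapping.lookup c b))"

definition tensor_space ::
    "('a \<Rightarrow>\<^sub>0 complex) set \<Rightarrow> ('b \<Rightarrow>\<^sub>0 complex) set \<Rightarrow> ('a \<times> 'b \<Rightarrow>\<^sub>0 complex) set"
  where "tensor_space A B = cvs.span {tensor p c | p c. p \<in> A \<and> c \<in> B}"

text \<open>For linear \<open>S\<close> and \<open>T\<close> this is the linear map \<open>S \<otimes> T\<close>.\<close>

definition tensor_map ::
    "(('a \<Rightarrow>\<^sub>0 complex) \<Rightarrow> ('a \<Rightarrow>\<^sub>0 complex)) \<Rightarrow> (('b \<Rightarrow>\<^sub>0 complex) \<Rightarrow> ('b \<Rightarrow>\<^sub>0 complex)) \<Rightarrow>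
     ('a \<times> 'b \<Rightarrow>\<^sub>0 complex) \<Rightarrow> ('a \<times> 'b \<Rightarrow>\<^sub>0 complex)"
  where "tensor_map S T F = (\<Sum>(a, b)\<in>Poly_Mapping.keys F.
    Poly_Mapping.lookup F (a, b) *\<^sub>c
      tensor (S (Poly_Mapping.single a 1)) (T (Poly_Mapping.single b 1)))"


section \<open>Polynomials\<close>

text \<open>
  Complex polynomials in variables indexed by the natural numbers: a monomial is a finitely
  supported exponent function. Indices start from 0 throughout: \<open>q\<^sub>j\<close>, \<open>e\<^sub>j\<close>, \<open>f\<^sub>j\<close>,
  \<open>\<epsilon>\<^sub>j\<close> are used with \<open>j < n\<close>, and the variables \<open>x\<^sub>2\<^sub>j\<^sub>-\<^sub>1\<close>, \<open>x\<^sub>2\<^sub>j\<close> (\<open>1 \<le> j \<le> n\<close>) of the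
  literature have indices \<open>2 * j\<close> and \<open>2 * j + 1\<close> (\<open>0 \<le> j < n\<close>).
\<close>

type_synonym monom = "nat \<Rightarrow>\<^sub>0 nat"
type_synonym mpol = "monom \<Rightarrow>\<^sub>0 complex"
type_synonym spinor_pol = "monom \<times> monom \<Rightarrow>\<^sub>0 complex"

definition mul_var :: "nat \<Rightarrow> mpol \<Rightarrow> mpol"
  where "mul_var i p = Poly_Mapping.single (Poly_Mapping.single i 1) 1 * p"

definition pd :: "nat \<Rightarrow> mpol \<Rightarrow> mpol"
  where "pd i p = (\<Sum>m\<in>Poly_Mapping.keys p. Poly_Mapping.single (m - Poly_Mapping.single i 1)
    (of_nat (Poly_Mapping.lookup m i) * Poly_Mapping.lookup p m))"

definition pols :: "nat \<Rightarrow> mpol set"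
  where "pols N = {p. \<forall>m\<in>Poly_Mapping.keys p. Poly_Mapping.keys m \<subseteq> {..<N}}"

definition homogeneous_pols :: "nat \<Rightarrow> nat \<Rightarrow> mpol set"
  where "homogeneous_pols N k =
    {p \<in> pols N. \<forall>m\<in>Poly_Mapping.keys p. (\<Sum>i<N. Poly_Mapping.lookup m i) = k}"


section \<open>The symplectic Lie algebra and its action\<close>

text \<open>
  A vector of \<open>V\<close> is its coordinate vector in the basis \<open>f\<^sub>0, e\<^sub>0, f\<^sub>1, e\<^sub>1, \<dots>\<close>, and
  \<open>\<omega>(e\<^sub>i, f\<^sub>j) = \<delta>\<^sub>i\<^sub>j\<close>.
\<close>

definition symp_form :: "nat \<Rightarrow> real vec \<Rightarrow> real vec \<Rightarrow> real"
  where "symp_form n v w = (\<Sum>j<n. v $ (2*j+1) * w $ (2*j) - v $ (2*j) * w $ (2*j+1))"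

definition sp :: "nat \<Rightarrow> real mat set"
  where "sp n = {A \<in> carrier_mat (2*n) (2*n).
    \<forall>v\<in>carrier_vec (2*n). \<forall>w\<in>carrier_vec (2*n).
      symp_form n (A *\<^sub>v v) w + symp_form n v (A *\<^sub>v w) = 0}"

definition op_e :: "nat \<Rightarrow> mpol \<Rightarrow> mpol"
  where "op_e j p = \<i> *\<^sub>c mul_var j p"

definition op_f :: "nat \<Rightarrow> mpol \<Rightarrow> mpol"
  where "op_f j p = \<i> *\<^sub>c pd j p"

text \<open>The action on \<open>\<complex>[q]\<close> of a vector of \<open>V\<close>.\<close>

definition op_vec :: "nat \<Rightarrow> real vec \<Rightarrow> mpol \<Rightarrow> mpol"
  where "op_vec n v p =
    (\<Sum>j<n. complex_of_real (v $ (2*j)) *\<^sub>c op_f j p + complex_of_real (v $ (2*j+1)) *\<^sub>c op_e j p)"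

text \<open>The real span of the operators \<open>e\<^sub>i e\<^sub>j\<close>, \<open>f\<^sub>i f\<^sub>j\<close>, \<open>e\<^sub>i f\<^sub>j + f\<^sub>j e\<^sub>i\<close>.\<close>

definition quadratic_ops :: "nat \<Rightarrow> (mpol \<Rightarrow> mpol) set"
  where "quadratic_ops n = {T. \<exists>a b c :: nat \<Rightarrow> nat \<Rightarrow> real. T = (\<lambda>p. \<Sum>i<n. \<Sum>j<n.
      complex_of_real (a i j) *\<^sub>c op_e i (op_e j p)
    + complex_of_real (b i j) *\<^sub>c op_f i (op_f j p)
    + complex_of_real (c i j) *\<^sub>c (op_e i (op_f j p) + op_f j (op_e i p)))}"

text \<open>The Segal-Shale-Weil action \<open>A \<mapsto> L(A)\<close>, determined by \<open>[L(A), v] = A v\<close>.\<close>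

definition sp_weil :: "nat \<Rightarrow> real mat \<Rightarrow> mpol \<Rightarrow> mpol"
  where "sp_weil n A = (THE T. T \<in> quadratic_ops n \<and>
    (\<forall>v\<in>carrier_vec (2*n). \<forall>p\<in>pols n.
      T (op_vec n v p) - op_vec n v (T p) = op_vec n (A *\<^sub>v v) p))"

text \<open>
  The contragredient action on polynomial functions on \<open>V\<close>: \<open>(A p)(v) = - dp\<^sub>v(A v)\<close>, where
  \<open>dp\<^sub>v\<close> is the derivative of \<open>p\<close> at \<open>v\<close>.
\<close>

definition sp_pol :: "nat \<Rightarrow> real mat \<Rightarrow> mpol \<Rightarrow> mpol"
  where "sp_pol n A p =
    - (\<Sum>i<2*n. \<Sum>k<2*n. complex_of_real (A $$ (i, k)) *\<^sub>c mul_var k (pd i p))"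

definition sp_act :: "nat \<Rightarrow> real mat \<Rightarrow> spinor_pol \<Rightarrow> spinor_pol"
  where "sp_act n A F = tensor_map (sp_pol n A) id F + tensor_map id (sp_weil n A) F"

definition sp_submodule :: "nat \<Rightarrow> spinor_pol set \<Rightarrow> bool"
  where "sp_submodule n W \<longleftrightarrow> cvs.subspace W \<and> (\<forall>A\<in>sp n. \<forall>w\<in>W. sp_act n A w \<in> W)"

definition simple_sp_module :: "nat \<Rightarrow> spinor_pol set \<Rightarrow> bool"
  where "simple_sp_module n W \<longleftrightarrow> sp_submodule n W \<and> W \<noteq> {0} \<and>
    (\<forall>U. sp_submodule n U \<and> U \<subseteq> W \<longrightarrow> U = {0} \<or> U = W)"


section \<open>Weights\<close>

text \<open>
  The endomorphism of \<open>V\<close> corresponding to \<open>H\<^sub>i = (e\<^sub>i f\<^sub>i + f\<^sub>i e\<^sub>i) / 2\<close>: since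
  \<open>[H\<^sub>i, f\<^sub>i] = f\<^sub>i\<close> and \<open>[H\<^sub>i, e\<^sub>i] = - e\<^sub>i\<close>, it fixes \<open>f\<^sub>i\<close>, negates \<open>e\<^sub>i\<close> and kills the
  other basis vectors.
\<close>

definition cartan :: "nat \<Rightarrow> nat \<Rightarrow> real mat"
  where "cartan n i = mat (2*n) (2*n) (\<lambda>(r, c).
    if r = c \<and> r = 2*i then 1 else if r = c \<and> r = 2*i+1 then -1 else 0)"

text \<open>
  A linear functional on the Cartan subalgebra is given by its coordinates in the basis
  \<open>\<epsilon>\<^sub>0, \<dots>, \<epsilon>\<^sub>n\<^sub>-\<^sub>1\<close>, that is, by its values on the elements \<open>cartan n i\<close>.
\<close>

definition weight_space :: "nat \<Rightarrow> spinor_pol set \<Rightarrow> complex vec \<Rightarrow> spinor_pol set"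
  where "weight_space n W \<mu> = {w \<in> W. \<forall>i<n. sp_act n (cartan n i) w = (\<mu> $ i) *\<^sub>c w}"

definition weight_module :: "nat \<Rightarrow> spinor_pol set \<Rightarrow> bool"
  where "weight_module n W \<longleftrightarrow> sp_submodule n W \<and>
    is_direct_sum (carrier_vec n) (weight_space n W) W"

definition simple_roots :: "nat \<Rightarrow> real vec set"
  where "simple_roots n =
    {unit_vec n i - unit_vec n (i+1) | i. i + 1 < n} \<union> {2 \<cdot>\<^sub>v unit_vec n (n-1)}"

definition root_space :: "nat \<Rightarrow> real vec \<Rightarrow> real mat set"
  where "root_space n \<alpha> =
    {A \<in> sp n. \<forall>i<n. cartan n i * A - A * cartan n i = (\<alpha> $ i) \<cdot>\<^sub>m A}"

text \<open>
  A highest weight vector is killed by the simple root spaces, which generate the nilradical of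
  the Borel subalgebra.
\<close>

definition highest_weight_module :: "nat \<Rightarrow> complex vec \<Rightarrow> spinor_pol set \<Rightarrow> bool"
  where "highest_weight_module n \<mu> W \<longleftrightarrow> sp_submodule n W \<and>
    (\<exists>v\<in>weight_space n W \<mu>. v \<noteq> 0 \<and>
      (\<forall>\<alpha>\<in>simple_roots n. \<forall>A\<in>root_space n \<alpha>. sp_act n A v = 0) \<and>
      (\<forall>U. sp_submodule n U \<and> v \<in> U \<longrightarrow> W \<subseteq> U))"

text \<open>
  \<open>W \<cong> L(\<mu>)\<close>: the module \<open>L(\<mu>)\<close> is by definition the simple highest weight module of highest
  weight \<open>\<mu>\<close>, which is unique up to isomorphism.
\<close>

definition is_L :: "nat \<Rightarrow> complex vec \<Rightarrow> spinor_pol set \<Rightarrow> bool"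
  where "is_L n \<mu> W \<longleftrightarrow> simple_sp_module n W \<and> highest_weight_module n \<mu> W"

text \<open>The fundamental weight \<open>\<omega>\<^sub>i\<close>, \<open>1 \<le> i \<le> n\<close>: the sum of the first \<open>i\<close> functionals \<open>\<epsilon>\<close>.\<close>

definition fund_weight :: "nat \<Rightarrow> nat \<Rightarrow> complex vec"
  where "fund_weight n i = vec n (\<lambda>j. if j < i then 1 else 0)"


section \<open>The symplectic Dirac operator and symplectic monogenics\<close>

definition PC :: "nat \<Rightarrow> spinor_pol set"
  where "PC n = tensor_space (pols (2*n)) (pols n)"

definition PC_deg :: "nat \<Rightarrow> nat \<Rightarrow> spinor_pol set"
  where "PC_deg n k = tensor_space (homogeneous_pols (2*n) k) (pols n)"

definition X_s :: "nat \<Rightarrow> spinor_pol \<Rightarrow> spinor_pol"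
  where "X_s n F = (\<Sum>j<n. tensor_map (mul_var (2*j)) (op_f j) F
                        + tensor_map (mul_var (2*j+1)) (op_e j) F)"

definition D_s :: "nat \<Rightarrow> spinor_pol \<Rightarrow> spinor_pol"
  where "D_s n F = (\<Sum>j<n. tensor_map (pd (2*j)) (op_e j) F
                        - tensor_map (pd (2*j+1)) (op_f j) F)"

definition euler :: "nat \<Rightarrow> spinor_pol \<Rightarrow> spinor_pol"
  where "euler n F = (\<Sum>i<2*n. tensor_map (\<lambda>p. mul_var i (pd i p)) id F)"

definition euler_shift :: "nat \<Rightarrow> spinor_pol \<Rightarrow> spinor_pol"
  where "euler_shift n F = euler n F + of_nat n *\<^sub>c F"

definition sl2_submodule :: "nat \<Rightarrow> spinor_pol set \<Rightarrow> bool"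
  where "sl2_submodule n U \<longleftrightarrow> cvs.subspace U \<and>
    (\<forall>u\<in>U. X_s n u \<in> U \<and> D_s n u \<in> U \<and> euler_shift n u \<in> U)"

definition lowest_weight_sl2_module_generated_by ::
    "nat \<Rightarrow> spinor_pol set \<Rightarrow> spinor_pol set \<Rightarrow> bool"
  where "lowest_weight_sl2_module_generated_by n U M \<longleftrightarrow>
    sl2_submodule n U \<and> cvs.subspace M \<and> M \<subseteq> U \<and>
    (\<forall>U'. sl2_submodule n U' \<and> M \<subseteq> U' \<longrightarrow> U \<subseteq> U') \<and>
    (\<forall>m\<in>M. D_s n m = 0) \<and>
    (\<exists>c. \<forall>m\<in>M. euler_shift n m = c *\<^sub>c m)"

definition monogenic_plus :: "nat \<Rightarrow> nat \<Rightarrow> spinor_pol set"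
  where "monogenic_plus n l = (THE W. W \<subseteq> PC_deg n l \<and>
    is_L n (of_nat l \<cdot>\<^sub>v fund_weight n 1 - (1/2) \<cdot>\<^sub>v fund_weight n n) W)"

definition monogenic_minus :: "nat \<Rightarrow> nat \<Rightarrow> spinor_pol set"
  where "monogenic_minus n l = (THE W. W \<subseteq> PC_deg n l \<and>
    is_L n (of_nat l \<cdot>\<^sub>v fund_weight n 1 + fund_weight n (n-1) - (3/2) \<cdot>\<^sub>v fund_weight n n) W)"

definition monogenic :: "nat \<Rightarrow> nat \<Rightarrow> spinor_pol set"
  where "monogenic n l = {a + b | a b. a \<in> monogenic_plus n l \<and> b \<in> monogenic_minus n l}"

text \<open>\<open>X_image n j M\<close> is \<open>X\<^sub>s\<^sup>j M\<close>, and \<open>X_tower n M\<close> is the sum of these over all \<open>j\<close>.\<close>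

definition X_image :: "nat \<Rightarrow> nat \<Rightarrow> spinor_pol set \<Rightarrow> spinor_pol set"
  where "X_image n j M = (X_s n ^^ j) ` M"

definition X_tower :: "nat \<Rightarrow> spinor_pol set \<Rightarrow> spinor_pol set"
  where "X_tower n M = cvs.span (\<Union>j. X_image n j M)"

end

(*
  D_s and X_s generate sl(2), and D_s X_s^j m is a nonzero multiple of X_s^(j-1) m for m in Ker D_s
  of degree l. By induction on the degree, P_k (x) C is therefore the sum of the spaces
  X_s^(k-l) (Ker D_s in degree l); the sum is direct because the Casimir operator of sl(2) takes
  the distinct values (l+n)(l+n-1) on the summands.

  It remains to see that the even and the odd part of Ker D_s in degree l are the simple modules
  M_l^+ and M_l^-. Write y_j, z_j for the coordinates dual to f_j, e_j. A direct computation shows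
  that the only vectors of Ker D_s in degree l killed by all positive root vectors are the
  combinations of z_1^l and z_1^l q_n, so every nonzero submodule of either part contains its
  highest weight vector. That this vector generates the whole part follows by duality: there is a
  nondegenerate bilinear form on P (x) C, diagonal on monomials, for which the root vectors of
  opposite roots are adjoint up to sign and X_s is adjoint to a multiple of D_s, so that Ker D_s
  is the orthogonal complement of the image of X_s. Finally, the weight spaces of the two highest
  weights in P_l (x) C are one-dimensional, which makes the submodules M_l^+ and M_l^- unique.
*)
theory Submission
  imports Defs
begin

text \<open>On P (x) C all operators of the statement lie in a Weyl algebra, so every commutation
  relation is a matter of normal ordering; linear maps are made a ring for this purpose. L(A), M_l^+
  and M_l^- are given by definite descriptions, so existence and uniqueness must be settled before
  anything can be computed with them. The modules are infinite dimensional, where a proper subspace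
  need not have a nonzero orthogonal complement. What rescues the duality is that a weight and a
  degree in x leave only finitely many monomials: a functional on one weight space is represented by
  a polynomial, and the Fischer decomposition of that polynomial yields a representative inside Ker
  D_s. As root vectors of opposite roots are adjoint, the complement of a submodule is closed under
  the raising operators, and a bounded height function supplies a highest weight vector in it. The
  hypothesis n >= 2 is decisive in the computation of the highest weight vectors, where an equation
  N^2 = 1 with N >= n has to be excluded.\<close>

abbreviation "coef \<equiv> Poly_Mapping.lookup"
abbreviation "supp \<equiv> Poly_Mapping.keys"
abbreviation "single \<equiv> Poly_Mapping.single"

section \<open>The ring of linear endomorphisms\<close>

text \<open>A type rather than a predicate, so that linear maps become an instance of
  \<open>ring_1\<close>, with composition as the product, and operator identities become ring
  identities for the simplifier.\<close>

typedef 'a endo = "{T :: ('a \<Rightarrow>\<^sub>0 complex) \<Rightarrow> ('a \<Rightarrow>\<^sub>0 complex).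
    (\<forall>F G. T (F + G) = T F + T G) \<and> (\<forall>c F. T (c *\<^sub>c F) = c *\<^sub>c T F)}"
  morphisms app Endo
  by (rule exI[of _ id]) simp

setup_lifting type_definition_endo

notation app (infixr "\<star>" 68)

lemmas cscale_add = cvs.scale_right_distrib cvs.scale_left_distrib
lemmas cscale_diff = cvs.scale_right_diff_distrib cvs.scale_left_diff_distrib
lemmas cscale_sum = cvs.scale_sum_right

lemma cscale_single: "c *\<^sub>c single s d = single s (c * d)"
  by (rule poly_mapping_eqI) (simp add: lookup_single when_def)

instantiation endo :: (type) ring_1
begin

lift_definition zero_endo :: "'a endo" is "\<lambda>F. 0" by simp
lift_definition one_endo :: "'a endo" is "\<lambda>F. F" by simp
lift_definition plus_endo :: "'a endo \<Rightarrow> 'a endo \<Rightarrow> 'a endo" is "\<lambda>S T F. S F + T F"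
  by (simp add: cscale_add)
lift_definition minus_endo :: "'a endo \<Rightarrow> 'a endo \<Rightarrow> 'a endo" is "\<lambda>S T F. S F - T F"
  by (simp add: cscale_diff)
lift_definition uminus_endo :: "'a endo \<Rightarrow> 'a endo" is "\<lambda>S F. - S F"
  by simp
lift_definition times_endo :: "'a endo \<Rightarrow> 'a endo \<Rightarrow> 'a endo" is "\<lambda>S T F. S (T F)"
  by simp

instance
proof
  show "(0::'a endo) \<noteq> 1"
  proof transfer
    show "(\<lambda>F. 0) \<noteq> (\<lambda>F :: 'a \<Rightarrow>\<^sub>0 complex. F)"
      by (metis lookup_single_eq lookup_zero zero_neq_one)
  qed
qed (transfer; simp add: fun_eq_iff algebra_simps)+

end

lift_definition sc :: "complex \<Rightarrow> 'a endo" is "\<lambda>c F. c *\<^sub>c F"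
  by (simp add: cscale_add mult.commute)

lemma app_simps [simp]:
  "A \<star> (F + G) = A \<star> F + A \<star> G" "A \<star> c *\<^sub>c F = c *\<^sub>c (A \<star> F)"
  "(A + B) \<star> F = (A \<star> F) + (B \<star> F)" "(A - B) \<star> F = (A \<star> F) - (B \<star> F)" "(- A) \<star> F = - (A \<star> F)"
  "A * B \<star> F = A \<star> B \<star> F" "1 \<star> F = F" "0 \<star> F = 0" "sc c \<star> F = c *\<^sub>c F"
  by (transfer; simp)+

lemma app_zero [simp]: "A \<star> 0 = 0"
  using app_simps(2)[of A 0 0] by simp

lemma app_uminus [simp]: "A \<star> - F = - (A \<star> F)"
  using app_simps(2)[of A "-1" F] by simp

lemma app_diff [simp]: "A \<star> (F - G) = (A \<star> F) - (A \<star> G)"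
  using app_simps(1)[of A F "- G"] by simp

lemma app_sum: "A \<star> sum f S = (\<Sum>x\<in>S. A \<star> f x)"
  by (induction S rule: infinite_finite_induct) auto

lemma sum_app: "sum A S \<star> F = (\<Sum>x\<in>S. A x \<star> F)"
  by (induction S rule: infinite_finite_induct) auto

lemma endo_ext: "(\<And>F. A \<star> F = B \<star> F) \<Longrightarrow> A = B"
  by transfer auto

lemma sc_simps [simp]: "sc 0 = 0" "sc 1 = 1" "sc (c + d) = sc c + sc d" "sc (c - d) = sc c - sc d"
  "sc (- c) = - sc c" "sc (c * d) = sc c * sc d" "sc (of_nat k) = of_nat k"
proof -
  show *: "sc 0 = 0" "sc 1 = 1" "sc (c + d) = sc c + sc d" "sc (c - d) = sc c - sc d"
    "sc (- c) = - sc c" "sc (c * d) = sc c * sc d" for c d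
    by (rule endo_ext; simp add: cscale_add cscale_diff)+
  show "sc (of_nat k) = of_nat k"
    by (induction k) (auto simp: *)
qed

lemma sc_commute: "A * sc c = sc c * A"
  by (rule endo_ext) simp

lemma poly_mapping_sum_single:
  "F = (\<Sum>s\<in>supp F. coef F s *\<^sub>c single s 1)"
  by (rule poly_mapping_eqI)
     (auto simp: lookup_sum lookup_single when_def in_keys_iff if_distrib[of "\<lambda>x. _ * x"] cong: if_cong)

lemma app_expand: "A \<star> F = (\<Sum>s\<in>supp F. coef F s *\<^sub>c (A \<star> single s 1))"
  by (subst poly_mapping_sum_single[of F]) (simp add: app_sum)

lemma endo_eqI: "(\<And>s. A \<star> single s 1 = B \<star> single s 1) \<Longrightarrow> A = B"
  by (rule endo_ext) (subst (1 2) app_expand, simp)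

lemma lookup_app: "coef (A \<star> F) a
    = (\<Sum>s\<in>supp F. coef F s * coef (A \<star> single s 1) a)"
  by (subst app_expand) (simp add: lookup_sum)

subsection \<open>Tensor products\<close>

lemma lookup_tensor [simp]:
  "coef (tensor p c) (a, b) = coef p a * coef c b"
proof -
  have "coef (tensor p c) (a, b) = (\<Sum>a'\<in>supp p. \<Sum>b'\<in>supp c.
      if a = a' then if b = b' then coef p a' * coef c b' else 0 else 0)"
    unfolding tensor_def lookup_sum
    by (intro sum.cong refl) (auto simp: lookup_single when_def)
  also have "\<dots> = (\<Sum>a'\<in>supp p. if a = a' then (\<Sum>b'\<in>supp c.
      if b = b' then coef p a' * coef c b' else 0) else 0)"
    by (intro sum.cong refl) auto
  also have "\<dots> = coef p a * coef c b"
    by (auto simp: in_keys_iff)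
  finally show ?thesis .
qed

lemma keys_tensor: "supp (tensor p c) = supp p \<times> supp c"
  by (auto simp: in_keys_iff)

lemma tensor_single:
  "tensor (single a c) (single b d) = single (a, b) (c * d)"
  by (rule poly_mapping_eqI) (auto simp: lookup_single when_def split: prod.splits if_splits)

text \<open>The support is replaced by any finite superset, so that the sums for \<open>F\<close>,
  \<open>G\<close> and \<open>F + G\<close> can run over one common index set.\<close>

lemma lookup_tensor_map:
  assumes "finite S" "supp F \<subseteq> S"
  shows "coef (tensor_map A B F) ab = (\<Sum>(s, t)\<in>S. coef F (s, t) *
    coef (tensor (A (single s 1)) (B (single t 1))) ab)"
proof -
  have "coef (tensor_map A B F) ab = (\<Sum>(s, t)\<in>supp F. coef F (s, t) *
      coef (tensor (A (single s 1)) (B (single t 1))) ab)"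
    unfolding tensor_map_def lookup_sum by (intro sum.cong refl) (auto split: prod.splits)
  also have "\<dots> = (\<Sum>(s, t)\<in>S. coef F (s, t) *
      coef (tensor (A (single s 1)) (B (single t 1))) ab)"
    by (rule sum.mono_neutral_left) (use assms in \<open>auto simp: in_keys_iff\<close>)
  finally show ?thesis .
qed

lemma tensor_map_add: "tensor_map A B (F + G) = tensor_map A B F + tensor_map A B G"
proof (rule poly_mapping_eqI)
  fix ab
  let ?S = "supp F \<union> supp G"
  have S: "finite ?S" "supp (F + G) \<subseteq> ?S" using Poly_Mapping.keys_add[of F G] by auto
  show "coef (tensor_map A B (F + G)) ab
      = coef (tensor_map A B F + tensor_map A B G) ab"
    by (simp add: lookup_add lookup_tensor_map[OF S] lookup_tensor_map[OF S(1), of F]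
      lookup_tensor_map[OF S(1), of G] case_prod_unfold sum.distrib[symmetric] algebra_simps)
qed

lemma tensor_map_cscale: "tensor_map A B (c *\<^sub>c F) = c *\<^sub>c tensor_map A B F"
proof (rule poly_mapping_eqI)
  fix ab
  have S: "supp (c *\<^sub>c F) \<subseteq> supp F" by (auto simp: in_keys_iff)
  show "coef (tensor_map A B (c *\<^sub>c F)) ab = coef (c *\<^sub>c tensor_map A B F) ab"
    by (simp add: lookup_tensor_map[OF finite_keys S] lookup_tensor_map[OF finite_keys order.refl[of "supp F"]]
      case_prod_unfold sum_distrib_left algebra_simps)
qed

lift_definition te :: "'a endo \<Rightarrow> 'b endo \<Rightarrow> ('a \<times> 'b) endo" is tensor_map
  by (simp add: tensor_map_add tensor_map_cscale)

lemma tensor_map_app: "tensor_map (app A) (app B) F = te A B \<star> F"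
  by (simp add: te.rep_eq)

text \<open>Extends the defining values on pairs of monomials to all pure tensors; composition of
  tensor maps rests on it.\<close>

lemma te_tensor: "te A B \<star> tensor p c = tensor (A \<star> p) (B \<star> c)"
  for p :: "'a \<Rightarrow>\<^sub>0 complex" and c :: "'b \<Rightarrow>\<^sub>0 complex"
proof (rule poly_mapping_eqI)
  fix ab :: "'a \<times> 'b"
  obtain a b where ab: "ab = (a, b)" by fastforce
  show "coef (te A B \<star> tensor p c) ab = coef (tensor (A \<star> p) (B \<star> c)) ab"
    unfolding ab tensor_map_app[symmetric]
    by (simp add: lookup_tensor_map[OF finite_keys order.refl] keys_tensor lookup_app[of A p] lookup_app[of B c]
      sum_product sum.cartesian_product algebra_simps)
qed

lemma te_single: "te A B \<star> single (a, b) 1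
    = tensor (A \<star> single a 1) (B \<star> single b 1)"
  by (metis mult_1 te_tensor tensor_single)

lemma te_times: "te A B * te C D = te (A * C) (B * D)"
  by (rule endo_eqI) (auto simp: te_single te_tensor)

lemma tensor_bilinear:
  "tensor (p + p') c = tensor p c + tensor p' c" "tensor p (c + c') = tensor p c + tensor p c'"
  "tensor (p - p') c = tensor p c - tensor p' c" "tensor p (c - c') = tensor p c - tensor p c'"
  "tensor (d *\<^sub>c p) c = d *\<^sub>c tensor p c" "tensor p (d *\<^sub>c c) = d *\<^sub>c tensor p c"
  "tensor 0 c = 0" "tensor p 0 = 0"
  by (rule poly_mapping_eqI; auto simp: lookup_add lookup_minus algebra_simps)+

lemma te_bilinear:
  "te (A + A') B = te A B + te A' B" "te A (B + B') = te A B + te A B'"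
  "te (A - A') B = te A B - te A' B" "te A (B - B') = te A B - te A B'"
  "te (sc d * A) B = sc d * te A B" "te A (sc d * B) = sc d * te A B"
  "te 0 B = 0" "te A 0 = 0" "te 1 1 = 1"
  by (rule endo_eqI; auto simp: te_single tensor_bilinear tensor_single)+

lemma te_uminus: "te (- A) B = - te A B" "te A (- B) = - te A B"
  using te_bilinear(3)[of 0 A B] te_bilinear(4)[of A 0 B] by (simp_all add: te_bilinear)

lemma te_sum: "te (sum f S) B = (\<Sum>x\<in>S. te (f x) B)" "te A (sum g S) = (\<Sum>x\<in>S. te A (g x))"
  by (induction S rule: infinite_finite_induct; simp add: te_bilinear)+

subsection \<open>Multiplication and differentiation\<close>

lift_definition mulv :: "nat \<Rightarrow> monom endo" is mul_var
proof (intro conjI allI)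
  fix i c and F G :: mpol
  show "mul_var i (F + G) = mul_var i F + mul_var i G"
    by (simp add: mul_var_def distrib_left)
  have *: "c *\<^sub>c p = single 0 c * p" for p :: mpol
    by (subst (1 2) poly_mapping_sum_single[of p])
       (simp add: cscale_sum sum_distrib_left cscale_single mult_single)
  show "mul_var i (c *\<^sub>c F) = c *\<^sub>c mul_var i F"
    by (simp add: mul_var_def * mult.left_commute)
qed

lemma minus_single_add: "k - single i 1 + single i 1 = k" if "coef k i \<noteq> 0" for k :: monom
proof (rule poly_mapping_eqI)
  fix j show "coef (k - single i 1 + single i 1) j = coef k j"
    using that by (cases "j = i") (simp_all add: lookup_add lookup_minus lookup_single)
qed

text \<open>Exponents are subtracted with truncation, so \<open>k - single i 1\<close> is not the
  intended monomial when \<open>k\<close> lacks the variable; the factor \<open>coef k i\<close> is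
  then 0 and the formula survives.\<close>

lemma coef_minus_single:
  "coef (single (k - single i 1) (of_nat (coef k i) * c)) m
    = (if k = m + single i 1 then of_nat (coef m i + 1) * c else 0)" for k m :: monom and c :: complex
proof (cases "k = m + single i 1")
  case False
  then have "k - single i 1 \<noteq> m" if "coef k i \<noteq> 0"
    using minus_single_add[OF that] by metis
  then show ?thesis using False by (cases "coef k i = 0") (simp_all add: lookup_single)
qed (simp add: lookup_add)

lemma coef_pd: "coef (pd i p) m = of_nat (coef m i + 1) * coef p (m + single i 1)"
  unfolding pd_def lookup_sum coef_minus_single by (simp add: in_keys_iff)

lift_definition pdv :: "nat \<Rightarrow> monom endo" is pd
  by (auto intro!: poly_mapping_eqI simp: coef_pd lookup_add algebra_simps)

lemma mulv_single: "mulv i \<star> single m c = single (m + single i 1) c"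
  by (simp add: mulv.rep_eq mul_var_def mult_single add.commute)

lemma pdv_single: "pdv i \<star> single m c = single (m - single i 1) (of_nat (coef m i) * c)"
  by (cases "c = 0") (simp_all add: pdv.rep_eq pd_def)

lemma mulv_mulv: "mulv i * mulv j = mulv j * mulv i"
  by (rule endo_eqI) (simp add: mulv_single add_ac)

lemma pdv_pdv: "pdv i * pdv j = pdv j * pdv i"
proof (rule endo_eqI)
  fix m :: monom
  have "m - single j 1 - single i 1 = m - single i 1 - single j 1"
    by (rule poly_mapping_eqI) (simp add: lookup_minus)
  then show "pdv i * pdv j \<star> single m 1 = pdv j * pdv i \<star> single m 1"
    by (cases "i = j") (simp_all add: pdv_single lookup_minus lookup_single mult.commute)
qed

lemma pdv_mulv: "pdv i * mulv j = mulv j * pdv i + of_bool (i = j)"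
proof (rule endo_eqI)
  fix m :: monom
  show "pdv i * mulv j \<star> single m 1 = (mulv j * pdv i + of_bool (i = j)) \<star> single m 1"
  proof (cases "i = j")
    case True
    show ?thesis
    proof (cases "coef m i = 0")
      case False
      then have "m - single i 1 + single i 1 = m"
        by (rule minus_single_add)
      then show ?thesis using True
        by (simp add: pdv_single mulv_single lookup_add single_add[symmetric] add.commute)
    qed (simp add: True pdv_single mulv_single lookup_add)
  next
    case False
    then have "m + single j 1 - single i 1 = m - single i 1 + single j 1"
      by (intro poly_mapping_eqI) (auto simp: lookup_add lookup_minus lookup_single when_def)
    then show ?thesis using False
      by (simp add: pdv_single mulv_single lookup_add lookup_single)
  qed
qed

definition xm :: "nat \<Rightarrow> (monom \<times> monom) endo" where "xm i = te (mulv i) 1"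
definition xd :: "nat \<Rightarrow> (monom \<times> monom) endo" where "xd i = te (pdv i) 1"
definition qm :: "nat \<Rightarrow> (monom \<times> monom) endo" where "qm i = te 1 (mulv i)"
definition qd :: "nat \<Rightarrow> (monom \<times> monom) endo" where "qd i = te 1 (pdv i)"

lemmas endo_defs = xm_def xd_def qm_def qd_def

text \<open>Oriented towards the normal form in which multiplications by the variables precede derivatives.\<close>

lemma weyl_left:
  "xd i * xm j = xm j * xd i + of_bool (i = j)"
  "qd i * qm j = qm j * qd i + of_bool (i = j)"
  "qm i * xm j = xm j * qm i" "qm i * xd j = xd j * qm i"
  "qd i * xm j = xm j * qd i" "qd i * xd j = xd j * qd i"
  "xm i * xm j = xm j * xm i" "xd i * xd j = xd j * xd i"
  "qm i * qm j = qm j * qm i" "qd i * qd j = qd j * qd i"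
  by (auto simp: endo_defs te_times pdv_mulv te_bilinear mulv_mulv[of i j] pdv_pdv[of i j] of_bool_def)

text \<open>After \<open>mult.assoc\<close> products are nested to the right and two neighbouring
  factors need not form a subterm, hence a copy of each rule with a trailing factor
  \<open>R\<close>.\<close>

lemma weyl_left_assoc:
  "xd i * (xm j * R) = xm j * (xd i * R) + of_bool (i = j) * R"
  "qd i * (qm j * R) = qm j * (qd i * R) + of_bool (i = j) * R"
  "qm i * (xm j * R) = xm j * (qm i * R)" "qm i * (xd j * R) = xd j * (qm i * R)"
  "qd i * (xm j * R) = xm j * (qd i * R)" "qd i * (xd j * R) = xd j * (qd i * R)"
  "xm i * (xm j * R) = xm j * (xm i * R)" "xd i * (xd j * R) = xd j * (xd i * R)"
  "qm i * (qm j * R) = qm j * (qm i * R)" "qd i * (qd j * R) = qd j * (qd i * R)"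
  by (simp_all only: mult.assoc[symmetric] weyl_left[of i j] distrib_right)

lemmas weyl = weyl_left weyl_left_assoc

lemma single_app:
  "xm i \<star> single (m, a) c = single (m + single i 1, a) c"
  "qm i \<star> single (m, a) c = single (m, a + single i 1) c"
  "xd i \<star> single (m, a) c = single (m - single i 1, a) (of_nat (coef m i) * c)"
  "qd i \<star> single (m, a) c = single (m, a - single i 1) (of_nat (coef a i) * c)"
proof -
  have *: "te A B \<star> single (m, a) c = c *\<^sub>c tensor (A \<star> single m 1) (B \<star> single a 1)" for A B
    unfolding te_single[symmetric] by (simp add: cscale_single flip: app_simps(2))
  show "xm i \<star> single (m, a) c = single (m + single i 1, a) c"
    "qm i \<star> single (m, a) c = single (m, a + single i 1) c"
    "xd i \<star> single (m, a) c = single (m - single i 1, a) (of_nat (coef m i) * c)"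
    "qd i \<star> single (m, a) c = single (m, a - single i 1) (of_nat (coef a i) * c)"
    by (simp_all add: endo_defs * mulv_single pdv_single tensor_single cscale_single mult.commute)
qed

text \<open>In the monomial basis, row \<open>t\<close> of the matrix of \<open>A\<close> has at
  most one nonzero entry, namely \<open>c\<close> in column \<open>t0\<close>.\<close>

lemma coef_app_eqI:
  assumes "\<And>s. coef (A \<star> single s 1) t = (if s = t0 then c else 0)"
  shows "coef (A \<star> F) t = c * coef F t0"
  unfolding lookup_app[of A F] assms by (simp add: in_keys_iff if_distrib[of "\<lambda>x. _ * x"] cong: if_cong)

lemma coef_single_pair:
  "coef (single (m, a) c) (m', a') = (if a = a' then coef (single m c) m' else 0)"
  "coef (single (m, a) c) (m', a') = (if m = m' then coef (single a c) a' else 0)"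
  by (auto simp: lookup_single when_def)

lemma coef_xd: "coef (xd i \<star> F) (m, a) = of_nat (coef m i + 1) * coef F (m + single i 1, a)"
proof (rule coef_app_eqI)
  fix s show "coef (xd i \<star> single s 1) (m, a) = (if s = (m + single i 1, a) then of_nat (coef m i + 1) else 0)"
    by (cases s) (simp add: single_app(3) coef_single_pair(1) coef_minus_single[where c = 1, simplified] lookup_add)
qed

lemma coef_qd: "coef (qd i \<star> F) (m, a) = of_nat (coef a i + 1) * coef F (m, a + single i 1)"
proof (rule coef_app_eqI)
  fix s show "coef (qd i \<star> single s 1) (m, a) = (if s = (m, a + single i 1) then of_nat (coef a i + 1) else 0)"
    by (cases s) (simp add: single_app(4) coef_single_pair(2) coef_minus_single[where c = 1, simplified] lookup_add)
qed

lemma coef_xm: "coef (xm i \<star> F) (m + single i 1, a) = coef F (m, a)"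
proof -
  have "coef (xm i \<star> F) (m + single i 1, a) = 1 * coef F (m, a)"
  proof (rule coef_app_eqI)
    fix s show "coef (xm i \<star> single s 1) (m + single i 1, a) = (if s = (m, a) then 1 else 0)"
      by (cases s) (simp add: single_app lookup_single when_def)
  qed
  then show ?thesis by simp
qed

lemma xm_eq_0_iff [simp]: "xm i \<star> F = 0 \<longleftrightarrow> F = 0"
proof
  assume "xm i \<star> F = 0"
  then have "coef F (m, a) = 0" for m a using coef_xm[of i F m a] by simp
  then show "F = 0" by (auto intro!: poly_mapping_eqI simp: split_paired_all)
qed simp

lemma xm_xd_single: "xm i \<star> xd i \<star> single (m, a) c = single (m, a) (of_nat (coef m i) * c)"
  by (cases "coef m i = 0") (simp_all add: single_app minus_single_add[simplified])

lemma qm_qd_single: "qm i \<star> qd i \<star> single (m, a) c = single (m, a) (of_nat (coef a i) * c)"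
  by (cases "coef a i = 0") (simp_all add: single_app minus_single_add[simplified])

lemma coef_xm_xd: "coef (xm i \<star> xd i \<star> F) (m, a) = of_nat (coef m i) * coef F (m, a)"
proof -
  have "coef (xm i * xd i \<star> F) (m, a) = of_nat (coef m i) * coef F (m, a)"
  proof (rule coef_app_eqI)
    fix s show "coef (xm i * xd i \<star> single s 1) (m, a) = (if s = (m, a) then of_nat (coef m i) else 0)"
      by (cases s) (simp add: xm_xd_single lookup_single when_def)
  qed
  then show ?thesis by simp
qed

lemma coef_qm_qd: "coef (qm i \<star> qd i \<star> F) (m, a) = of_nat (coef a i) * coef F (m, a)"
proof -
  have "coef (qm i * qd i \<star> F) (m, a) = of_nat (coef a i) * coef F (m, a)"
  proof (rule coef_app_eqI)
    fix s show "coef (qm i * qd i \<star> single s 1) (m, a) = (if s = (m, a) then of_nat (coef a i) else 0)"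
      by (cases s) (simp add: qm_qd_single lookup_single when_def)
  qed
  then show ?thesis by simp
qed

section \<open>The operators of the two commuting Lie algebras\<close>

text \<open>
  \<open>Xp\<close> and \<open>Dp\<close> are \<open>X\<^sub>s\<close> and \<open>D\<^sub>s\<close> without their common factor
  \<open>\<i>\<close>. Up to constants, \<open>opE i j\<close>, \<open>opS i j\<close> and \<open>opT i j\<close> are the actions of the
  root vectors of the roots \<open>\<epsilon>\<^sub>i - \<epsilon>\<^sub>j\<close>, \<open>\<epsilon>\<^sub>i + \<epsilon>\<^sub>j\<close> and
  \<open>- \<epsilon>\<^sub>i - \<epsilon>\<^sub>j\<close>.
\<close>

definition Xp :: "nat \<Rightarrow> (monom \<times> monom) endo" where
  "Xp n = (\<Sum>j<n. xm (2*j) * qd j + xm (2*j+1) * qm j)"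

definition Dp :: "nat \<Rightarrow> (monom \<times> monom) endo" where
  "Dp n = (\<Sum>j<n. xd (2*j) * qm j - xd (2*j+1) * qd j)"

definition Eu :: "nat \<Rightarrow> (monom \<times> monom) endo" where
  "Eu n = (\<Sum>j<n. xm (2*j) * xd (2*j) + xm (2*j+1) * xd (2*j+1))"

definition opE :: "nat \<Rightarrow> nat \<Rightarrow> (monom \<times> monom) endo" where
  "opE i j = xm (2*j) * xd (2*i) - xm (2*i+1) * xd (2*j+1) + qm j * qd i"

definition opS :: "nat \<Rightarrow> nat \<Rightarrow> (monom \<times> monom) endo" where
  "opS i j = qd i * qd j - xm (2*j+1) * xd (2*i) - xm (2*i+1) * xd (2*j)"

definition opT :: "nat \<Rightarrow> nat \<Rightarrow> (monom \<times> monom) endo" where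
  "opT i j = qm i * qm j + xm (2*j) * xd (2*i+1) + xm (2*i) * xd (2*j+1)"

section \<open>Commutators of the root vectors with \<open>Xp\<close> and \<open>Dp\<close>\<close>

definition comm :: "'a::ring_1 \<Rightarrow> 'a \<Rightarrow> 'a" where "comm A B = A * B - B * A"

lemma comm_sum: "comm A (sum f S) = (\<Sum>x\<in>S. comm A (f x))" "comm (sum f S) A = (\<Sum>x\<in>S. comm (f x) A)"
  by (simp_all add: comm_def sum_distrib_left sum_distrib_right sum_subtractf)

lemmas op_defs = opE_def opS_def opT_def

text \<open>A root vector with indices \<open>i\<close>, \<open>j\<close> interacts only with the
  summands \<open>k = i\<close> and \<open>k = j\<close>, and their contributions \<open>U\<close>
  and \<open>V\<close> cancel. Two separate conditionals let \<open>i = j\<close> pass without a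
  case of its own.\<close>

lemma comm_sum_two_terms:
  fixes i j n :: nat
  assumes "\<And>k. comm A (t k) = (if k = i then U else 0) + (if k = j then V else 0)"
    and "i < n" "j < n" "U + V = 0"
  shows "comm A (\<Sum>k<n. t k) = 0"
proof -
  have "comm A (\<Sum>k<n. t k) = (\<Sum>k<n. if k = i then U else 0) + (\<Sum>k<n. if k = j then V else 0)"
    by (simp add: comm_sum assms(1) sum.distrib)
  also have "\<dots> = U + V" using assms(2,3) by (simp add: sum.delta)
  finally show ?thesis using assms(4) by simp
qed

lemma opE_Xp: assumes "i < n" "j < n" shows "comm (opE i j) (Xp n) = 0"
  unfolding Xp_def
  by (rule comm_sum_two_terms[where U = "xm (2*j) * qd i + xm (2*i+1) * qm j" and
        V = "- (xm (2*j) * qd i + xm (2*i+1) * qm j)", OF _ assms])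
    (auto simp: comm_def opE_def distrib_left distrib_right left_diff_distrib right_diff_distrib mult.assoc weyl)

lemma opS_Xp: assumes "i < n" "j < n" shows "comm (opS i j) (Xp n) = 0"
  unfolding Xp_def
  by (rule comm_sum_two_terms[where U = "xm (2*i+1) * qd j - xm (2*j+1) * qd i" and
        V = "xm (2*j+1) * qd i - xm (2*i+1) * qd j", OF _ assms])
    (auto simp: comm_def opS_def distrib_left distrib_right left_diff_distrib right_diff_distrib mult.assoc weyl)

lemma opT_Xp: assumes "i < n" "j < n" shows "comm (opT i j) (Xp n) = 0"
  unfolding Xp_def
  by (rule comm_sum_two_terms[where U = "xm (2*j) * qm i - xm (2*i) * qm j" and
        V = "xm (2*i) * qm j - xm (2*j) * qm i", OF _ assms])
    (auto simp: comm_def opT_def distrib_left distrib_right left_diff_distrib right_diff_distrib mult.assoc weyl)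

lemma opE_Dp: assumes "i < n" "j < n" shows "comm (opE i j) (Dp n) = 0"
  unfolding Dp_def
  by (rule comm_sum_two_terms[where U = "xd (2*i) * qm j - xd (2*j+1) * qd i" and
        V = "xd (2*j+1) * qd i - xd (2*i) * qm j", OF _ assms])
    (auto simp: comm_def opE_def distrib_left distrib_right left_diff_distrib right_diff_distrib mult.assoc weyl)

lemma opS_Dp: assumes "i < n" "j < n" shows "comm (opS i j) (Dp n) = 0"
  unfolding Dp_def
  by (rule comm_sum_two_terms[where U = "xd (2*i) * qd j - xd (2*j) * qd i" and
        V = "xd (2*j) * qd i - xd (2*i) * qd j", OF _ assms])
    (auto simp: comm_def opS_def distrib_left distrib_right left_diff_distrib right_diff_distrib mult.assoc weyl)

lemma opT_Dp: assumes "i < n" "j < n" shows "comm (opT i j) (Dp n) = 0"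
  unfolding Dp_def
  by (rule comm_sum_two_terms[where U = "xd (2*i+1) * qm j - xd (2*j+1) * qm i" and
        V = "xd (2*j+1) * qm i - xd (2*i+1) * qm j", OF _ assms])
    (auto simp: comm_def opT_def distrib_left distrib_right left_diff_distrib right_diff_distrib mult.assoc weyl)

lemma comm_double_sum:
  fixes n :: nat
  assumes "\<And>k l. comm (s k) (t l) = (if k = l then w l else 0)"
  shows "comm (\<Sum>k<n. s k) (\<Sum>l<n. t l) = (\<Sum>l<n. w l)"
proof -
  have "comm (\<Sum>k<n. s k) (\<Sum>l<n. t l) = (\<Sum>l<n. \<Sum>k<n. comm (s k) (t l))"
    by (simp add: comm_sum)
  also have "\<dots> = (\<Sum>l<n. w l)" by (simp add: assms sum.delta)
  finally show ?thesis .
qed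

text \<open>The sign is opposite to that of [D_s, X_s], because the two factors i that were dropped
  contribute i^2 = -1.\<close>

lemma Dp_Xp: "comm (Dp n) (Xp n) = - (Eu n + of_nat n)"
proof -
  have "comm (Dp n) (Xp n) = (\<Sum>k<n. - (xm (2*k) * xd (2*k) + xm (2*k+1) * xd (2*k+1)) - 1)"
    unfolding Dp_def Xp_def
    by (rule comm_double_sum)
      (auto simp: comm_def distrib_left distrib_right left_diff_distrib right_diff_distrib mult.assoc weyl)
  then show ?thesis by (simp add: Eu_def sum_subtractf sum_negf sum.distrib)
qed

lemma Eu_Xp: "comm (Eu n) (Xp n) = Xp n"
  unfolding Eu_def Xp_def
  by (rule comm_double_sum)
    (auto simp: comm_def distrib_left distrib_right left_diff_distrib right_diff_distrib mult.assoc weyl)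

lemma Eu_Dp: "comm (Eu n) (Dp n) = - Dp n"
proof -
  have "comm (Eu n) (Dp n) = (\<Sum>k<n. - (xd (2*k) * qm k - xd (2*k+1) * qd k))"
    unfolding Eu_def Dp_def
    by (rule comm_double_sum)
      (auto simp: comm_def distrib_left distrib_right left_diff_distrib right_diff_distrib mult.assoc weyl)
  then show ?thesis by (simp add: Dp_def sum_negf sum_subtractf)
qed

subsection \<open>The operators of the statement\<close>

lemma sum_lessThan_double: "(\<Sum>i<2*n. f i) = (\<Sum>j<n. f (2*j) + f (2*j+1))" for n :: nat
  by (induction n) (simp_all add: add.assoc)

lemma op_e_app: "op_e j = app (sc \<i> * mulv j)" and op_f_app: "op_f j = app (sc \<i> * pdv j)"
  by (simp_all add: fun_eq_iff op_e_def op_f_def mulv.rep_eq pdv.rep_eq)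

lemma id_app: "id = app 1"
  by (simp add: fun_eq_iff)

lemma te_split: "te A B = te A 1 * te 1 B"
  by (simp add: te_times)

lemma X_s_app: "X_s n F = \<i> *\<^sub>c (Xp n \<star> F)"
proof -
  have *: "mul_var i = app (mulv i)" for i by (simp add: fun_eq_iff mulv.rep_eq)
  show ?thesis
    unfolding X_s_def op_e_app op_f_app * tensor_map_app te_bilinear
    by (subst (1 2) te_split)
       (simp add: Xp_def sum_app cscale_sum cscale_add flip: xm_def qm_def qd_def)
qed

lemma D_s_app: "D_s n F = \<i> *\<^sub>c (Dp n \<star> F)"
proof -
  have *: "pd i = app (pdv i)" for i by (simp add: fun_eq_iff pdv.rep_eq)
  show ?thesis
    unfolding D_s_def op_e_app op_f_app * tensor_map_app te_bilinear
    by (subst (1 2) te_split)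
       (simp add: Dp_def sum_app cscale_sum cscale_diff flip: xd_def qm_def qd_def)
qed

lemma euler_app: "euler n F = Eu n \<star> F"
proof -
  have *: "(\<lambda>p. mul_var i (pd i p)) = app (mulv i * pdv i)" for i
    by (simp add: fun_eq_iff mulv.rep_eq pdv.rep_eq)
  show ?thesis
    unfolding euler_def * id_app tensor_map_app sum_lessThan_double
    by (simp add: Eu_def sum_app endo_defs te_times flip: app_simps)
qed

lemma euler_shift_app: "euler_shift n F = (Eu n + of_nat n) \<star> F"
  by (simp add: euler_shift_def euler_app flip: sc_simps)

subsection \<open>The symplectic Lie algebra\<close>

lemma mult_mat_vec_double:
  assumes "A \<in> carrier_mat (2*n) (2*n)" "v \<in> carrier_vec (2*n)" "r < 2*n"
  shows "(A *\<^sub>v v) $ r = (\<Sum>k<n. A $$ (r, 2*k) * v $ (2*k) + A $$ (r, 2*k+1) * v $ (2*k+1))"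
proof -
  have "(A *\<^sub>v v) $ r = (\<Sum>k<2*n. A $$ (r, k) * v $ k)"
    using assms by (simp add: scalar_prod_def lessThan_atLeast0)
  then show ?thesis unfolding sum_lessThan_double .
qed

lemma mult_mat_vec_unit:
  fixes A :: "real mat"
  assumes "A \<in> carrier_mat N N" "c < N" "r < N"
  shows "(A *\<^sub>v unit_vec N c) $ r = A $$ (r, c)"
  using assms scalar_prod_right_unit[of c N "row A r"] by simp

lemma symp_form_unit:
  assumes "k < n"
  shows "symp_form n v (unit_vec (2*n) (2*k)) = v $ (2*k+1)"
    "symp_form n v (unit_vec (2*n) (2*k+1)) = - v $ (2*k)"
    "symp_form n (unit_vec (2*n) (2*k)) v = - v $ (2*k+1)"
    "symp_form n (unit_vec (2*n) (2*k+1)) v = v $ (2*k)"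
proof -
  have *: "unit_vec (2*n) (2*k) $ (2*j) = of_bool (j = k)" "unit_vec (2*n) (2*k) $ (2*j+1) = 0"
    "unit_vec (2*n) (2*k+1) $ (2*j) = 0" "unit_vec (2*n) (2*k+1) $ (2*j+1) = of_bool (j = k)"
    if "j < n" for j
    using that assms by (auto simp: unit_vec_def) presburger+
  have d: "(\<Sum>j<n. f j * of_bool (j = k)) = f k" "(\<Sum>j<n. of_bool (j = k) * f j) = f k" for f :: "nat \<Rightarrow> real"
    using assms by (simp_all add: of_bool_def if_distrib[of "\<lambda>x. _ * x"] if_distrib[of "\<lambda>x. x * _"] cong: if_cong)
  show "symp_form n v (unit_vec (2*n) (2*k)) = v $ (2*k+1)"
    "symp_form n v (unit_vec (2*n) (2*k+1)) = - v $ (2*k)"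
    "symp_form n (unit_vec (2*n) (2*k)) v = - v $ (2*k+1)"
    "symp_form n (unit_vec (2*n) (2*k+1)) v = v $ (2*k)"
    unfolding symp_form_def
    by (simp_all add: *[simplified] d sum_negf cong: sum.cong_simp del: of_bool_eq_iff sum_mult_of_bool_eq sum_of_bool_mult_eq)
qed

text \<open>With all f-coordinates before all e-coordinates this is the block form with rows (a, b)
  and (c, -a^T), where b and c are symmetric; here the two kinds of coordinates are
  interleaved.\<close>

lemma sp_iff:
  "A \<in> sp n \<longleftrightarrow> A \<in> carrier_mat (2*n) (2*n) \<and> (\<forall>i<n. \<forall>j<n.
     A $$ (2*i+1, 2*j+1) = - A $$ (2*j, 2*i) \<and> A $$ (2*i, 2*j+1) = A $$ (2*j, 2*i+1) \<and>
     A $$ (2*i+1, 2*j) = A $$ (2*j+1, 2*i))" (is "_ \<longleftrightarrow> ?C \<and> ?R")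
proof (intro iffI conjI)
  assume A: "A \<in> sp n"
  then show C: ?C by (simp add: sp_def)
  have *: "symp_form n (A *\<^sub>v unit_vec (2*n) r) (unit_vec (2*n) c)
      + symp_form n (unit_vec (2*n) r) (A *\<^sub>v unit_vec (2*n) c) = 0" if "r < 2*n" "c < 2*n" for r c
    using A that unit_vec_carrier[of "2*n"] unfolding sp_def by blast
  show ?R
  proof (intro allI impI)
    fix i j assume ij: "i < n" "j < n"
    then have b: "2*i < 2*n" "2*i+1 < 2*n" "2*j < 2*n" "2*j+1 < 2*n" by auto
    show "A $$ (2*i+1, 2*j+1) = - A $$ (2*j, 2*i) \<and> A $$ (2*i, 2*j+1) = A $$ (2*j, 2*i+1) \<and>
        A $$ (2*i+1, 2*j) = A $$ (2*j+1, 2*i)"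
      using *[OF b(4,1)] *[OF b(2,4)] *[OF b(1,3)]
      by (simp only: symp_form_unit[OF ij(1)] symp_form_unit[OF ij(2)] mult_mat_vec_unit[OF C] b, intro conjI)
        linarith+
  qed
next
  assume "?C \<and> ?R"
  then have C: ?C and R: "\<And>i j. i < n \<Longrightarrow> j < n \<Longrightarrow> A $$ (2*i+1, 2*j+1) = - A $$ (2*j, 2*i)"
    "\<And>i j. i < n \<Longrightarrow> j < n \<Longrightarrow> A $$ (2*i, 2*j+1) = A $$ (2*j, 2*i+1)"
    "\<And>i j. i < n \<Longrightarrow> j < n \<Longrightarrow> A $$ (2*i+1, 2*j) = A $$ (2*j+1, 2*i)" by blast+
  have "symp_form n (A *\<^sub>v v) w + symp_form n v (A *\<^sub>v w) = 0"
    if v: "v \<in> carrier_vec (2*n)" and w: "w \<in> carrier_vec (2*n)" for v w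
  proof -
    let ?f = "\<lambda>j k. v $ (2*j+1) * (A $$ (2*j, 2*k) * w $ (2*k) + A $$ (2*j, 2*k+1) * w $ (2*k+1))
        - v $ (2*j) * (A $$ (2*j+1, 2*k) * w $ (2*k) + A $$ (2*j+1, 2*k+1) * w $ (2*k+1))"
    have "symp_form n v (A *\<^sub>v w) = (\<Sum>j<n. \<Sum>k<n. ?f j k)"
      unfolding symp_form_def
      by (intro sum.cong refl) (simp add: mult_mat_vec_double[OF C w] sum_distrib_left sum_subtractf del: mult_Suc_right)
    \<comment> \<open>Exchanging \<open>j\<close> and \<open>k\<close> in one of the two double sums
      makes the cancellation termwise.\<close>
    also have "\<dots> = (\<Sum>j<n. \<Sum>k<n. ?f k j)" by (rule sum.swap)
    finally have 1: "symp_form n v (A *\<^sub>v w) = (\<Sum>j<n. \<Sum>k<n. ?f k j)" .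
    have 2: "symp_form n (A *\<^sub>v v) w = (\<Sum>j<n. \<Sum>k<n.
        (A $$ (2*j+1, 2*k) * v $ (2*k) + A $$ (2*j+1, 2*k+1) * v $ (2*k+1)) * w $ (2*j)
        - (A $$ (2*j, 2*k) * v $ (2*k) + A $$ (2*j, 2*k+1) * v $ (2*k+1)) * w $ (2*j+1))"
      unfolding symp_form_def
      by (intro sum.cong refl) (simp add: mult_mat_vec_double[OF C v] sum_distrib_right sum_subtractf del: mult_Suc_right)
    show ?thesis unfolding 1 2 sum.distrib[symmetric]
    proof (intro sum.neutral ballI)
      fix j k assume "j \<in> {..<n}" "k \<in> {..<n}"
      then have jk: "j < n" "k < n" by auto
      show "(A $$ (2*j+1, 2*k) * v $ (2*k) + A $$ (2*j+1, 2*k+1) * v $ (2*k+1)) * w $ (2*j)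
        - (A $$ (2*j, 2*k) * v $ (2*k) + A $$ (2*j, 2*k+1) * v $ (2*k+1)) * w $ (2*j+1) + ?f k j = 0"
        unfolding R(1)[OF jk] R(1)[OF jk(2,1)] R(2)[OF jk] R(3)[OF jk] by (simp add: algebra_simps)
    qed
  qed
  then show "A \<in> sp n" using C by (simp add: sp_def)
qed

subsection \<open>The Segal-Shale-Weil action\<close>

lemma mulv_pdv_order:
  "pdv i * mulv j = mulv j * pdv i + of_bool (i = j)" "mulv i * mulv j = mulv j * mulv i" "pdv i * pdv j = pdv j * pdv i"
  "pdv i * (mulv j * R) = mulv j * (pdv i * R) + of_bool (i = j) * R"
  "mulv i * (mulv j * R) = mulv j * (mulv i * R)" "pdv i * (pdv j * R) = pdv j * (pdv i * R)"
proof -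
  show *: "pdv i * mulv j = mulv j * pdv i + of_bool (i = j)" "mulv i * mulv j = mulv j * mulv i" "pdv i * pdv j = pdv j * pdv i"
    using pdv_mulv mulv_mulv pdv_pdv by blast+
  show "pdv i * (mulv j * R) = mulv j * (pdv i * R) + of_bool (i = j) * R"
    "mulv i * (mulv j * R) = mulv j * (mulv i * R)" "pdv i * (pdv j * R) = pdv j * (pdv i * R)"
    by (simp_all only: mult.assoc[symmetric] * distrib_right)
qed

definition linear_op :: "nat \<Rightarrow> (nat \<Rightarrow> complex) \<Rightarrow> (nat \<Rightarrow> complex) \<Rightarrow> monom endo" where
  "linear_op n \<alpha> \<beta> = (\<Sum>i<n. sc (\<alpha> i) * mulv i + sc (\<beta> i) * pdv i)"

text \<open>The leading minus sign is the factor i^2 that arises from e = i q and f = i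
  d/dq.\<close>

definition quadratic_op :: "nat \<Rightarrow> (nat \<Rightarrow> nat \<Rightarrow> complex) \<Rightarrow> (nat \<Rightarrow> nat \<Rightarrow> complex) \<Rightarrow>
    (nat \<Rightarrow> nat \<Rightarrow> complex) \<Rightarrow> monom endo" where
  "quadratic_op n a b c = - (\<Sum>i<n. \<Sum>j<n. sc (a i j) * (mulv i * mulv j) + sc (b i j) * (pdv i * pdv j)
      + sc (c i j) * (mulv i * pdv j + pdv j * mulv i))"

lemma op_vec_app: "op_vec n v = app (linear_op n (\<lambda>i. \<i> * v $ (2*i+1)) (\<lambda>i. \<i> * v $ (2*i)))"
  by (simp add: fun_eq_iff op_vec_def linear_op_def op_e_def op_f_def mulv.rep_eq pdv.rep_eq sum_app
      mult.commute add.commute)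

lemma quadratic_ops_app:
  "quadratic_ops n = {T. \<exists>a b c :: nat \<Rightarrow> nat \<Rightarrow> real.
     T = app (quadratic_op n (\<lambda>i j. complex_of_real (a i j)) (\<lambda>i j. complex_of_real (b i j))
       (\<lambda>i j. complex_of_real (c i j)))}"
proof -
  have "(\<lambda>p. \<Sum>i<n. \<Sum>j<n. complex_of_real (a i j) *\<^sub>c op_e i (op_e j p)
      + complex_of_real (b i j) *\<^sub>c op_f i (op_f j p)
      + complex_of_real (c i j) *\<^sub>c (op_e i (op_f j p) + op_f j (op_e i p)))
    = app (quadratic_op n (\<lambda>i j. a i j) (\<lambda>i j. b i j) (\<lambda>i j. c i j))" for a b c :: "nat \<Rightarrow> nat \<Rightarrow> real"
    by (rule ext) (simp add: quadratic_op_def op_e_app op_f_app sum_app sum_negf[symmetric] cscale_add cscale_diff algebra_simps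
      del: sum_negf)
  then show ?thesis unfolding quadratic_ops_def by (simp only:)
qed

text \<open>The value on 1 shows the coefficients of the multiplications, and the constant term of
  the value on q_k shows that of the derivative. Both test polynomials lie in \<open>pols n\<close>,
  where the operators are known to agree.\<close>

lemma linear_op_eqD:
  assumes eq: "\<And>p. p \<in> pols n \<Longrightarrow> linear_op n \<alpha> \<beta> \<star> p = linear_op n \<alpha>' \<beta>' \<star> p" and k: "k < n"
  shows "\<alpha> k = \<alpha>' k" "\<beta> k = \<beta>' k"
proof -
  have mem: "single 0 1 \<in> pols n" "single (single k 1) 1 \<in> pols n"
    using k by (auto simp: pols_def)
  have inj: "single i (1::nat) = single k 1 \<longleftrightarrow> i = k" for i k :: nat
    by (metis lookup_single_eq lookup_single_not_eq one_neq_zero)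
  have nz: "single k 1 + single i (1::nat) \<noteq> 0" for i
    by (metis add_is_0 lookup_add lookup_single_eq lookup_zero one_neq_zero)
  have val: "mulv i \<star> single 0 1 = single (single i 1) 1" "pdv i \<star> single 0 1 = 0"
    "mulv i \<star> single (single k 1) 1 = single (single k 1 + single i 1) 1"
    "pdv i \<star> single (single k 1) 1 = (if i = k then single 0 1 else 0)" for i
    by (simp_all add: mulv_single pdv_single lookup_single del: single_one)
  have *: "coef (linear_op n \<alpha> \<beta> \<star> single 0 1) (single k 1) = \<alpha> k"
    "coef (linear_op n \<alpha> \<beta> \<star> single (single k 1) 1) 0 = \<beta> k" for \<alpha> \<beta>
  proof -
    have "coef (linear_op n \<alpha> \<beta> \<star> single 0 1) (single k 1) = (\<Sum>i<n. if i = k then \<alpha> i else 0)"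
      unfolding linear_op_def sum_app lookup_sum
      by (intro sum.cong refl) (simp only: app_simps val lookup_add lookup_cscale, simp add: lookup_single inj[simplified])
    then show "coef (linear_op n \<alpha> \<beta> \<star> single 0 1) (single k 1) = \<alpha> k" using k by simp
    have "coef (linear_op n \<alpha> \<beta> \<star> single (single k 1) 1) 0 = (\<Sum>i<n. if i = k then \<beta> i else 0)"
      unfolding linear_op_def sum_app lookup_sum
      by (intro sum.cong refl) (simp only: app_simps val lookup_add lookup_cscale, simp add: lookup_single nz[simplified] del: single_one)
    then show "coef (linear_op n \<alpha> \<beta> \<star> single (single k 1) 1) 0 = \<beta> k" using k by simp
  qed
  show "\<alpha> k = \<alpha>' k" "\<beta> k = \<beta>' k"
    using eq[OF mem(1)] eq[OF mem(2)] *[of \<alpha> \<beta>] *[of \<alpha>' \<beta>'] by metis+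
qed

lemma sc_two: "sc 2 * R = R + R"
  by (rule endo_ext) (simp add: cvs.scale_left_distrib[of 1 1, simplified])

lemma sc_sum: "sc (sum f S) = (\<Sum>x\<in>S. sc (f x))"
  by (induction S rule: infinite_finite_induct) simp_all

lemma sc_left:
  "mulv i * sc c = sc c * mulv i" "pdv i * sc c = sc c * pdv i"
  "mulv i * (sc c * B) = sc c * (mulv i * B)" "pdv i * (sc c * B) = sc c * (pdv i * B)"
  by (simp_all only: sc_commute mult.assoc[symmetric])

lemma double_sum_delta:
  "(\<Sum>i<n. \<Sum>j<n. (if i = k then f i j else 0)) = (\<Sum>j<n. if k < n then f k j else 0)"
  "(\<Sum>i<n. \<Sum>j<n. (if j = k then f i j else 0)) = (\<Sum>i<n. if k < n then f i k else 0)" for k n :: nat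
proof -
  show "(\<Sum>i<n. \<Sum>j<n. (if j = k then f i j else 0)) = (\<Sum>i<n. if k < n then f i k else 0)"
    by simp
  show "(\<Sum>i<n. \<Sum>j<n. (if i = k then f i j else 0)) = (\<Sum>j<n. if k < n then f k j else 0)"
    by (subst sum.swap) simp
qed

lemma comm_quadratic_pdv:
  assumes "k < n"
  shows "comm (quadratic_op n a b c) (pdv k) = linear_op n (\<lambda>i. a i k + a k i) (\<lambda>j. c k j + c k j)"
proof -
  have "comm (quadratic_op n a b c) (pdv k) = (\<Sum>i<n. \<Sum>j<n. - comm (sc (a i j) * (mulv i * mulv j) + sc (b i j) * (pdv i * pdv j)
      + sc (c i j) * (mulv i * pdv j + pdv j * mulv i)) (pdv k))"
    unfolding quadratic_op_def by (simp add: comm_def sum_distrib_left sum_distrib_right sum_subtractf)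
  also have "\<dots> = (\<Sum>i<n. \<Sum>j<n. (if i = k then sc (a i j) * mulv j + sc (c i j + c i j) * pdv j else 0)
      + (if j = k then sc (a i j) * mulv i else 0))"
    by (intro sum.cong refl)
      (auto simp: comm_def distrib_left distrib_right left_diff_distrib right_diff_distrib mult.assoc
        sc_left mulv_pdv_order sc_two)
  also have "\<dots> = linear_op n (\<lambda>i. a i k + a k i) (\<lambda>j. c k j + c k j)"
    using assms by (simp only: sum.distrib double_sum_delta if_True)
      (simp add: linear_op_def sc_two distrib_right sum.distrib)
  finally show ?thesis .
qed

lemma comm_quadratic_mulv:
  assumes "k < n"
  shows "comm (quadratic_op n a b c) (mulv k) = linear_op n (\<lambda>i. - (c i k + c i k)) (\<lambda>i. - b i k - b k i)"
proof -
  have "comm (quadratic_op n a b c) (mulv k) = (\<Sum>i<n. \<Sum>j<n. - comm (sc (a i j) * (mulv i * mulv j) + sc (b i j) * (pdv i * pdv j)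
      + sc (c i j) * (mulv i * pdv j + pdv j * mulv i)) (mulv k))"
    unfolding quadratic_op_def by (simp add: comm_def sum_distrib_left sum_distrib_right sum_subtractf)
  also have "\<dots> = (\<Sum>i<n. \<Sum>j<n. (if i = k then sc (- b i j) * pdv j else 0)
      + (if j = k then sc (- b i j) * pdv i + sc (- (c i j + c i j)) * mulv i else 0))"
    by (intro sum.cong refl)
      (auto simp: comm_def distrib_left distrib_right left_diff_distrib right_diff_distrib mult.assoc
        sc_left mulv_pdv_order sc_two)
  also have "\<dots> = linear_op n (\<lambda>i. - (c i k + c i k)) (\<lambda>i. - b i k - b k i)"
    using assms by (simp only: sum.distrib double_sum_delta if_True)
      (simp add: linear_op_def sc_two distrib_right left_diff_distrib sum.distrib sum_subtractf sum_negf)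
  finally show ?thesis .
qed

text \<open>Quadratic operators act by commutators on the span of the q_i and d/dq_i; this is the
  matrix of that action, to be matched with \<open>A\<close>.\<close>

lemma comm_quadratic_linear:
  "comm (quadratic_op n a b c) (linear_op n \<alpha> \<beta>) = linear_op n
     (\<lambda>i. (\<Sum>k<n. \<beta> k * (a i k + a k i) - \<alpha> k * (c i k + c i k)))
     (\<lambda>i. (\<Sum>k<n. \<beta> k * (c k i + c k i) - \<alpha> k * (b i k + b k i)))"
proof -
  let ?Q = "quadratic_op n a b c"
  have "comm ?Q (linear_op n \<alpha> \<beta>) = (\<Sum>k<n. sc (\<alpha> k) * comm ?Q (mulv k) + sc (\<beta> k) * comm ?Q (pdv k))"
    unfolding linear_op_def comm_sum
    by (intro sum.cong refl)
      (simp add: comm_def algebra_simps sc_commute[of ?Q] flip: mult.assoc)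
  also have "\<dots> = (\<Sum>k<n. \<Sum>i<n. sc (\<beta> k * (a i k + a k i) - \<alpha> k * (c i k + c i k)) * mulv i
      + sc (\<beta> k * (c k i + c k i) - \<alpha> k * (b i k + b k i)) * pdv i)"
    by (intro sum.cong refl)
      (simp add: comm_quadratic_mulv comm_quadratic_pdv linear_op_def sum_distrib_left algebra_simps
        sum.distrib sum_subtractf sum_negf)
  also have "\<dots> = (\<Sum>i<n. \<Sum>k<n. sc (\<beta> k * (a i k + a k i) - \<alpha> k * (c i k + c i k)) * mulv i
      + sc (\<beta> k * (c k i + c k i) - \<alpha> k * (b i k + b k i)) * pdv i)"
    by (rule sum.swap)
  also have "\<dots> = linear_op n
     (\<lambda>i. (\<Sum>k<n. \<beta> k * (a i k + a k i) - \<alpha> k * (c i k + c i k)))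
     (\<lambda>i. (\<Sum>k<n. \<beta> k * (c k i + c k i) - \<alpha> k * (b i k + b k i)))"
    unfolding linear_op_def sc_sum sum_distrib_right sum.distrib[symmetric] ..
  finally show ?thesis .
qed

text \<open>The solution of [L(A), v] = A v. Matching \<open>comm_quadratic_linear\<close> with the
  entries of \<open>A\<close> requires a_ik + a_ki = A(2i+1, 2k), b_ik + b_ki = -A(2i, 2k+1) and 2
  c_ik = A(2k, 2i); the symmetric choice of a and b gives the halves.\<close>

definition weil :: "nat \<Rightarrow> real mat \<Rightarrow> monom endo" where
  "weil n A = quadratic_op n (\<lambda>i j. complex_of_real (A $$ (2*i+1, 2*j) / 2))
     (\<lambda>i j. complex_of_real (- A $$ (2*i, 2*j+1) / 2)) (\<lambda>i j. complex_of_real (A $$ (2*j, 2*i) / 2))"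

text \<open>The products q_i q_j and the second derivatives are symmetric in their indices, so the
  operator sees only the symmetrised \<open>a\<close> and \<open>b\<close>. This is why L(A) is
  unique although its coefficients are not.\<close>

lemma quadratic_op_eqI:
  assumes "\<And>i j. i < n \<Longrightarrow> j < n \<Longrightarrow> a i j + a j i = a' i j + a' j i"
    "\<And>i j. i < n \<Longrightarrow> j < n \<Longrightarrow> b i j + b j i = b' i j + b' j i"
    "\<And>i j. i < n \<Longrightarrow> j < n \<Longrightarrow> c i j = c' i j"
  shows "quadratic_op n a b c = quadratic_op n a' b' c'"
proof -
  define h where "h = (1/2 :: complex)"
  have *: "quadratic_op n a b c = - (\<Sum>i<n. \<Sum>j<n. sc (h * (a i j + a j i)) * (mulv i * mulv j)
      + sc (h * (b i j + b j i)) * (pdv i * pdv j) + sc (c i j) * (mulv i * pdv j + pdv j * mulv i))" for a b c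
  proof -
    have sym: "(\<Sum>i<n. \<Sum>j<n. sc (f i j) * g i j) = (\<Sum>i<n. \<Sum>j<n. sc (h * (f i j + f j i)) * g i j)"
      if "\<And>i j. g i j = g j i" for f and g :: "nat \<Rightarrow> nat \<Rightarrow> monom endo"
    proof -
      have "(\<Sum>i<n. \<Sum>j<n. sc (h * f j i) * g i j) = (\<Sum>i<n. \<Sum>j<n. sc (h * f i j) * g i j)"
        by (subst sum.swap) (simp add: that)
      moreover have "(sc (f i j) :: monom endo) = sc (h * f i j) + sc (h * f i j)" for i j
        unfolding sc_simps(3)[symmetric] by (simp add: h_def del: sc_simps)
      then have "(\<Sum>i<n. \<Sum>j<n. sc (f i j) * g i j)
          = (\<Sum>i<n. \<Sum>j<n. sc (h * f i j) * g i j) + (\<Sum>i<n. \<Sum>j<n. sc (h * f i j) * g i j)"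
        by (simp only: distrib_right sum.distrib)
      ultimately show ?thesis by (simp add: distrib_left distrib_right sum.distrib del: sc_simps(6))
    qed
    show ?thesis
      unfolding quadratic_op_def sum.distrib
      by (subst (1) sym[of "\<lambda>i j. mulv i * mulv j" a], rule mulv_mulv,
          subst (1) sym[of "\<lambda>i j. pdv i * pdv j" b], rule pdv_pdv) simp
  qed
  show ?thesis unfolding * using assms by simp
qed

text \<open>For uniqueness the defining relation is tested on the basis vectors of V: each gives the
  commutator with one q_k or one d/dq_k up to a scalar, and together these determine the symmetrised
  \<open>a\<close> and \<open>b\<close> and all of \<open>c\<close>.\<close>

lemma sp_weil_app: assumes A: "A \<in> sp n" shows "sp_weil n A = app (weil n A)"
  unfolding sp_weil_def
proof (rule the_equality)
  have C: "A \<in> carrier_mat (2*n) (2*n)" and R: "\<And>i j. i < n \<Longrightarrow> j < n \<Longrightarrow> A $$ (2*i+1, 2*j+1) = - A $$ (2*j, 2*i)"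
    "\<And>i j. i < n \<Longrightarrow> j < n \<Longrightarrow> A $$ (2*i, 2*j+1) = A $$ (2*j, 2*i+1)"
    "\<And>i j. i < n \<Longrightarrow> j < n \<Longrightarrow> A $$ (2*i+1, 2*j) = A $$ (2*j+1, 2*i)" using A unfolding sp_iff by blast+
  have "weil n A \<star> op_vec n v p - op_vec n v (weil n A \<star> p) = op_vec n (A *\<^sub>v v) p"
    if v: "v \<in> carrier_vec (2*n)" for v p
  proof -
    have "weil n A \<star> op_vec n v p - op_vec n v (weil n A \<star> p)
        = comm (weil n A) (linear_op n (\<lambda>i. \<i> * v $ (2*i+1)) (\<lambda>i. \<i> * v $ (2*i))) \<star> p"
      by (simp add: comm_def op_vec_app)
    also have "\<dots> = op_vec n (A *\<^sub>v v) p"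
      unfolding op_vec_app weil_def comm_quadratic_linear
    proof (rule arg_cong[where f = "\<lambda>T. T \<star> p"], unfold linear_op_def, intro sum.cong refl, goal_cases)
      case (1 i)
      then have i: "i < n" by simp
      have "(A *\<^sub>v v) $ (2*i+1) = (\<Sum>k<n. A $$ (2*i+1, 2*k) * v $ (2*k) - A $$ (2*k, 2*i) * v $ (2*k+1))"
        using i by (subst mult_mat_vec_double[OF C v]) (auto intro!: sum.cong simp: R(1)[OF i, simplified])
      moreover have "(A *\<^sub>v v) $ (2*i) = (\<Sum>k<n. A $$ (2*i, 2*k) * v $ (2*k) + A $$ (2*i, 2*k+1) * v $ (2*k+1))"
        using i by (subst mult_mat_vec_double[OF C v]) auto
      moreover have "complex_of_real (A $$ (2*i+1, 2*k) / 2) + complex_of_real (A $$ (2*k+1, 2*i) / 2) = A $$ (2*i+1, 2*k)"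
        "complex_of_real (- A $$ (2*i, 2*k+1) / 2) + complex_of_real (- A $$ (2*k, 2*i+1) / 2) = - A $$ (2*i, 2*k+1)"
        "complex_of_real (A $$ (2*k, 2*i) / 2) + complex_of_real (A $$ (2*k, 2*i) / 2) = A $$ (2*k, 2*i)"
        "complex_of_real (A $$ (2*i, 2*k) / 2) + complex_of_real (A $$ (2*i, 2*k) / 2) = A $$ (2*i, 2*k)"
        if "k < n" for k
        using R(2,3)[OF i that] by simp_all
      ultimately show ?case
        by (simp add: sum_distrib_left algebra_simps del: sc_simps mult_Suc_right add_divide_eq_if_simps cong: sum.cong_simp)
    qed
    finally show ?thesis .
  qed
  moreover have "app (weil n A) \<in> quadratic_ops n"
    unfolding quadratic_ops_app weil_def by (intro CollectI exI) (rule refl)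
  ultimately show "app (weil n A) \<in> quadratic_ops n \<and> (\<forall>v\<in>carrier_vec (2*n). \<forall>p\<in>pols n.
      weil n A \<star> op_vec n v p - op_vec n v (weil n A \<star> p) = op_vec n (A *\<^sub>v v) p)"
    by blast
  fix T assume T: "T \<in> quadratic_ops n \<and> (\<forall>v\<in>carrier_vec (2*n). \<forall>p\<in>pols n.
      T (op_vec n v p) - op_vec n v (T p) = op_vec n (A *\<^sub>v v) p)"
  then obtain a b c :: "nat \<Rightarrow> nat \<Rightarrow> real" where
    Teq: "T = app (quadratic_op n (\<lambda>i j. complex_of_real (a i j)) (\<lambda>i j. complex_of_real (b i j))
       (\<lambda>i j. complex_of_real (c i j)))"
    unfolding quadratic_ops_app by blast
  let ?Q = "quadratic_op n (\<lambda>i j. complex_of_real (a i j)) (\<lambda>i j. complex_of_real (b i j))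
       (\<lambda>i j. complex_of_real (c i j))"
  have *: "(\<Sum>k<n. \<i> * v $ (2*k) * (complex_of_real (a i k) + a k i) - \<i> * v $ (2*k+1) * (complex_of_real (c i k) + c i k))
        = \<i> * (A *\<^sub>v v) $ (2*i+1)" (is "?l1 = _")
    "(\<Sum>k<n. \<i> * v $ (2*k) * (complex_of_real (c k i) + c k i) - \<i> * v $ (2*k+1) * (complex_of_real (b i k) + b k i))
        = \<i> * (A *\<^sub>v v) $ (2*i)" (is "?l2 = _")
    if v: "v \<in> carrier_vec (2*n)" and i: "i < n" for v i
  proof -
    have "comm ?Q (linear_op n (\<lambda>i. \<i> * v $ (2*i+1)) (\<lambda>i. \<i> * v $ (2*i))) \<star> p
        = linear_op n (\<lambda>i. \<i> * (A *\<^sub>v v) $ (2*i+1)) (\<lambda>i. \<i> * (A *\<^sub>v v) $ (2*i)) \<star> p"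
      if p: "p \<in> pols n" for p
      using T v p unfolding Teq op_vec_app by (simp add: comm_def del: index_mult_mat_vec)
    note linear_op_eqD[OF this[unfolded comm_quadratic_linear] i]
    then show "?l1 = \<i> * (A *\<^sub>v v) $ (2*i+1)" "?l2 = \<i> * (A *\<^sub>v v) $ (2*i)" by blast+
  qed
  have u: "unit_vec (2*n) (2*k) $ (2*j) = (of_bool (j = k) :: real)" "unit_vec (2*n) (2*k) $ (2*j+1) = (0 :: real)"
    "unit_vec (2*n) (2*k+1) $ (2*j) = (0 :: real)" "unit_vec (2*n) (2*k+1) $ (2*j+1) = (of_bool (j = k) :: real)"
    if "j < n" "k < n" for j k
    using that by (auto simp: unit_vec_def) presburger+
  have d: "(\<Sum>k<n. \<i> * complex_of_real (of_bool (k = m)) * f k) = \<i> * f m" if "m < n" for f m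
  proof -
    have "(\<Sum>k<n. \<i> * complex_of_real (of_bool (k = m)) * f k) = (\<Sum>k<n. if k = m then \<i> * f k else 0)"
      by (intro sum.cong refl) auto
    then show ?thesis using that by simp
  qed
  have eq: "complex_of_real (a i k) + a k i = A $$ (2*i+1, 2*k)" "complex_of_real (c k i) + c k i = A $$ (2*i, 2*k)"
    "complex_of_real (b i k) + b k i = - A $$ (2*i, 2*k+1)" if "i < n" "k < n" for i k
  proof -
    have b: "2*i < 2*n" "2*i+1 < 2*n" "2*k < 2*n" "2*k+1 < 2*n" using that by auto
    have "(\<Sum>k'<n. \<i> * complex_of_real (of_bool (k' = k)) * (complex_of_real (a i k') + a k' i)) = \<i> * A $$ (2*i+1, 2*k)"
      by (rule trans[OF _ *(1)[OF unit_vec_carrier that(1), of "2*k", unfolded mult_mat_vec_unit[OF C b(3) b(2)]]],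
          rule sum.cong[OF refl])
        (simp only: lessThan_iff u[OF _ that(2)] of_real_0 mult_zero_left mult_zero_right diff_0_right diff_0)
    then show "complex_of_real (a i k) + a k i = A $$ (2*i+1, 2*k)" unfolding d[OF that(2)] by simp
    have "(\<Sum>k'<n. \<i> * complex_of_real (of_bool (k' = k)) * (complex_of_real (c k' i) + c k' i)) = \<i> * A $$ (2*i, 2*k)"
      by (rule trans[OF _ *(2)[OF unit_vec_carrier that(1), of "2*k", unfolded mult_mat_vec_unit[OF C b(3) b(1)]]],
          rule sum.cong[OF refl])
        (simp only: lessThan_iff u[OF _ that(2)] of_real_0 mult_zero_left mult_zero_right diff_0_right diff_0)
    then show "complex_of_real (c k i) + c k i = A $$ (2*i, 2*k)" unfolding d[OF that(2)] by simp
    have "- (\<Sum>k'<n. \<i> * complex_of_real (of_bool (k' = k)) * (complex_of_real (b i k') + b k' i)) = \<i> * A $$ (2*i, 2*k+1)"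
      unfolding sum_negf[symmetric]
      by (rule trans[OF _ *(2)[OF unit_vec_carrier that(1), of "2*k+1", unfolded mult_mat_vec_unit[OF C b(4) b(1)]]],
          rule sum.cong[OF refl])
        (simp only: lessThan_iff u[OF _ that(2)] of_real_0 mult_zero_left mult_zero_right diff_0_right diff_0)
    then have "\<i> * (- (complex_of_real (b i k) + b k i)) = \<i> * A $$ (2*i, 2*k+1)"
      unfolding d[OF that(2)] mult_minus_right .
    then have "- (complex_of_real (b i k) + b k i) = A $$ (2*i, 2*k+1)"
      by (simp only: mult_cancel_left complex_i_not_zero simp_thms)
    then show "complex_of_real (b i k) + b k i = - A $$ (2*i, 2*k+1)"
      by (metis minus_minus of_real_minus)
  qed
  have "?Q = weil n A"
    unfolding weil_def
  proof (rule quadratic_op_eqI)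
    fix i j assume ij: "i < n" "j < n"
    show "complex_of_real (a i j) + a j i = complex_of_real (A $$ (2*i+1, 2*j) / 2) + complex_of_real (A $$ (2*j+1, 2*i) / 2)"
      using eq(1)[OF ij] R(3)[OF ij] by simp
    show "complex_of_real (b i j) + b j i = complex_of_real (- A $$ (2*i, 2*j+1) / 2) + complex_of_real (- A $$ (2*j, 2*i+1) / 2)"
      using eq(3)[OF ij] R(2)[OF ij] by simp
    show "complex_of_real (c i j) = complex_of_real (A $$ (2*j, 2*i) / 2)"
      using eq(2)[OF ij(2,1)] by (simp add: field_simps)
  qed
  then show "T = app (weil n A)" unfolding Teq by simp
qed

subsection \<open>The tensor product action\<close>

text \<open>The action of \<open>A\<close> in terms of root vectors. \<open>opS i j\<close> and
  \<open>opT i j\<close> occur for both orders of their indices, hence the halves; the scalar 1/2 on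
  the diagonal comes from (q d/dq + d/dq q)/2 = q d/dq + 1/2.\<close>

definition sp_op :: "nat \<Rightarrow> real mat \<Rightarrow> (monom \<times> monom) endo" where
  "sp_op n A = (\<Sum>i<n. \<Sum>j<n. sc (A $$ (2*i, 2*j+1) / 2) * opS i j
      - sc (A $$ (2*i, 2*j)) * (opE i j + sc (of_bool (i = j) / 2)) - sc (A $$ (2*i+1, 2*j) / 2) * opT i j)"

text \<open>Termwise equality may fail by an antisymmetric amount, which summation over all pairs
  removes.\<close>

lemma double_sum_antisym:
  fixes L R g :: "nat \<Rightarrow> nat \<Rightarrow> 'a::ab_group_add"
  assumes "\<And>i j. i < n \<Longrightarrow> j < n \<Longrightarrow> L i j - R i j = g i j - g j i"
  shows "(\<Sum>i<n. \<Sum>j<n. L i j) = (\<Sum>i<n. \<Sum>j<n. R i j)"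
proof -
  have "(\<Sum>i<n. \<Sum>j<n. L i j) - (\<Sum>i<n. \<Sum>j<n. R i j) = (\<Sum>i<n. \<Sum>j<n. g i j - g j i)"
    unfolding sum_subtractf[symmetric] by (intro sum.cong refl) (use assms in auto)
  also have "\<dots> = 0"
    unfolding sum_subtractf using sum.swap[of g "{..<n}" "{..<n}"] by simp
  finally show ?thesis by simp
qed

lemma sp_act_app: assumes A: "A \<in> sp n" shows "sp_act n A F = sp_op n A \<star> F"
proof -
  have R: "A $$ (2*i+1, 2*j+1) = - A $$ (2*j, 2*i)"
    "A $$ (2*i, 2*j+1) = A $$ (2*j, 2*i+1)" "A $$ (2*i+1, 2*j) = A $$ (2*j+1, 2*i)"
    if "i < n" "j < n" for i j using A that unfolding sp_iff by blast+
  let ?P = "- (\<Sum>i<2*n. \<Sum>k<2*n. sc (A $$ (i, k)) * (mulv k * pdv i)) :: monom endo"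
  have P: "sp_pol n A = app ?P"
    by (simp add: fun_eq_iff sp_pol_def sum_app mulv.rep_eq pdv.rep_eq)
  have 1: "te ?P 1 = (\<Sum>i<n. \<Sum>k<n. - (sc (A $$ (2*i, 2*k)) * (xm (2*k) * xd (2*i)) + sc (A $$ (2*i, 2*k+1)) * (xm (2*k+1) * xd (2*i)))
    - (sc (A $$ (2*i+1, 2*k)) * (xm (2*k) * xd (2*i+1)) + sc (A $$ (2*i+1, 2*k+1)) * (xm (2*k+1) * xd (2*i+1))))"
    unfolding sum_lessThan_double
    by (simp add: te_uminus te_sum te_bilinear endo_defs te_times sum.distrib sum_subtractf sum_negf del: mult_Suc_right)
  have 2: "te 1 (weil n A) = (\<Sum>i<n. \<Sum>j<n. - (sc (A $$ (2*i+1, 2*j) / 2) * (qm i * qm j))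
      + sc (A $$ (2*i, 2*j+1) / 2) * (qd i * qd j) - sc (A $$ (2*j, 2*i) / 2) * (qm i * qd j + qd j * qm i))"
    unfolding weil_def quadratic_op_def
    by (simp add: te_uminus te_sum te_bilinear endo_defs te_times sum.distrib sum_subtractf sum_negf)
  have "sp_act n A F = (te ?P 1 + te 1 (weil n A)) \<star> F"
    unfolding sp_act_def P sp_weil_app[OF A] id_app tensor_map_app by simp
  also have "te ?P 1 + te 1 (weil n A) = sp_op n A"
    unfolding 1 2 sp_op_def sum.distrib[symmetric]
  \<comment> \<open>\<open>g\<close> collects the summands that the two sides attach to transposed
    pairs of indices.\<close>
  proof (rule double_sum_antisym[where g = "\<lambda>i j. - (sc (A $$ (2*i, 2*j)) * (xm (2*i+1) * xd (2*j+1)))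
      - sc (A $$ (2*i, 2*j+1) / 2) * (xm (2*j+1) * xd (2*i)) - sc (A $$ (2*i+1, 2*j) / 2) * (xm (2*j) * xd (2*i+1))
      + sc (A $$ (2*i, 2*j) / 2) * (qm j * qd i + qm j * qd i + of_bool (i = j))"], goal_cases)
    case (1 i j)
    then have ij: "i < n" "j < n" .
    define a where "a i j = complex_of_real (A $$ (2*i, 2*j) / 2)" for i j
    define b where "b = complex_of_real (A $$ (2*i, 2*j+1) / 2)"
    define c where "c = complex_of_real (A $$ (2*i+1, 2*j) / 2)"
    have e: "complex_of_real (A $$ (2*i, 2*j)) = a i j + a i j" "complex_of_real (A $$ (2*j, 2*i)) = a j i + a j i"
      "complex_of_real (A $$ (2*i, 2*j+1)) = b + b" "complex_of_real (A $$ (2*i+1, 2*j)) = c + c"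
      by (simp_all add: a_def b_def c_def)
    have h: "sc (x + x) * sc (of_bool (i = j) / 2) = sc x * (of_bool (i = j) :: (monom \<times> monom) endo)" for x
      by (rule endo_ext) simp
    have hb: "complex_of_real (A $$ (2*i, 2*j) / 2) = a i j" "complex_of_real (A $$ (2*j, 2*i) / 2) = a j i"
      "complex_of_real (A $$ (2*i, 2*j+1) / 2) = b" "complex_of_real (A $$ (2*i+1, 2*j) / 2) = c"
      by (simp_all add: a_def b_def c_def)
    show ?case
      unfolding R(1)[OF ij] R(2)[OF ij, symmetric] R(3)[OF ij, symmetric] of_real_minus hb e distrib_left[of _ "opE i j"] h
      unfolding opE_def opS_def opT_def sc_simps(3,5)
      by (auto simp: distrib_left distrib_right left_diff_distrib right_diff_distrib weyl)
  qed
  finally show ?thesis .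
qed

definition op_closed :: "nat \<Rightarrow> spinor_pol set \<Rightarrow> bool" where
  "op_closed n W \<longleftrightarrow> cvs.subspace W \<and> (\<forall>w\<in>W. \<forall>i<n. \<forall>j<n. opE i j \<star> w \<in> W \<and> opS i j \<star> w \<in> W \<and> opT i j \<star> w \<in> W)"

lemma double_sum_two_delta:
  fixes i j n :: nat
  assumes "i < n" "j < n"
  shows "(\<Sum>a<n. \<Sum>b<n. if a = i \<and> b = j then f a b else 0) = f i j"
proof -
  have "(\<Sum>a<n. \<Sum>b<n. if a = i \<and> b = j then f a b else 0) = (\<Sum>a<n. if a = i then f a j else 0)"
    using assms by (intro sum.cong refl) auto
  then show ?thesis using assms by simp
qed

lemma opE_from_sp:
  assumes "i < n" "j < n"
  obtains A where "A \<in> sp n" "sp_op n A = - (opE i j + sc (of_bool (i = j) / 2))"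
proof
  let ?A = "mat (2*n) (2*n) (\<lambda>(r, c). if r = 2*i \<and> c = 2*j then 1 else if r = 2*j+1 \<and> c = 2*i+1 then -1 else 0) :: real mat"
  have a: "?A $$ (2*a, 2*b) = of_bool (a = i \<and> b = j)" "?A $$ (2*a+1, 2*b+1) = - of_bool (a = j \<and> b = i)"
    "?A $$ (2*a, 2*b+1) = 0" "?A $$ (2*a+1, 2*b) = 0" if "a < n" "b < n" for a b
    using that by (auto simp: Suc_double_not_eq_double double_not_eq_Suc_double)
  show "?A \<in> sp n" unfolding sp_iff
  proof (intro conjI allI impI mat_carrier, goal_cases)
    case (1 x y) show ?case unfolding a[OF 1] a[OF 1(2,1)] by (simp add: conj_commute add.commute)
  next
    case (2 x y) show ?case unfolding a[OF 2] a[OF 2(2,1)] by (simp add: conj_commute add.commute)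
  next
    case (3 x y) show ?case unfolding a[OF 3] a[OF 3(2,1)] by (simp add: conj_commute add.commute)
  qed
  have "sp_op n ?A = (\<Sum>a<n. \<Sum>b<n. if a = i \<and> b = j then - (opE a b + sc (of_bool (a = b) / 2)) else 0)"
    unfolding sp_op_def
  proof (intro sum.cong refl, goal_cases)
    case (1 x y)
    then have xy: "x < n" "y < n" by auto
    show ?case unfolding a[OF xy] by simp
  qed
  also have "\<dots> = - (opE i j + sc (of_bool (i = j) / 2))" by (rule double_sum_two_delta[OF assms])
  finally show "sp_op n ?A = - (opE i j + sc (of_bool (i = j) / 2))" .
qed

lemma opS_sym: "opS i j = opS j i" and opT_sym: "opT i j = opT j i"
  by (simp_all add: opS_def opT_def weyl[of i j] algebra_simps)

lemma sc_half_of_bool: "sc (complex_of_real ((of_bool P + of_bool Q) / 2)) * R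
    = (if P then sc (1/2) * R else 0) + (if Q then sc (1/2) * R else 0)"
proof -
  have "R = sc (1/2) * R + sc (1/2) * R"
    unfolding distrib_right[symmetric] sc_simps(3)[symmetric] by (simp del: sc_simps(3))
  then show ?thesis by (cases P; cases Q) simp_all
qed

text \<open>For \<open>i = j\<close> the two indicators add up to the entry 2, which the factor 1/2
  in \<open>sp_op\<close> turns into a single \<open>opS i i\<close>.\<close>

lemma opS_from_sp:
  assumes "i < n" "j < n"
  obtains A where "A \<in> sp n" "sp_op n A = opS i j"
proof
  let ?A = "mat (2*n) (2*n) (\<lambda>(r, c). of_bool (r = 2*i \<and> c = 2*j+1) + of_bool (r = 2*j \<and> c = 2*i+1)) :: real mat"
  have a: "?A $$ (2*a, 2*b) = 0" "?A $$ (2*a+1, 2*b+1) = 0"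
    "?A $$ (2*a, 2*b+1) = of_bool (a = i \<and> b = j) + of_bool (a = j \<and> b = i)" "?A $$ (2*a+1, 2*b) = 0" if "a < n" "b < n" for a b
    using that by (auto simp: Suc_double_not_eq_double double_not_eq_Suc_double)
  show "?A \<in> sp n" unfolding sp_iff
  proof (intro conjI allI impI mat_carrier, goal_cases)
    case (1 x y) show ?case unfolding a[OF 1] a[OF 1(2,1)] by (simp add: conj_commute add.commute)
  next
    case (2 x y) show ?case unfolding a[OF 2] a[OF 2(2,1)] by (simp add: conj_commute add.commute)
  next
    case (3 x y) show ?case unfolding a[OF 3] a[OF 3(2,1)] by (simp add: conj_commute add.commute)
  qed
  have "sp_op n ?A = (\<Sum>a<n. \<Sum>b<n. (if a = i \<and> b = j then sc (1/2) * opS a b else 0)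
      + (if a = j \<and> b = i then sc (1/2) * opS a b else 0))"
    unfolding sp_op_def
  proof (intro sum.cong refl, goal_cases)
    case (1 x y)
    then have xy: "x < n" "y < n" by auto
    show ?case unfolding a[OF xy] sc_half_of_bool by simp
  qed
  also have "\<dots> = sc (1/2) * opS i j + sc (1/2) * opS j i"
    unfolding sum.distrib by (simp only: double_sum_two_delta assms)
  also have "\<dots> = sc (1/2 + 1/2) * opS i j" by (simp only: opS_sym[of j i] sc_simps(3) distrib_right)
  finally show "sp_op n ?A = opS i j" by (simp del: sc_simps(3))
qed

lemma opT_from_sp:
  assumes "i < n" "j < n"
  obtains A where "A \<in> sp n" "sp_op n A = - opT i j"
proof
  let ?A = "mat (2*n) (2*n) (\<lambda>(r, c). of_bool (r = 2*i+1 \<and> c = 2*j) + of_bool (r = 2*j+1 \<and> c = 2*i)) :: real mat"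
  have a: "?A $$ (2*a, 2*b) = 0" "?A $$ (2*a+1, 2*b+1) = 0"
    "?A $$ (2*a+1, 2*b) = of_bool (a = i \<and> b = j) + of_bool (a = j \<and> b = i)" "?A $$ (2*a, 2*b+1) = 0" if "a < n" "b < n" for a b
    using that by (auto simp: Suc_double_not_eq_double double_not_eq_Suc_double)
  show "?A \<in> sp n" unfolding sp_iff
  proof (intro conjI allI impI mat_carrier, goal_cases)
    case (1 x y) show ?case unfolding a[OF 1] a[OF 1(2,1)] by (simp add: conj_commute add.commute)
  next
    case (2 x y) show ?case unfolding a[OF 2] a[OF 2(2,1)] by (simp add: conj_commute add.commute)
  next
    case (3 x y) show ?case unfolding a[OF 3] a[OF 3(2,1)] by (simp add: conj_commute add.commute)
  qed
  have "sp_op n ?A = (\<Sum>a<n. \<Sum>b<n. (if a = i \<and> b = j then - (sc (1/2) * opT a b) else 0)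
      + (if a = j \<and> b = i then - (sc (1/2) * opT a b) else 0))"
    unfolding sp_op_def
  proof (intro sum.cong refl, goal_cases)
    case (1 x y)
    then have xy: "x < n" "y < n" by auto
    show ?case unfolding a[OF xy] sc_half_of_bool
      by (simp only: of_real_0 div_0 sc_simps(1) mult_zero_left diff_0 minus_add_distrib if_distrib[of uminus] minus_zero)
  qed
  also have "\<dots> = - (sc (1/2) * opT i j) + - (sc (1/2) * opT j i)"
    unfolding sum.distrib by (simp only: double_sum_two_delta assms)
  also have "\<dots> = - (sc (1/2 + 1/2) * opT i j)"
    by (simp only: opT_sym[of j i] sc_simps(3) distrib_right minus_add_distrib)
  finally show "sp_op n ?A = - opT i j" by (simp del: sc_simps(3))
qed

text \<open>Each root vector comes from one real matrix, and every \<open>sp_op n A\<close> is a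
  combination of root vectors. The shift by 1/2 in the Cartan part is a scalar, which a subspace
  absorbs.\<close>

lemma sp_submodule_iff: "sp_submodule n W \<longleftrightarrow> op_closed n W"
proof
  assume W: "sp_submodule n W"
  then have sub: "cvs.subspace W" by (simp add: sp_submodule_def)
  have act: "sp_op n A \<star> w \<in> W" if "A \<in> sp n" "w \<in> W" for A w
    using W that by (metis sp_submodule_def sp_act_app)
  show "op_closed n W" unfolding op_closed_def
  proof (intro conjI sub ballI allI impI)
    fix w i j assume w: "w \<in> W" and ij: "i < n" "j < n"
    obtain A where A: "A \<in> sp n" "sp_op n A = - (opE i j + sc (of_bool (i = j) / 2))"
      using opE_from_sp[OF ij] by blast
    have "opE i j \<star> w = (-1) *\<^sub>c (sp_op n A \<star> w) - (of_bool (i = j) / 2) *\<^sub>c w"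
      by (simp add: A)
    then show "opE i j \<star> w \<in> W"
      using act[OF A(1) w] w sub by (metis cvs.subspace_diff cvs.subspace_scale)
    show "opS i j \<star> w \<in> W" using opS_from_sp[OF ij] act w by metis
    obtain A where A: "A \<in> sp n" "sp_op n A = - opT i j" using opT_from_sp[OF ij] by blast
    show "opT i j \<star> w \<in> W" using act[OF A(1) w] sub cvs.subspace_neg[of W] unfolding A by force
  qed
next
  assume W: "op_closed n W"
  then have sub: "cvs.subspace W" by (simp add: op_closed_def)
  show "sp_submodule n W" unfolding sp_submodule_def
  proof (intro conjI sub ballI)
    fix A w assume "A \<in> sp n" "w \<in> W"
    then show "sp_act n A w \<in> W"
      using W sub unfolding sp_act_app[OF \<open>A \<in> sp n\<close>] sp_op_def sum_app op_closed_def
      by (auto intro!: cvs.subspace_sum cvs.subspace_diff cvs.subspace_add cvs.subspace_scale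
          simp del: cvs.scale_left_distrib simp: cvs.scale_right_distrib)
  qed
qed

lemma cartan_sp: "cartan n i \<in> sp n"
proof -
  have a: "cartan n i $$ (2*a, 2*b) = of_bool (a = i \<and> b = i)" "cartan n i $$ (2*a+1, 2*b+1) = - of_bool (a = i \<and> b = i)"
    "cartan n i $$ (2*a, 2*b+1) = 0" "cartan n i $$ (2*a+1, 2*b) = 0" if "a < n" "b < n" for a b
    unfolding cartan_def using that by (auto simp: Suc_double_not_eq_double double_not_eq_Suc_double)
  have "cartan n i \<in> carrier_mat (2*n) (2*n)" by (simp add: cartan_def)
  then show ?thesis unfolding sp_iff
  proof (intro conjI allI impI, goal_cases)
    case (2 x y) show ?case unfolding a[OF 2(2,3)] a[OF 2(3,2)] by (simp add: conj_commute add.commute)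
  next
    case (3 x y) show ?case unfolding a[OF 3(2,3)] a[OF 3(3,2)] by (simp add: conj_commute add.commute)
  next
    case (4 x y) show ?case unfolding a[OF 4(2,3)] a[OF 4(3,2)] by (simp add: conj_commute add.commute)
  qed
qed

lemma sp_op_cartan: assumes "i < n" shows "sp_op n (cartan n i) = - (opE i i + sc (1/2))"
proof -
  have a: "cartan n i $$ (2*a, 2*b) = of_bool (a = i \<and> b = i)"
    "cartan n i $$ (2*a, 2*b+1) = 0" "cartan n i $$ (2*a+1, 2*b) = 0" if "a < n" "b < n" for a b
    unfolding cartan_def using that by (auto simp: Suc_double_not_eq_double double_not_eq_Suc_double)
  have "sp_op n (cartan n i) = (\<Sum>a<n. \<Sum>b<n. if a = i \<and> b = i then - (opE a b + sc (1/2)) else 0)"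
    unfolding sp_op_def
  proof (intro sum.cong refl, goal_cases)
    case (1 x y)
    then have xy: "x < n" "y < n" by auto
    show ?case unfolding a[OF xy] by simp
  qed
  also have "\<dots> = - (opE i i + sc (1/2))" by (rule double_sum_two_delta[OF assms assms])
  finally show ?thesis .
qed

section \<open>Supports\<close>

definition mons :: "nat \<Rightarrow> (monom \<times> monom) set" where
  "mons n = {(m, a). supp m \<subseteq> {..<2*n} \<and> supp a \<subseteq> {..<n}}"

definition xdeg :: "nat \<Rightarrow> monom \<times> monom \<Rightarrow> nat" where
  "xdeg n s = (\<Sum>i<2*n. coef (fst s) i)"

lemma subspace_supp: "cvs.subspace {F. supp F \<subseteq> S}"
proof (rule cvs.subspaceI)
  fix F G :: "'a \<Rightarrow>\<^sub>0 complex" and c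
  assume "F \<in> {F. supp F \<subseteq> S}" "G \<in> {F. supp F \<subseteq> S}"
  then show "F + G \<in> {F. supp F \<subseteq> S}" using Poly_Mapping.keys_add[of F G] by auto
  show "c *\<^sub>c F \<in> {F. supp F \<subseteq> S}" using \<open>F \<in> _\<close> by (auto simp: in_keys_iff)
qed auto

lemma subspace_mem_supp:
  assumes "cvs.subspace W" "\<And>s. s \<in> supp F \<Longrightarrow> single s 1 \<in> W"
  shows "F \<in> W"
  by (subst poly_mapping_sum_single[of F]) (auto intro!: cvs.subspace_sum cvs.subspace_scale assms)

text \<open>Both factors are spanned by monomials, so membership in the tensor product is a
  condition on supports.\<close>

lemma tensor_space_supp:
  assumes "\<And>p. p \<in> A \<longleftrightarrow> supp p \<subseteq> S" "\<And>c. c \<in> B \<longleftrightarrow> supp c \<subseteq> T"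
  shows "tensor_space A B = {F. supp F \<subseteq> S \<times> T}"
proof
  show "tensor_space A B \<subseteq> {F. supp F \<subseteq> S \<times> T}"
    unfolding tensor_space_def
    by (rule cvs.span_minimal[OF _ subspace_supp]) (use assms in \<open>auto simp: keys_tensor\<close>)
  show "{F. supp F \<subseteq> S \<times> T} \<subseteq> tensor_space A B"
  proof
    fix F :: "'a \<times> 'b \<Rightarrow>\<^sub>0 complex" assume F: "F \<in> {F. supp F \<subseteq> S \<times> T}"
    show "F \<in> tensor_space A B" unfolding tensor_space_def
    proof (rule subspace_mem_supp[OF cvs.subspace_span], intro cvs.span_base)
      fix s assume "s \<in> supp F"
      then have "single (fst s) 1 \<in> A" "single (snd s) 1 \<in> B" using F assms by auto
      moreover have "single s 1 = tensor (single (fst s) 1) (single (snd s) 1)"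
        unfolding tensor_single by simp
      ultimately show "single s 1 \<in> {tensor p c |p c. p \<in> A \<and> c \<in> B}" by blast
    qed
  qed
qed

lemma PC_eq: "PC n = {F. supp F \<subseteq> mons n}"
proof -
  have "PC n = {F. supp F \<subseteq> {m. supp m \<subseteq> {..<2*n}} \<times> {a. supp a \<subseteq> {..<n}}}"
    unfolding PC_def by (rule tensor_space_supp) (auto simp: pols_def)
  then show ?thesis by (auto simp: mons_def)
qed

lemma PC_deg_eq: "PC_deg n k = {F. supp F \<subseteq> {s \<in> mons n. xdeg n s = k}}"
proof -
  have "PC_deg n k = {F. supp F \<subseteq> {m. supp m \<subseteq> {..<2*n} \<and> (\<Sum>i<2*n. coef m i) = k} \<times> {a. supp a \<subseteq> {..<n}}}"
    unfolding PC_deg_def by (rule tensor_space_supp) (auto simp: homogeneous_pols_def pols_def)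
  then show ?thesis by (auto simp: mons_def xdeg_def)
qed

lemma subspace_PC: "cvs.subspace (PC n)" and subspace_PC_deg: "cvs.subspace (PC_deg n k)"
  unfolding PC_eq PC_deg_eq by (rule subspace_supp)+

section \<open>Operators diagonal in the monomial basis\<close>

definition diagonal :: "'a endo \<Rightarrow> ('a \<Rightarrow> complex) \<Rightarrow> bool" where
  "diagonal T t \<longleftrightarrow> (\<forall>F s. coef (T \<star> F) s = t s * coef F s)"

lemma diagonal_simps:
  "diagonal S s \<Longrightarrow> diagonal T t \<Longrightarrow> diagonal (S + T) (\<lambda>x. s x + t x)"
  "diagonal S s \<Longrightarrow> diagonal T t \<Longrightarrow> diagonal (S - T) (\<lambda>x. s x - t x)"
  "diagonal S s \<Longrightarrow> diagonal (- S) (\<lambda>x. - s x)"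
  "diagonal S s \<Longrightarrow> diagonal (sc c * S) (\<lambda>x. c * s x)"
  "diagonal (sc c) (\<lambda>x. c)" "diagonal (of_nat k) (\<lambda>x. of_nat k)"
  by (auto simp: diagonal_def lookup_add lookup_minus algebra_simps simp flip: sc_simps(7))

lemma diagonal_sum: "(\<And>i. i \<in> I \<Longrightarrow> diagonal (S i) (s i)) \<Longrightarrow> diagonal (sum S I) (\<lambda>x. \<Sum>i\<in>I. s i x)"
  by (auto simp: diagonal_def sum_app lookup_sum sum_distrib_right)

lemma diagonal_xm_xd: "diagonal (xm i * xd i) (\<lambda>s. of_nat (coef (fst s) i))"
  and diagonal_qm_qd: "diagonal (qm i * qd i) (\<lambda>s. of_nat (coef (snd s) i))"
  by (auto simp: diagonal_def coef_xm_xd coef_qm_qd)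

lemma diagonal_Eu: "diagonal (Eu n) (\<lambda>s. of_nat (xdeg n s))"
proof -
  have "diagonal (Eu n) (\<lambda>s. \<Sum>j<n. of_nat (coef (fst s) (2*j)) + of_nat (coef (fst s) (2*j+1)))"
    unfolding Eu_def by (intro diagonal_sum diagonal_simps diagonal_xm_xd)
  then show ?thesis by (simp add: xdeg_def sum_lessThan_double)
qed

lemma diagonal_eigen_iff:
  assumes "diagonal T t"
  shows "T \<star> F = c *\<^sub>c F \<longleftrightarrow> (\<forall>s\<in>supp F. t s = c)"
proof -
  have "T \<star> F = c *\<^sub>c F \<longleftrightarrow> (\<forall>s. t s * coef F s = c * coef F s)"
    using assms by (simp add: poly_mapping_eq_iff fun_eq_iff diagonal_def)
  then show ?thesis by (auto simp: in_keys_iff)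
qed

text \<open>With the degree as an Euler eigenvalue, homogeneity of an image can be read off from a
  commutator with \<open>Eu n\<close>.\<close>

lemma PC_deg_iff: "F \<in> PC_deg n k \<longleftrightarrow> F \<in> PC n \<and> Eu n \<star> F = of_nat k *\<^sub>c F"
  unfolding diagonal_eigen_iff[OF diagonal_Eu] PC_deg_eq PC_eq by auto

section \<open>Subspaces stable under operators\<close>

definition preserves :: "'a endo \<Rightarrow> ('a \<Rightarrow>\<^sub>0 complex) set \<Rightarrow> bool" where
  "preserves A W \<longleftrightarrow> (\<forall>w\<in>W. A \<star> w \<in> W)"

lemma preserves_simps:
  assumes "cvs.subspace W"
  shows "preserves A W \<Longrightarrow> preserves B W \<Longrightarrow> preserves (A + B) W"
    "preserves A W \<Longrightarrow> preserves B W \<Longrightarrow> preserves (A - B) W"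
    "preserves A W \<Longrightarrow> preserves (- A) W"
    "preserves A W \<Longrightarrow> preserves B W \<Longrightarrow> preserves (A * B) W"
    "preserves (sc c) W"
  using assms by (auto simp: preserves_def cvs.subspace_add cvs.subspace_diff cvs.subspace_scale cvs.subspace_neg)

lemma preserves_sum: "cvs.subspace W \<Longrightarrow> (\<And>i. i \<in> I \<Longrightarrow> preserves (A i) W) \<Longrightarrow> preserves (sum A I) W"
  by (auto simp: preserves_def sum_app intro!: cvs.subspace_sum)

lemma preserves_suppI:
  assumes "\<And>s. s \<in> S \<Longrightarrow> supp (A \<star> single s 1) \<subseteq> S"
  shows "preserves A {F. supp F \<subseteq> S}"
  unfolding preserves_def
proof
  fix F :: "'a \<Rightarrow>\<^sub>0 complex" assume F: "F \<in> {F. supp F \<subseteq> S}"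
  then have "\<And>s. s \<in> supp F \<Longrightarrow> A \<star> single s 1 \<in> {F. supp F \<subseteq> S}" using assms by auto
  then show "A \<star> F \<in> {F. supp F \<subseteq> S}"
    by (subst app_expand, intro cvs.subspace_sum[OF subspace_supp] cvs.subspace_scale[OF subspace_supp])
qed

lemma supp_mon:
  "supp (m + single i 1) = insert i (supp m)" "supp (m - single i 1) \<subseteq> supp m" for m :: monom
  by (auto simp: in_keys_iff lookup_add lookup_minus lookup_single when_def split: if_splits)

lemma supp_single_subset: "t \<in> S \<Longrightarrow> supp (single t c) \<subseteq> S"
  by simp

lemma preserves_PC:
  shows "i < 2 * n \<Longrightarrow> preserves (xm i) (PC n)" "i < 2 * n \<Longrightarrow> preserves (xd i) (PC n)"
    "i < n \<Longrightarrow> preserves (qm i) (PC n)" "i < n \<Longrightarrow> preserves (qd i) (PC n)"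
proof -
  have split: "preserves A (PC n)"
    if "\<And>m a. (m, a) \<in> mons n \<Longrightarrow> supp (A \<star> single (m, a) 1) \<subseteq> mons n" for A
    unfolding PC_eq by (rule preserves_suppI) (use that in auto)
  note memI = supp_single_subset[of "(x, y)" "mons n" for x y]
  show "preserves (xm i) (PC n)" if "i < 2 * n"
    by (rule split, unfold single_app, rule memI) (use that in \<open>simp add: mons_def supp_mon(1)[simplified]\<close>)
  show "preserves (xd i) (PC n)" if "i < 2 * n"
    by (rule split, unfold single_app, rule memI) (use supp_mon(2)[of _ i] in \<open>auto simp: mons_def\<close>)
  show "preserves (qm i) (PC n)" if "i < n"
    by (rule split, unfold single_app, rule memI) (use that in \<open>simp add: mons_def supp_mon(1)[simplified]\<close>)
  show "preserves (qd i) (PC n)" if "i < n"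
    by (rule split, unfold single_app, rule memI) (use supp_mon(2)[of _ i] in \<open>auto simp: mons_def\<close>)
qed

lemma preserves_PC_ops:
  shows "preserves (Xp n) (PC n)" "preserves (Dp n) (PC n)"
    "i < n \<Longrightarrow> j < n \<Longrightarrow> preserves (opE i j) (PC n)"
    "i < n \<Longrightarrow> j < n \<Longrightarrow> preserves (opS i j) (PC n)"
    "i < n \<Longrightarrow> j < n \<Longrightarrow> preserves (opT i j) (PC n)"
  unfolding Xp_def Dp_def opE_def opS_def opT_def
  by (intro preserves_sum preserves_simps preserves_PC subspace_PC; simp)+

lemma comm_app: "A \<star> B \<star> F = (B \<star> A \<star> F) + (comm A B \<star> F)"
  by (simp add: comm_def)

lemma Xp_PC_deg: "F \<in> PC_deg n k \<Longrightarrow> Xp n \<star> F \<in> PC_deg n (Suc k)"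
  using preserves_PC_ops(1)[of n] comm_app[of "Eu n" "Xp n" F]
  by (auto simp: PC_deg_iff Eu_Xp preserves_def cvs.scale_left_distrib)

lemma Dp_PC_deg: "F \<in> PC_deg n (Suc k) \<Longrightarrow> Dp n \<star> F \<in> PC_deg n k"
  using preserves_PC_ops(2)[of n] comm_app[of "Eu n" "Dp n" F]
  by (auto simp: PC_deg_iff Eu_Dp preserves_def cvs.scale_left_distrib)

text \<open>A nonzero image would have Euler degree -1.\<close>

lemma Dp_PC_deg_0: assumes "F \<in> PC_deg n 0" shows "Dp n \<star> F = 0"
proof -
  have "Eu n \<star> Dp n \<star> F = (-1) *\<^sub>c (Dp n \<star> F)"
    using comm_app[of "Eu n" "Dp n" F] assms by (simp add: PC_deg_iff Eu_Dp)
  then have *: "\<forall>s\<in>supp (Dp n \<star> F). of_nat (xdeg n s) = (-1 :: complex)"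
    by (simp only: diagonal_eigen_iff[OF diagonal_Eu])
  have "of_nat k \<noteq> (-1 :: complex)" for k
    by (metis add.commute of_nat_0_neq of_nat_Suc add.right_inverse)
  then show ?thesis using * by (metis all_not_in_conv keys_eq_empty)
qed

section \<open>The Fischer decomposition\<close>

definition ker_D :: "nat \<Rightarrow> nat \<Rightarrow> spinor_pol set" where
  "ker_D n l = {F \<in> PC_deg n l. Dp n \<star> F = 0}"

lemma subspace_ker_D: "cvs.subspace (ker_D n l)"
  using subspace_PC_deg[of n l] unfolding ker_D_def
  by (auto simp: cvs.subspace_def)

lemma Xp_pow_PC_deg: "F \<in> PC_deg n k \<Longrightarrow> Xp n ^ j \<star> F \<in> PC_deg n (k + j)"
  by (induction j) (auto simp: Xp_PC_deg)

text \<open>Moving \<open>Dp\<close> past each factor \<open>Xp\<close> costs the current eigenvalue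
  \<open>l + i + n\<close> of \<open>Eu n + of_nat n\<close>; this is the accumulated cost of
  \<open>j\<close> factors.\<close>

definition ladder :: "nat \<Rightarrow> nat \<Rightarrow> nat \<Rightarrow> complex" where
  "ladder n l j = of_nat (\<Sum>i<j. l + i + n)"

lemma ladder_nonzero: "n > 0 \<Longrightarrow> ladder n l (Suc j) \<noteq> 0"
  unfolding ladder_def of_nat_eq_0_iff by simp

lemma Dp_Xp_pow:
  assumes "F \<in> ker_D n l"
  shows "Dp n \<star> Xp n ^ Suc j \<star> F = (- ladder n l (Suc j)) *\<^sub>c (Xp n ^ j \<star> F)"
proof (induction j)
  case 0
  then show ?case using assms comm_app[of "Dp n" "Xp n" F]
    by (simp add: ker_D_def PC_deg_iff Dp_Xp ladder_def cvs.scale_left_distrib cvs.scale_left_diff_distrib flip: sc_simps(7))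
next
  case (Suc j)
  have "Eu n \<star> Xp n ^ Suc j \<star> F = of_nat (l + Suc j) *\<^sub>c (Xp n ^ Suc j \<star> F)"
    using Xp_pow_PC_deg[of F n l "Suc j"] assms by (simp only: ker_D_def PC_deg_iff mem_Collect_eq)
  then have "Dp n \<star> Xp n ^ Suc (Suc j) \<star> F
      = (- ladder n l (Suc j) - of_nat (l + Suc j) - of_nat n) *\<^sub>c (Xp n ^ Suc j \<star> F)"
    using comm_app[of "Dp n" "Xp n" "Xp n ^ Suc j \<star> F"] Suc.IH
    by (simp add: Dp_Xp algebra_simps flip: sc_simps(7))
  also have "- ladder n l (Suc j) - of_nat (l + Suc j) - of_nat n = - ladder n l (Suc (Suc j))"
    by (simp add: ladder_def)
  finally show ?case .
qed

text \<open>Applying \<open>Dp\<close> to a vanishing power lowers the exponent by one, up to a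
  nonzero factor.\<close>

lemma Xp_pow_inj:
  assumes "n > 0" "F \<in> ker_D n l" "Xp n ^ j \<star> F = 0"
  shows "F = 0"
  using assms(3)
proof (induction j)
  case (Suc j)
  have "(- ladder n l (Suc j)) *\<^sub>c (Xp n ^ j \<star> F) = 0"
    unfolding Dp_Xp_pow[OF assms(2), symmetric] Suc.prems by simp
  then show ?case using ladder_nonzero[OF assms(1), of l j] Suc.IH by simp
qed simp

lemma fischer:
  assumes "n > 0" "F \<in> PC_deg n k"
  obtains m where "\<And>l. l \<le> k \<Longrightarrow> m l \<in> ker_D n l" "F = (\<Sum>l\<le>k. Xp n ^ (k - l) \<star> m l)"
proof -
  have "\<exists>m. (\<forall>l\<le>k. m l \<in> ker_D n l) \<and> F = (\<Sum>l\<le>k. Xp n ^ (k - l) \<star> m l)"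
    using assms(2)
  proof (induction k arbitrary: F)
    case 0
    then show ?case using Dp_PC_deg_0 by (intro exI[of _ "\<lambda>l. F"]) (auto simp: ker_D_def)
  next
    case (Suc k)
    from Suc.IH[OF Dp_PC_deg[OF Suc.prems]] obtain m where
      m: "\<And>l. l \<le> k \<Longrightarrow> m l \<in> ker_D n l" and D: "Dp n \<star> F = (\<Sum>l\<le>k. Xp n ^ (k - l) \<star> m l)" by blast
    \<comment> \<open>Dividing by \<open>- ladder\<close> turns each lifted summand into a preimage
      under \<open>Dp\<close> of the corresponding summand of \<open>Dp n \<star> F\<close>. What
      remains of \<open>F\<close> after removing them lies in the kernel and becomes the component
      of degree \<open>Suc k\<close>.\<close>
    define m' where "m' l = (if l \<le> k then (- 1 / ladder n l (Suc (k - l))) *\<^sub>c m l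
      else F + (\<Sum>l\<le>k. (1 / ladder n l (Suc (k - l))) *\<^sub>c (Xp n ^ (Suc k - l) \<star> m l)))" for l
    have mK: "m' l \<in> ker_D n l" if "l \<le> k" for l
      using that cvs.subspace_neg[OF subspace_ker_D cvs.subspace_scale[OF subspace_ker_D m[OF that]]] by (simp add: m'_def)
    have "Dp n \<star> m' (Suc k) = 0"
    proof -
      have "Dp n \<star> (1 / ladder n l (Suc (k - l))) *\<^sub>c (Xp n ^ (Suc k - l) \<star> m l) = - (Xp n ^ (k - l) \<star> m l)"
        if "l \<le> k" for l
        using that Dp_Xp_pow[OF m[OF that], of "k - l"] ladder_nonzero[OF assms(1), of l "k - l"]
        by (simp add: Suc_diff_le)
      then show ?thesis by (simp add: m'_def D app_sum sum_negf)
    qed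
    moreover have "m' (Suc k) \<in> PC_deg n (Suc k)"
    proof -
      have "Xp n ^ (Suc k - l) \<star> m l \<in> PC_deg n (Suc k)" if "l \<le> k" for l
        using Xp_pow_PC_deg[of "m l" n l "Suc k - l"] m[OF that] that by (simp add: ker_D_def)
      then show ?thesis using Suc.prems
        by (simp add: m'_def) (intro cvs.subspace_add cvs.subspace_sum cvs.subspace_scale subspace_PC_deg, auto)
    qed
    ultimately have "m' (Suc k) \<in> ker_D n (Suc k)" by (simp add: ker_D_def)
    then have "\<forall>l\<le>Suc k. m' l \<in> ker_D n l" using mK by (metis le_SucE)
    moreover have "F = (\<Sum>l\<le>Suc k. Xp n ^ (Suc k - l) \<star> m' l)"
    proof -
      have "(\<Sum>l\<le>k. Xp n ^ (Suc k - l) \<star> m' l)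
          = - (\<Sum>l\<le>k. (1 / ladder n l (Suc (k - l))) *\<^sub>c (Xp n ^ (Suc k - l) \<star> m l))"
        unfolding sum_negf[symmetric] by (intro sum.cong refl) (simp add: m'_def)
      then show ?thesis by (simp add: m'_def)
    qed
    ultimately show ?case by blast
  qed
  then show ?thesis using that by blast
qed

text \<open>With h = E + n this is h^2 - h - 2 X_s D_s; the last term vanishes on Ker D_s, and the
  whole operator commutes with X_s.\<close>

definition casimir :: "nat \<Rightarrow> (monom \<times> monom) endo" where
  "casimir n = (Eu n + of_nat n) * (Eu n + of_nat n) - (Eu n + of_nat n) + 2 * (Xp n * Dp n)"

lemma casimir_ker_D: assumes "F \<in> ker_D n l"
  shows "casimir n \<star> Xp n ^ j \<star> F = of_nat ((l + n) * (l + n) - (l + n)) *\<^sub>c (Xp n ^ j \<star> F)"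
proof -
  have "casimir n * Xp n - Xp n * casimir n = 0"
  proof -
    define h where "h = Eu n + of_nat n"
    have hX: "h * Xp n = Xp n * h + Xp n" "Dp n * Xp n = Xp n * Dp n - h"
      using Eu_Xp[of n] Dp_Xp[of n] by (simp_all add: comm_def h_def algebra_simps mult_of_nat_commute)
    have hX': "h * (Xp n * R) = Xp n * (h * R) + Xp n * R" "Dp n * (Xp n * R) = Xp n * (Dp n * R) - h * R" for R
      by (simp_all only: mult.assoc[symmetric] hX distrib_right left_diff_distrib)
    show ?thesis unfolding casimir_def h_def[symmetric] mult_2
      by (simp add: distrib_left distrib_right left_diff_distrib right_diff_distrib mult.assoc hX hX')
  qed
  then have comm: "casimir n \<star> Xp n \<star> G = Xp n \<star> casimir n \<star> G" for G
    by (metis app_simps(6) eq_iff_diff_eq_0)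
  have "casimir n \<star> F = of_nat ((l + n) * (l + n) - (l + n)) *\<^sub>c F"
  proof -
    define h where "h = Eu n + of_nat n"
    have "h \<star> F = of_nat (l + n) *\<^sub>c F"
      using assms by (simp add: h_def ker_D_def PC_deg_iff cvs.scale_left_distrib flip: sc_simps(7))
    then have "casimir n \<star> F = (of_nat (l + n) * of_nat (l + n) - of_nat (l + n)) *\<^sub>c F"
      using assms unfolding casimir_def mult_2 h_def[symmetric]
      by (simp add: ker_D_def cvs.scale_left_diff_distrib del: of_nat_add)
    then show ?thesis by (simp add: of_nat_diff del: of_nat_add)
  qed
  then show ?thesis by (induction j) (simp_all add: comm)
qed

section \<open>Highest weight vectors\<close>

lemma xdeg_add: "i < 2 * n \<Longrightarrow> xdeg n (m + single i 1, a) = Suc (xdeg n (m, a))"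
  by (simp add: xdeg_def lookup_add sum.distrib lookup_single when_def)

lemma supp_xd: "(m, a) \<in> supp (xd i \<star> F) \<Longrightarrow> (m + single i 1, a) \<in> supp F"
  and supp_qd: "(m, a) \<in> supp (qd i \<star> F) \<Longrightarrow> (m, a + single i 1) \<in> supp F"
  by (auto simp: in_keys_iff coef_xd coef_qd)

lemma xd_PC_deg: assumes "i < 2 * n" "F \<in> PC_deg n (Suc l)" shows "xd i \<star> F \<in> PC_deg n l"
proof -
  have "xd i \<star> F \<in> PC n"
    using preserves_PC(2)[OF assms(1)] assms(2) by (simp add: preserves_def PC_deg_iff)
  moreover have "xdeg n s = l" if "s \<in> supp (xd i \<star> F)" for s
    using assms supp_xd[of "fst s" "snd s" i F] xdeg_add[OF assms(1), of "fst s" "snd s"] that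
    by (force simp: PC_deg_eq)
  ultimately show ?thesis by (auto simp: PC_deg_eq PC_eq)
qed

lemma xd_PC_deg_0: assumes "i < 2 * n" "F \<in> PC_deg n 0" shows "xd i \<star> F = 0"
proof -
  have False if "s \<in> supp (xd i \<star> F)" for s
    using assms supp_xd[of "fst s" "snd s" i F] xdeg_add[OF assms(1), of "fst s" "snd s"] that
    by (force simp: PC_deg_eq)
  then show ?thesis by (metis all_not_in_conv keys_eq_empty)
qed

text \<open>The eigenvalues \<open>k + t s\<close> are positive integers, so the operator is
  injective.\<close>

lemma diagonal_positive:
  assumes "diagonal T (\<lambda>s. of_nat (t s))" "k > 0" "of_nat k *\<^sub>c F + (T \<star> F) = 0"
  shows "F = 0"
proof (rule poly_mapping_eqI)
  fix s
  have "of_nat (k + t s) * coef F s = 0"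
    using arg_cong[OF assms(3), of "\<lambda>F. coef F s"] assms(1)
    by (simp add: diagonal_def lookup_add algebra_simps)
  then show "coef F s = coef 0 s" using assms(2) unfolding mult_eq_0_iff of_nat_eq_0_iff by simp
qed

lemma weyl_app:
  "qm i \<star> xm j \<star> F = xm j \<star> qm i \<star> F" "qm i \<star> xd j \<star> F = xd j \<star> qm i \<star> F"
  "qd i \<star> xm j \<star> F = xm j \<star> qd i \<star> F" "qd i \<star> xd j \<star> F = xd j \<star> qd i \<star> F"
  "xm i \<star> xm j \<star> F = xm j \<star> xm i \<star> F" "xd i \<star> xd j \<star> F = xd j \<star> xd i \<star> F"
  "qm i \<star> qm j \<star> F = qm j \<star> qm i \<star> F" "qd i \<star> qd j \<star> F = qd j \<star> qd i \<star> F"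
  by (simp_all only: app_simps(6)[symmetric] weyl_left[of i j])

lemma weyl_app_same:
  "xd i \<star> xm j \<star> F = (xm j \<star> xd i \<star> F) + (if i = j then F else 0)"
  "qd i \<star> qm j \<star> F = (qm j \<star> qd i \<star> F) + (if i = j then F else 0)"
  unfolding app_simps(6)[symmetric] weyl_left by simp_all

text \<open>
  The equations \<open>D w = 0\<close> and \<open>S\<^sub>i\<^sub>j w = 0\<close> have constant coefficients in the variables
  \<open>x\<^sub>2\<^sub>k\<close>, so their solutions are closed under \<open>\<partial>/\<partial>x\<^sub>2\<^sub>k\<close>: by induction on the degree
  all second derivatives in these variables vanish, after which the equations are linear in
  the first derivatives.
\<close>

lemma nilradical_invariant:
  assumes n: "n \<ge> 2" and "w \<in> PC_deg n l" "Dp n \<star> w = 0"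
    and "\<And>i j. i < n \<Longrightarrow> j < n \<Longrightarrow> opS i j \<star> w = 0" and "k < n"
  shows "xd (2*k) \<star> w = 0"
  using assms(2-)
proof (induction l arbitrary: w k)
  case 0
  then show ?case by (intro xd_PC_deg_0[of _ n]) auto
next
  case (Suc l)
  note D = Suc.prems(2) and S = Suc.prems(3)
  define u where "u k = xd (2*k) \<star> w" for k
  have uP: "u k \<in> PC_deg n l" if "k < n" for k
    unfolding u_def using Suc.prems(1) that by (intro xd_PC_deg) auto
  have "Dp n \<star> u k = xd (2*k) \<star> Dp n \<star> w" for k
    by (simp add: Dp_def u_def sum_app app_sum weyl_app)
  then have uD: "Dp n \<star> u k = 0" for k by (simp add: D)
  have "opS i j \<star> u k = xd (2*k) \<star> opS i j \<star> w" for i j k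
    by (simp add: opS_def u_def weyl_app weyl_app_same Suc_double_not_eq_double double_not_eq_Suc_double)
  then have uS: "opS i j \<star> u k = 0" if "i < n" "j < n" for i j k using S that by simp
  have uu: "xd (2*j) \<star> u k = 0" if "j < n" "k < n" for j k
    using Suc.IH[OF uP[OF that(2)] uD uS that(1)] by simp
  \<comment> \<open>Write y_k, z_k for the variables with indices \<open>2*k\<close>,
    \<open>2*k+1\<close>. The equations S_ij w = 0 express second q-derivatives of \<open>w\<close>
    through its y-derivatives \<open>u\<close>.\<close>
  have qq: "qd i \<star> qd j \<star> w = (xm (2*j+1) \<star> u i) + (xm (2*i+1) \<star> u j)" if "i < n" "j < n" for i j
    using S[OF that] by (simp add: opS_def u_def algebra_simps)
  \<comment> \<open>\<open>Om\<close> is the trace of the mixed derivatives d/dz_k d/dy_k w; it is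
    the term that separates the q_i-derivative of the equation Dp w = 0 from a closed linear system
    for the \<open>u i\<close>.\<close>
  define Om where "Om = (\<Sum>k<n. xd (2*k+1) \<star> u k)"
  define N where "N = n + l"
  have ez: "(\<Sum>k<n. xm (2*k+1) \<star> xd (2*k+1) \<star> u i) = of_nat l *\<^sub>c u i" if "i < n" for i
  proof -
    have "Eu n \<star> u i = of_nat l *\<^sub>c u i" using uP[OF that] by (simp add: PC_deg_iff)
    moreover have "Eu n \<star> u i = (\<Sum>k<n. xm (2*k+1) \<star> xd (2*k+1) \<star> u i)"
      unfolding Eu_def sum_app by (intro sum.cong refl) (simp add: uu that)
    ultimately show ?thesis by simp
  qed
  \<comment> \<open>The equation Dp w = 0 is differentiated by q_i and the second q-derivatives are
    replaced by \<open>qq\<close>. Of the coefficient N = n + l, the part n comes from commuting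
    d/dz_k with z_k, the part l from the Euler operator.\<close>
  have lin: "(\<Sum>k<n. qm k \<star> qd i \<star> u k) = (xm (2*i+1) \<star> Om) + of_nat N *\<^sub>c u i" if i: "i < n" for i
  proof -
    have "0 = qd i \<star> Dp n \<star> w" by (simp add: D)
    also have "\<dots> = (\<Sum>k<n. (qm k \<star> qd i \<star> u k) + (if i = k then u k else 0) - (xd (2*k+1) \<star> qd i \<star> qd k \<star> w))"
      unfolding Dp_def sum_app app_sum
      by (intro sum.cong refl) (simp add: u_def weyl_app weyl_app_same)
    also have "\<dots> = (\<Sum>k<n. (qm k \<star> qd i \<star> u k) + (if i = k then u k else 0)
        - (xm (2*i+1) \<star> xd (2*k+1) \<star> u k) - (if i = k then u k else 0) - (xm (2*k+1) \<star> xd (2*k+1) \<star> u i) - u i)"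
      by (intro sum.cong refl) (auto simp: qq[OF i, simplified] weyl_app_same)
    also have "\<dots> = (\<Sum>k<n. qm k \<star> qd i \<star> u k) - (xm (2*i+1) \<star> Om) - of_nat l *\<^sub>c u i - of_nat n *\<^sub>c u i"
    proof -
      have "(\<Sum>k<n. u i) = of_nat n *\<^sub>c u i" by (induction n) (simp_all add: cvs.scale_left_distrib)
      then show ?thesis unfolding sum_subtractf sum.distrib ez[OF i, symmetric] Om_def app_sum by simp
    qed
    finally show ?thesis by (simp add: N_def cvs.scale_left_distrib algebra_simps)
  qed
  \<comment> \<open>Summing the z_i-derivatives of \<open>lin\<close> turns its left side into the
    q_k d/dy_k applied to the sum of d/dz_i d/dq_i w. By Dp w = 0 that sum consists of the q_i u_i,
    which y-derivatives kill. On the right stands a positive operator applied to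
    \<open>Om\<close>.\<close>
  have "Om = 0"
  proof (rule diagonal_positive)
    let ?T = "\<Sum>i<n. xm (2*i+1) * xd (2*i+1)"
    have "diagonal ?T (\<lambda>s. \<Sum>i<n. of_nat (coef (fst s) (2*i+1)))"
      by (intro diagonal_sum diagonal_xm_xd)
    then show "diagonal ?T (\<lambda>s. of_nat (\<Sum>i<n. coef (fst s) (2*i+1)))" by simp
    have "(\<Sum>i<n. xd (2*i+1) \<star> (\<Sum>k<n. qm k \<star> qd i \<star> u k)) = (\<Sum>k<n. qm k \<star> xd (2*k) \<star> (\<Sum>i<n. xd (2*i+1) \<star> qd i \<star> w))"
      unfolding app_sum by (subst sum.swap) (simp add: u_def weyl_app)
    also have "(\<Sum>i<n. xd (2*i+1) \<star> qd i \<star> w) = (\<Sum>i<n. qm i \<star> u i)"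
      using D by (simp add: Dp_def sum_app sum_subtractf u_def weyl_app)
    also have "(\<Sum>k<n. qm k \<star> xd (2*k) \<star> (\<Sum>i<n. qm i \<star> u i)) = 0"
      unfolding app_sum by (intro sum.neutral ballI) (simp add: uu flip: weyl_app(2))
    finally have "0 = (\<Sum>i<n. xd (2*i+1) \<star> ((xm (2*i+1) \<star> Om) + of_nat N *\<^sub>c u i))"
      using lin by simp
    also have "\<dots> = (\<Sum>i<n. xm (2*i+1) \<star> xd (2*i+1) \<star> Om) + (\<Sum>i<n. Om) + of_nat N *\<^sub>c Om"
      unfolding Om_def cscale_sum by (simp add: weyl_app_same sum.distrib)
    also have "(\<Sum>i<n. Om) = of_nat n *\<^sub>c Om" by (induction n) (simp_all add: cvs.scale_left_distrib)
    finally show "of_nat (n + N) *\<^sub>c Om + (?T \<star> Om) = 0"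
      by (simp add: sum_app cvs.scale_left_distrib algebra_simps)
    show "n + N > 0" using n by simp
  qed
  then have lin': "(\<Sum>k<n. qm k \<star> qd i \<star> u k) = of_nat N *\<^sub>c u i" if "i < n" for i
    using lin[OF that] by simp
  have qqu: "qd j \<star> qd i \<star> u k = 0" if "i < n" "j < n" "k < n" for i j k
  proof -
    have "qd j \<star> qd i \<star> u k = xd (2*k) \<star> qd j \<star> qd i \<star> w" by (simp add: u_def weyl_app)
    then show ?thesis using that uu
      by (simp add: qq weyl_app_same Suc_double_not_eq_double double_not_eq_Suc_double)
  qed
  \<comment> \<open>Under d/dq_j only the commutator with q_j survives in \<open>lin'\<close>,
    because second q-derivatives of the \<open>u k\<close> vanish.\<close>
  have sym: "qd i \<star> u j = of_nat N *\<^sub>c (qd j \<star> u i)" if "i < n" "j < n" for i j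
  proof -
    have "of_nat N *\<^sub>c (qd j \<star> u i) = qd j \<star> (\<Sum>k<n. qm k \<star> qd i \<star> u k)" using lin'[OF that(1)] by simp
    also have "\<dots> = (\<Sum>k<n. if j = k then qd i \<star> u k else 0)"
      unfolding app_sum by (intro sum.cong refl) (simp add: weyl_app_same qqu that)
    finally show ?thesis using that by simp
  qed
  \<comment> \<open>Used twice, \<open>sym\<close> gives N^2 = 1 unless d/dq_i u_j vanishes. For n =
    1 this breaks down in degree 1: y q + z q^3/3 solves all the equations and depends on y.\<close>
  have N2: "N \<ge> 2" using n by (simp add: N_def)
  have zero: "qd i \<star> u j = 0" if "i < n" "j < n" for i j
  proof -
    have "qd i \<star> u j = of_nat (N * N) *\<^sub>c (qd i \<star> u j)"
      using sym[OF that] sym[OF that(2,1)] by simp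
    then have "(of_nat (N * N) - 1) *\<^sub>c (qd i \<star> u j) = 0" by (simp add: cvs.scale_left_diff_distrib)
    moreover have "of_nat (N * N) \<noteq> (1 :: complex)"
      using N2 unfolding of_nat_eq_1_iff by simp
    ultimately show ?thesis by simp
  qed
  have "of_nat N *\<^sub>c u k = 0" using lin'[OF Suc.prems(4)] zero[OF Suc.prems(4)] by (simp flip: lin')
  then show ?case using N2 by (simp add: u_def)
qed

lemma supp_xd_eq_0: assumes "xd i \<star> F = 0" "(m, a) \<in> supp F" shows "coef m i = 0"
proof (rule ccontr)
  assume "coef m i \<noteq> 0"
  from minus_single_add[OF this] have "coef (xd i \<star> F) (m - single i 1, a) \<noteq> 0"
    using assms(2) unfolding coef_xd mult_eq_0_iff of_nat_eq_0_iff by (simp add: in_keys_iff)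
  then show False using assms(1) by simp
qed

lemma supp_qd_eq_0: assumes "qd i \<star> F = 0" "(m, a) \<in> supp F" shows "coef a i = 0"
proof (rule ccontr)
  assume "coef a i \<noteq> 0"
  from minus_single_add[OF this] have "coef (qd i \<star> F) (m, a - single i 1) \<noteq> 0"
    using assms(2) unfolding coef_qd mult_eq_0_iff of_nat_eq_0_iff by (simp add: in_keys_iff)
  then show False using assms(1) by simp
qed

text \<open>Once the y-derivatives vanish, S_ij w = 0 makes \<open>w\<close> at most linear in q.
  The equations E_ij w = 0 and Dp w = 0 then remove every q_i but the last and every z_j but the
  first.\<close>

lemma highest_weight_supp:
  assumes n: "n \<ge> 2" and w: "w \<in> ker_D n l"
    and S: "\<And>i j. i < n \<Longrightarrow> j < n \<Longrightarrow> opS i j \<star> w = 0"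
    and E: "\<And>i j. i < j \<Longrightarrow> j < n \<Longrightarrow> opE i j \<star> w = 0"
  shows "supp w \<subseteq> {(single 1 l, 0), (single 1 l, single (n-1) 1)}"
proof -
  have D: "Dp n \<star> w = 0" and wP: "w \<in> PC_deg n l" using w by (auto simp: ker_D_def)
  have y: "xd (2*k) \<star> w = 0" if "k < n" for k
    by (rule nilradical_invariant[OF n wP D S that])
  have qq: "qd i \<star> qd j \<star> w = 0" if "i < n" "j < n" for i j
    using S[OF that] y that by (simp add: opS_def)
  define g where "g k = qd k \<star> w" for k
  have E': "qm j \<star> g i = xm (2*i+1) \<star> xd (2*j+1) \<star> w" if "i < j" "j < n" for i j
    using E[OF that] y[of i] that by (simp add: opE_def g_def)
  \<comment> \<open>This is the q_k-derivative of \<open>E'\<close>; second q-derivatives of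
    \<open>w\<close> are zero, so only the commutator with q_j survives on the left.\<close>
  have g: "(if k = j then g i else 0) = xm (2*i+1) \<star> xd (2*j+1) \<star> g k" if "i < j" "j < n" "k < n" for i j k
  proof -
    have "qd k \<star> qm j \<star> g i = qd k \<star> xm (2*i+1) \<star> xd (2*j+1) \<star> w" using E' that by simp
    then show ?thesis using qq[of k i] that by (auto simp: weyl_app weyl_app_same g_def split: if_splits)
  qed
  define L where "L = n - 1"
  have L: "L < n" "0 < L" "n = Suc L" using n by (auto simp: L_def)
  \<comment> \<open>Taking both \<open>j\<close> and \<open>k\<close> to be the last index in
    \<open>g\<close> gives g_i = z_i h for all smaller i. Inserted in Dp w = 0 this reads (n + sum
    of z_i d/dz_i over i < L) h = 0.\<close>
  define h where "h = xd (2*L+1) \<star> g L"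
  have gi: "g i = xm (2*i+1) \<star> h" if "i < L" for i
    using g[of i L L] that L by (simp add: h_def)
  have "h = 0"
  proof (rule diagonal_positive)
    let ?T = "\<Sum>i<L. xm (2*i+1) * xd (2*i+1)"
    have "diagonal ?T (\<lambda>s. \<Sum>i<L. of_nat (coef (fst s) (2*i+1)))"
      by (intro diagonal_sum diagonal_xm_xd)
    then show "diagonal ?T (\<lambda>s. of_nat (\<Sum>i<L. coef (fst s) (2*i+1)))" by simp
    have "0 = (\<Sum>k<n. xd (2*k+1) \<star> g k)"
      using D y by (simp add: Dp_def sum_app g_def weyl_app sum_negf flip: weyl_app(2))
    also have "\<dots> = (\<Sum>k<L. xd (2*k+1) \<star> xm (2*k+1) \<star> h) + h"
      by (simp add: L(3) gi h_def)
    also have "\<dots> = (?T \<star> h) + (\<Sum>k<L. h) + h" by (simp add: weyl_app_same sum.distrib sum_app)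
    also have "(\<Sum>k<L. h) = of_nat L *\<^sub>c h" by (induction L) (simp_all add: cvs.scale_left_distrib)
    finally show "of_nat n *\<^sub>c h + (?T \<star> h) = 0" by (simp add: L(3) cvs.scale_left_distrib algebra_simps)
    show "n > 0" using n by simp
  qed
  then have q: "qd i \<star> w = 0" if "i < L" for i using gi[OF that] by (simp add: g_def)
  have z: "xd (2*j+1) \<star> w = 0" if "0 < j" "j < n" for j
    using E'[OF that] q[OF L(2)] by (simp add: g_def)
  show ?thesis
  proof
    fix s assume s: "s \<in> supp w"
    obtain m a where ma: "s = (m, a)" by fastforce
    have mons: "supp m \<subseteq> {..<2*n}" "supp a \<subseteq> {..<n}" "xdeg n (m, a) = l"
      using s wP by (auto simp: PC_deg_eq mons_def ma)
    have m0: "coef m i = 0" if "i \<noteq> 1" for i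
    proof (cases "i < 2 * n")
      case True
      show ?thesis
      proof (cases "even i")
        case True
        then have "xd i \<star> w = 0" using y[of "i div 2"] \<open>i < 2 * n\<close> by auto
        then show ?thesis using supp_xd_eq_0 s ma by blast
      next
        case False
        then have "xd i \<star> w = 0" using z[of "i div 2"] \<open>i < 2 * n\<close> that by (auto elim!: oddE)
        then show ?thesis using supp_xd_eq_0 s ma by blast
      qed
    qed (use mons(1) in \<open>auto simp: in_keys_iff\<close>)
    have "l = (\<Sum>i<2*n. if i = 1 then coef m 1 else 0)"
      unfolding mons(3)[symmetric] xdeg_def by (intro sum.cong) (auto simp: m0)
    then have "coef m 1 = l" using n by simp
    then have m: "m = single 1 l" using m0 by (intro poly_mapping_eqI) (auto simp: lookup_single when_def)
    have a0: "coef a i = 0" if "i \<noteq> L" for i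
    proof (cases "i < n")
      case True
      then have "i < L" using that L by simp
      then show ?thesis using supp_qd_eq_0[OF q] s ma by blast
    qed (use mons(2) in \<open>auto simp: in_keys_iff\<close>)
    have aL: "coef a L \<le> 1"
    proof (rule ccontr)
      assume "\<not> coef a L \<le> 1"
      then have *: "coef a L \<noteq> 0" "coef (a - single L 1) L \<noteq> 0" by (auto simp: lookup_minus lookup_single)
      from minus_single_add[OF *(1)] have "(m, a - single L 1) \<in> supp (qd L \<star> w)"
        using s unfolding in_keys_iff coef_qd mult_eq_0_iff of_nat_eq_0_iff ma by simp
      then have "coef (a - single L 1) L = 0" by (rule supp_qd_eq_0[OF qq[OF L(1) L(1)]])
      then show False using *(2) by contradiction
    qed
    have "a = single L (coef a L)" using a0 by (intro poly_mapping_eqI) (auto simp: lookup_single when_def)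
    then have "a = 0 \<or> a = single L 1" using aL by (cases "coef a L") (auto simp: le_Suc_eq)
    then show "s \<in> {(single 1 l, 0), (single 1 l, single (n-1) 1)}" by (auto simp: ma m L_def)
  qed
qed

section \<open>A contravariant bilinear form\<close>

text \<open>The value of a Fischer form on a monomial and itself: the factorial of the exponents
  times \<kappa> to the degree. Multiplication by a variable is then adjoint to \<kappa> times the
  derivative.\<close>

definition mweight :: "complex \<Rightarrow> monom \<Rightarrow> complex" where
  "mweight \<kappa> m = (\<Prod>i\<in>supp m. \<kappa> ^ coef m i * fact (coef m i))"

lemma mweight_nonzero: "\<kappa> \<noteq> 0 \<Longrightarrow> mweight \<kappa> m \<noteq> 0"
  by (simp add: mweight_def)

lemma mweight_add: "mweight \<kappa> (m + single i 1) = \<kappa> * of_nat (coef m i + 1) * mweight \<kappa> m"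
proof -
  let ?f = "\<lambda>m j. \<kappa> ^ coef m j * fact (coef m j)" and ?S = "supp m - {i}"
  have *: "mweight \<kappa> m = ?f m i * (\<Prod>j\<in>?S. ?f m j)"
  proof -
    have "mweight \<kappa> m = (\<Prod>j\<in>insert i ?S. ?f m j)"
      unfolding mweight_def by (rule prod.mono_neutral_left) (auto simp: in_keys_iff)
    also have "\<dots> = ?f m i * (\<Prod>j\<in>?S. ?f m j)" by (rule prod.insert) auto
    finally show ?thesis .
  qed
  have "mweight \<kappa> (m + single i 1) = (\<Prod>j\<in>insert i ?S. ?f (m + single i 1) j)"
    unfolding mweight_def by (rule prod.mono_neutral_left) (auto simp: in_keys_iff lookup_add lookup_single when_def split: if_splits)
  also have "\<dots> = ?f (m + single i 1) i * (\<Prod>j\<in>?S. ?f (m + single i 1) j)"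
    by (rule prod.insert) auto
  also have "(\<Prod>j\<in>?S. ?f (m + single i 1) j) = (\<Prod>j\<in>?S. ?f m j)"
    by (rule prod.cong) (auto simp: lookup_add lookup_single)
  also have "?f (m + single i 1) i = \<kappa> * of_nat (coef m i + 1) * ?f m i"
    by (simp add: lookup_add algebra_simps)
  finally show ?thesis unfolding * by simp
qed

text \<open>The factor \<open>\<i>\<close> per variable \<open>q\<^sub>j\<close> makes \<open>S\<^sub>i\<^sub>j\<close> and \<open>- T\<^sub>i\<^sub>j\<close> adjoint to each other.\<close>

definition bw :: "monom \<times> monom \<Rightarrow> complex" where
  "bw s = mweight 1 (fst s) * mweight \<i> (snd s)"

lemma bw_nonzero: "bw s \<noteq> 0"
  by (simp add: bw_def mweight_nonzero)

text \<open>Bilinear, without conjugation: scalars, in particular the factors i in the adjoints of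
  the q-operators, are self-adjoint, and the form is symmetric although its weights are not
  real.\<close>

definition form :: "spinor_pol \<Rightarrow> spinor_pol \<Rightarrow> complex" where
  "form F G = (\<Sum>s\<in>supp F. bw s * coef F s * coef G s)"

lemma form_superset: "finite S \<Longrightarrow> supp F \<subseteq> S \<Longrightarrow> form F G = (\<Sum>s\<in>S. bw s * coef F s * coef G s)"
  unfolding form_def by (rule sum.mono_neutral_left) (auto simp: in_keys_iff)

lemma form_commute: "form F G = form G F"
proof -
  have "form F G = (\<Sum>s\<in>supp F \<union> supp G. bw s * coef F s * coef G s)"
    by (rule form_superset) auto
  also have "\<dots> = form G F" by (subst form_superset[of "supp F \<union> supp G"]) (auto simp: mult_ac)
  finally show ?thesis .
qed

lemma form_add_right: "form F (G + H) = form F G + form F H"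
  and form_scale_right: "form F (c *\<^sub>c G) = c * form F G"
  and form_zero_right: "form F 0 = 0"
  by (simp_all add: form_def lookup_add algebra_simps sum.distrib sum_distrib_left)

lemma form_add_left: "form (G + H) F = form G F + form H F"
  and form_scale_left: "form (c *\<^sub>c G) F = c * form G F"
  and form_zero_left: "form 0 F = 0"
  by (simp_all add: form_commute[of _ F] form_add_right form_scale_right form_zero_right)

lemma form_sum_left: "form (sum f S) G = (\<Sum>x\<in>S. form (f x) G)"
  by (induction S rule: infinite_finite_induct) (simp_all add: form_add_left form_zero_left)

lemma form_single: "form (single s c) G = bw s * c * coef G s"
  by (cases "c = 0") (simp_all add: form_def)

definition adj :: "(monom \<times> monom) endo \<Rightarrow> (monom \<times> monom) endo \<Rightarrow> bool" where
  "adj A B \<longleftrightarrow> (\<forall>F G. form (A \<star> F) G = form F (B \<star> G))"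

text \<open>Linearity in the first argument reduces adjointness to monomials there, against which
  the form reads off a single coefficient.\<close>

lemma adjI:
  assumes "\<And>s G. form (A \<star> single s 1) G = bw s * coef (B \<star> G) s"
  shows "adj A B"
  unfolding adj_def
proof (intro allI)
  fix F G
  have "form (A \<star> F) G = (\<Sum>s\<in>supp F. coef F s * (bw s * coef (B \<star> G) s))"
    by (subst app_expand) (simp add: form_sum_left form_scale_left assms)
  then show "form (A \<star> F) G = form F (B \<star> G)" by (simp add: form_def mult_ac)
qed

lemma adj_simps:
  "adj A A' \<Longrightarrow> adj B B' \<Longrightarrow> adj (A + B) (A' + B')"
  "adj A A' \<Longrightarrow> adj B B' \<Longrightarrow> adj (A - B) (A' - B')"
  "adj A A' \<Longrightarrow> adj B B' \<Longrightarrow> adj (A * B) (B' * A')"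
  "adj A A' \<Longrightarrow> adj (sc c * A) (sc c * A')"
  "adj A A' \<Longrightarrow> adj A' A"
proof -
  assume "adj A A'" "adj B B'"
  then show "adj (A - B) (A' - B')"
    unfolding adj_def
    by (simp add: form_add_left form_scale_left form_add_right form_scale_right
        diff_conv_add_uminus[of _ "_ \<star> _"] cvs.scale_minus_left[of 1, symmetric, simplified]
        del: add_uminus_conv_diff cvs.scale_minus_left)
      (metis add_uminus_conv_diff cvs.scale_minus_left cvs.scale_one form_scale_left form_scale_right)
qed (auto simp: adj_def form_add_left form_scale_left form_add_right form_scale_right form_commute)

lemma adj_sum: "(\<And>i. i \<in> I \<Longrightarrow> adj (A i) (B i)) \<Longrightarrow> adj (sum A I) (sum B I)"
  by (induction I rule: infinite_finite_induct)
    (auto intro!: adj_simps(1) simp: adj_def[of 0] form_zero_left form_zero_right)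

lemma adj_xm: "adj (xm i) (xd i)"
proof (rule adjI)
  fix s G show "form (xm i \<star> single s 1) G = bw s * coef (xd i \<star> G) s"
    using mweight_add[of 1 "fst s" i]
    by (cases s) (simp add: single_app form_single coef_xd bw_def)
qed

lemma adj_qm: "adj (qm i) (sc \<i> * qd i)"
proof (rule adjI)
  fix s G show "form (qm i \<star> single s 1) G = bw s * coef (sc \<i> * qd i \<star> G) s"
    using mweight_add[of \<i> "snd s" i]
    by (cases s) (simp add: single_app form_single coef_qd bw_def)
qed

lemma adj_qd: "adj (qd i) (sc (- \<i>) * qm i)"
proof -
  have "adj (sc (- \<i>) * (sc \<i> * qd i)) (sc (- \<i>) * qm i)"
    by (intro adj_simps(4) adj_simps(5)[OF adj_qm])
  moreover have "sc (- \<i>) * (sc \<i> * qd i) = qd i"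
    unfolding mult.assoc[symmetric] sc_simps(6)[symmetric] by simp
  ultimately show ?thesis by simp
qed

lemmas adj_basic = adj_xm adj_simps(5)[OF adj_xm] adj_qm adj_qd

lemma sc_i: "sc \<i> * (sc \<i> * A) = - A" "sc \<i> * (A * (sc \<i> * B)) = - (A * B)"
  by (rule endo_ext; simp)+

text \<open>The factors -i and i in the adjoints of d/dq_i and q_j cancel, so the q-part transposes
  exactly like the x-part.\<close>

lemma adj_opE: "adj (opE i j) (opE j i)"
proof -
  have "adj (opE i j) (xm (2*i) * xd (2*j) - xm (2*j+1) * xd (2*i+1) + (sc (- \<i>) * qm i) * (sc \<i> * qd j))"
    unfolding opE_def by (intro adj_simps(1-3) adj_basic)
  also have "\<dots> = opE j i" unfolding opE_def by (simp add: mult.assoc sc_i)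
  finally show ?thesis .
qed

lemma adj_opT: "adj (opT i j) (- opS i j)"
proof -
  have "adj (opT i j) ((sc \<i> * qd j) * (sc \<i> * qd i) + xm (2*i+1) * xd (2*j) + xm (2*j+1) * xd (2*i))"
    unfolding opT_def by (intro adj_simps(1-3) adj_basic)
  also have "\<dots> = - opS i j" unfolding opS_def by (simp add: mult.assoc sc_i weyl_left(10)[of j i])
  finally show ?thesis .
qed

lemma adj_Xp: "adj (Xp n) (sc (- \<i>) * Dp n)"
proof -
  have "adj (Xp n) (\<Sum>j<n. (sc (- \<i>) * qm j) * xd (2*j) + (sc \<i> * qd j) * xd (2*j+1))"
    unfolding Xp_def by (intro adj_sum adj_simps(1,3) adj_basic)
  also have "\<dots> = sc (- \<i>) * Dp n"
    unfolding Dp_def sum_distrib_left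
    by (intro sum.cong refl) (simp add: mult.assoc weyl right_diff_distrib)
  finally show ?thesis .
qed

section \<open>Projections onto sets of monomials\<close>

lift_definition keep :: "('a \<Rightarrow> bool) \<Rightarrow> 'a endo" is
  "\<lambda>P F. Abs_poly_mapping (\<lambda>s. coef F s when P s)"
proof -
  fix P :: "'a \<Rightarrow> bool"
  have *: "coef (Abs_poly_mapping (\<lambda>s. coef F s when P s)) = (\<lambda>s. coef F s when P s)" for F :: "'a \<Rightarrow>\<^sub>0 complex"
    by (rule lookup_Abs_poly_mapping) (rule finite_subset[OF _ finite_lookup[of F]], auto simp: when_def)
  show "(\<forall>F G :: 'a \<Rightarrow>\<^sub>0 complex. Abs_poly_mapping (\<lambda>s. coef (F + G) s when P s)
        = Abs_poly_mapping (\<lambda>s. coef F s when P s) + Abs_poly_mapping (\<lambda>s. coef G s when P s)) \<and>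
      (\<forall>c F. Abs_poly_mapping (\<lambda>s. coef (c *\<^sub>c F) s when P s) = c *\<^sub>c Abs_poly_mapping (\<lambda>s. coef F s when P s))"
    by (intro conjI allI poly_mapping_eqI;
      simp only: * lookup_add[of "Abs_poly_mapping _"] lookup_cscale[of _ "Abs_poly_mapping _"];
      simp add: lookup_add when_def)
qed

lemma coef_keep: "coef (keep P \<star> F) s = (if P s then coef F s else 0)"
proof -
  have "coef (Abs_poly_mapping (\<lambda>s. coef F s when P s)) = (\<lambda>s. coef F s when P s)"
    by (rule lookup_Abs_poly_mapping) (rule finite_subset[OF _ finite_lookup[of F]], auto simp: when_def)
  then show ?thesis by (simp add: keep.rep_eq when_def)
qed

lemma supp_keep: "supp (keep P \<star> F) = {s \<in> supp F. P s}"
  by (auto simp: in_keys_iff coef_keep split: if_splits)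

lemma adj_keep: "adj (keep P) (keep P)"
proof (rule adjI)
  fix s G
  have "keep P \<star> single s 1 = (if P s then single s 1 else 0)"
    by (rule poly_mapping_eqI) (auto simp: coef_keep lookup_single when_def)
  then show "form (keep P \<star> single s 1) G = bw s * coef (keep P \<star> G) s"
    by (simp add: form_single coef_keep form_zero_left)
qed

text \<open>Lagrange interpolation: on \<open>F\<close> the projection is given by the polynomial in
  \<open>T\<close> that is 1 at \<tau> and 0 at the other eigenvalues occurring in \<open>F\<close>,
  finitely many since the support is finite.\<close>

lemma diagonal_component:
  assumes T: "diagonal T t" and U: "cvs.subspace U" "preserves T U" and F: "F \<in> U"
  shows "keep (\<lambda>s. t s = \<tau>) \<star> F \<in> U"
proof -
  have *: "\<exists>G\<in>U. \<forall>s. coef G s = coef F s * (\<Prod>b\<in>B. (t s - b) / (\<tau> - b))" if "finite B" for B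
    using that
  proof (induction B)
    case empty
    then show ?case using F by auto
  next
    case (insert b B)
    then obtain G where G: "G \<in> U" "\<And>s. coef G s = coef F s * (\<Prod>b\<in>B. (t s - b) / (\<tau> - b))" by blast
    let ?G = "(1 / (\<tau> - b)) *\<^sub>c ((T \<star> G) - b *\<^sub>c G)"
    have "?G \<in> U" using U G(1) by (auto simp: preserves_def intro!: cvs.subspace_scale cvs.subspace_diff)
    moreover have "coef ?G s = coef F s * (\<Prod>b\<in>insert b B. (t s - b) / (\<tau> - b))" for s
      using T insert.hyps by (simp add: diagonal_def lookup_minus G(2) algebra_simps diff_divide_distrib)
    ultimately show ?case by blast
  qed
  obtain G where G: "G \<in> U" "\<And>s. coef G s = coef F s * (\<Prod>b\<in>t ` supp F - {\<tau>}. (t s - b) / (\<tau> - b))"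
    using *[of "t ` supp F - {\<tau>}"] by auto
  have "coef G s = coef (keep (\<lambda>s. t s = \<tau>) \<star> F) s" for s
  proof (cases "t s = \<tau>")
    case True
    then show ?thesis by (simp add: G(2) coef_keep)
  next
    case False
    then show ?thesis by (cases "s \<in> supp F") (auto simp: G(2) coef_keep in_keys_iff intro!: bexI[of _ s])
  qed
  then have "G = keep (\<lambda>s. t s = \<tau>) \<star> F" by (rule poly_mapping_eqI)
  then show ?thesis using G(1) by simp
qed

lemma keep_intertwine:
  assumes "\<And>s t. t \<in> supp (A \<star> single s 1) \<Longrightarrow> Q t = P s"
  shows "keep Q * A = A * keep P"
proof (rule endo_eqI)
  fix s
  have "keep P \<star> single s 1 = (if P s then single s 1 else 0)"
    by (rule poly_mapping_eqI) (auto simp: coef_keep lookup_single when_def)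
  moreover have "keep Q \<star> A \<star> single s 1 = (if P s then A \<star> single s 1 else 0)"
    using assms by (intro poly_mapping_eqI) (auto simp: coef_keep in_keys_iff)
  ultimately show "keep Q * A \<star> single s 1 = A * keep P \<star> single s 1" by simp
qed

lemma keep_not: "keep (\<lambda>s. \<not> P s) = 1 - keep P"
  by (rule endo_ext, rule poly_mapping_eqI) (simp add: coef_keep lookup_minus)

section \<open>The grading by parity in q\<close>

definition evenq :: "nat \<Rightarrow> monom \<times> monom \<Rightarrow> bool" where
  "evenq n s = even (\<Sum>i<n. coef (snd s) i)"

abbreviation "ev n \<equiv> keep (evenq n)"

lemma evenq_add: "i < n \<Longrightarrow> evenq n (m, a + single i 1) \<longleftrightarrow> \<not> evenq n (m, a)"
  by (simp add: evenq_def lookup_add sum.distrib lookup_single when_def)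

text \<open>Operators odd in q exchange the parities: \<open>qm i - qm i * ev n\<close> is
  \<open>qm i\<close> after the projection to the odd part.\<close>

lemma ev_basic:
  "ev n * xm i = xm i * ev n" "ev n * xd i = xd i * ev n"
  "i < n \<Longrightarrow> ev n * qm i = qm i - qm i * ev n" "i < n \<Longrightarrow> ev n * qd i = qd i - qd i * ev n"
proof -
  show "ev n * xm i = xm i * ev n" "ev n * xd i = xd i * ev n"
    by (rule keep_intertwine; auto simp: single_app evenq_def split: prod.splits if_splits)+
  assume i: "i < n"
  have "ev n * qm i = qm i * keep (\<lambda>s. \<not> evenq n s)"
  proof (rule keep_intertwine)
    fix s t assume "t \<in> supp (qm i \<star> single s 1)"
    then show "evenq n t = (\<not> evenq n s)" using evenq_add[OF i, of "fst s" "snd s"]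
      by (cases s) (simp add: single_app)
  qed
  then show "ev n * qm i = qm i - qm i * ev n" by (simp add: keep_not right_diff_distrib)
  have "ev n * qd i = qd i * keep (\<lambda>s. \<not> evenq n s)"
  proof (rule keep_intertwine)
    fix s t assume "t \<in> supp (qd i \<star> single s 1)"
    then have "(fst t, snd t + single i 1) = s"
      using supp_qd[of "fst t" "snd t" i "single s 1"] by simp
    then show "evenq n t = (\<not> evenq n s)" using evenq_add[OF i, of "fst t" "snd t"] by auto
  qed
  then show "ev n * qd i = qd i - qd i * ev n" by (simp add: keep_not right_diff_distrib)
qed

lemma ev_basic_assoc:
  "ev n * (xm i * R) = xm i * (ev n * R)" "ev n * (xd i * R) = xd i * (ev n * R)"
  "i < n \<Longrightarrow> ev n * (qm i * R) = qm i * R - qm i * (ev n * R)"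
  "i < n \<Longrightarrow> ev n * (qd i * R) = qd i * R - qd i * (ev n * R)"
  by (simp_all only: mult.assoc[symmetric] ev_basic left_diff_distrib)

text \<open>Root vectors are even in q, whereas every term of \<open>Dp\<close> is odd. Hence the
  kernel of \<open>Dp\<close> splits into an even and an odd part, and the root vectors respect the
  splitting.\<close>

lemma ev_ops:
  "i < n \<Longrightarrow> j < n \<Longrightarrow> ev n * opE i j = opE i j * ev n"
  "i < n \<Longrightarrow> j < n \<Longrightarrow> ev n * opS i j = opS i j * ev n"
  "i < n \<Longrightarrow> j < n \<Longrightarrow> ev n * opT i j = opT i j * ev n"
  "ev n * Dp n = Dp n - Dp n * ev n"
proof -
  show "i < n \<Longrightarrow> j < n \<Longrightarrow> ev n * opE i j = opE i j * ev n"
    "i < n \<Longrightarrow> j < n \<Longrightarrow> ev n * opS i j = opS i j * ev n"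
    "i < n \<Longrightarrow> j < n \<Longrightarrow> ev n * opT i j = opT i j * ev n"
    by (simp_all add: op_defs distrib_left distrib_right left_diff_distrib right_diff_distrib mult.assoc ev_basic ev_basic_assoc)
  have "ev n * Dp n = (\<Sum>j<n. (xd (2*j) * qm j - xd (2*j+1) * qd j) - (xd (2*j) * qm j - xd (2*j+1) * qd j) * ev n)"
    unfolding Dp_def sum_distrib_left
    by (intro sum.cong refl) (simp add: left_diff_distrib right_diff_distrib mult.assoc ev_basic ev_basic_assoc)
  then show "ev n * Dp n = Dp n - Dp n * ev n"
    unfolding Dp_def sum_distrib_right sum_subtractf[symmetric] .
qed

section \<open>Weights\<close>

text \<open>H_k acts on the monomial by \<open>wt k s - 1/2\<close>: z_k raises this weight, y_k and
  q_k lower it.\<close>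

definition wt :: "nat \<Rightarrow> monom \<times> monom \<Rightarrow> int" where
  "wt k s = int (coef (fst s) (2*k+1)) - int (coef (fst s) (2*k)) - int (coef (snd s) k)"

lemma diagonal_opE: "diagonal (opE k k) (\<lambda>s. - of_int (wt k s))"
proof -
  have "diagonal (opE k k) (\<lambda>s. of_nat (coef (fst s) (2*k)) - of_nat (coef (fst s) (2*k+1)) + of_nat (coef (snd s) k))"
    unfolding opE_def by (intro diagonal_simps diagonal_xm_xd diagonal_qm_qd)
  then show ?thesis by (simp add: wt_def algebra_simps)
qed

text \<open>A functional of the weight that is positive on all positive roots. With indices from 0
  its coefficients are n, ..., 1, so it takes the value j - i on \<epsilon>_i - \<epsilon>_j and 2n
  - i - j on \<epsilon>_i + \<epsilon>_j.\<close>

definition height :: "nat \<Rightarrow> monom \<times> monom \<Rightarrow> int" where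
  "height n s = (\<Sum>k<n. int (n - k) * wt k s)"

definition height_op :: "nat \<Rightarrow> (monom \<times> monom) endo" where
  "height_op n = (\<Sum>k<n. sc (- of_nat (n - k)) * opE k k)"

lemma diagonal_height: "diagonal (height_op n) (\<lambda>s. of_int (height n s))"
proof -
  have "diagonal (height_op n) (\<lambda>s. \<Sum>k<n. - of_nat (n - k) * - of_int (wt k s))"
    unfolding height_op_def by (intro diagonal_sum diagonal_simps(4) diagonal_opE)
  then show ?thesis by (simp add: height_def algebra_simps)
qed

text \<open>Only the exponents of the z_k count positively, and these are bounded by the degree; the
  unbounded q-exponents enter with a minus sign.\<close>

lemma height_le: assumes "xdeg n s = l" shows "height n s \<le> int n * int l"
proof -
  have "height n s \<le> (\<Sum>k<n. int n * (int (coef (fst s) (2*k)) + int (coef (fst s) (2*k+1))))"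
    unfolding height_def
  proof (rule sum_mono)
    fix k assume "k \<in> {..<n}"
    have "int (n - k) * wt k s \<le> int (n - k) * int (coef (fst s) (2*k+1))"
      by (intro mult_left_mono) (auto simp: wt_def)
    also have "\<dots> \<le> int n * (int (coef (fst s) (2*k)) + int (coef (fst s) (2*k+1)))"
      by (intro mult_mono) auto
    finally show "int (n - k) * wt k s \<le> int n * (int (coef (fst s) (2*k)) + int (coef (fst s) (2*k+1)))" .
  qed
  also have "\<dots> = int n * int (xdeg n s)" unfolding xdeg_def sum_lessThan_double by (simp add: sum_distrib_left)
  finally show ?thesis using assms by simp
qed

lemma comm_opE_opE: "comm (opE k k) (opE i j) = (if k = j then opE i j else 0) - (if k = i then opE i j else 0)"
  by (cases "k = j"; cases "k = i")
    (simp_all add: comm_def opE_def distrib_left distrib_right left_diff_distrib right_diff_distrib mult.assoc weyl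
      Suc_double_not_eq_double double_not_eq_Suc_double)

lemma comm_opE_opS: "comm (opE k k) (opS i j) = - (if k = i then opS i j else 0) - (if k = j then opS i j else 0)"
  by (cases "k = j"; cases "k = i")
    (simp_all add: comm_def opE_def opS_def distrib_left distrib_right left_diff_distrib right_diff_distrib mult.assoc weyl
      Suc_double_not_eq_double double_not_eq_Suc_double)

lemma comm_height:
  assumes "i < n" "j < n"
  shows "comm (height_op n) (opE i j) = sc (of_int (int j - int i)) * opE i j"
    "comm (height_op n) (opS i j) = sc (of_int (int (n - i) + int (n - j))) * opS i j"
proof -
  have sc_comm: "comm (sc c * A) B = sc c * comm A B" for c and A B :: "(monom \<times> monom) endo"
    by (simp add: comm_def right_diff_distrib mult.assoc) (metis mult.assoc sc_commute)
  \<comment> \<open>Covers both families at once: the premise says that \<open>A\<close> is a root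
    vector for \<alpha> \<epsilon>_i + \<beta> \<epsilon>_j.\<close>
  have E: "comm (height_op n) A = sc (\<beta> * of_nat (n - j) + \<alpha> * of_nat (n - i)) * A"
    if "\<And>k. comm (opE k k) A = sc (if k = i then - \<alpha> else 0) * A + sc (if k = j then - \<beta> else 0) * A" for A \<alpha> \<beta>
  proof -
    have "comm (height_op n) A = (\<Sum>k<n. sc ((if k = i then \<alpha> * of_nat (n - k) else 0) + (if k = j then \<beta> * of_nat (n - k) else 0)) * A)"
      unfolding height_op_def comm_sum
      by (intro sum.cong refl) (simp only: sc_comm that distrib_left mult.assoc[symmetric] sc_simps(6)[symmetric],
        simp only: distrib_right[symmetric] sc_simps(3)[symmetric], rule arg_cong[where f = "\<lambda>c. sc c * A"], simp add: algebra_simps)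
    also have "\<dots> = sc (\<beta> * of_nat (n - j) + \<alpha> * of_nat (n - i)) * A"
      unfolding sum_distrib_right[symmetric] sc_sum[symmetric] sum.distrib using assms by (simp add: add.commute del: sc_simps)
    finally show ?thesis .
  qed
  have "comm (height_op n) (opE i j) = sc (- 1 * of_nat (n - j) + 1 * of_nat (n - i)) * opE i j"
    by (rule E) (auto simp: comm_opE_opE)
  also have "- 1 * of_nat (n - j) + 1 * of_nat (n - i) = (of_int (int j - int i) :: complex)"
    using assms by (simp add: of_nat_diff)
  finally show "comm (height_op n) (opE i j) = sc (of_int (int j - int i)) * opE i j" .
  have "comm (height_op n) (opS i j) = sc (1 * of_nat (n - j) + 1 * of_nat (n - i)) * opS i j"
    by (rule E) (auto simp: comm_opE_opS)
  then show "comm (height_op n) (opS i j) = sc (of_int (int (n - i) + int (n - j))) * opS i j"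
    by (simp add: add.commute del: sc_simps)
qed

section \<open>The simple submodules\<close>

definition ker_D_parity :: "nat \<Rightarrow> nat \<Rightarrow> bool \<Rightarrow> spinor_pol set" where
  "ker_D_parity n l p = {F \<in> ker_D n l. ev n \<star> F = (if p then F else 0)}"

definition hw :: "nat \<Rightarrow> nat \<Rightarrow> bool \<Rightarrow> monom \<times> monom" where
  "hw n l p = (single 1 l, if p then 0 else single (n - 1) 1)"

lemma op_preserves: "op_closed n W \<longleftrightarrow> cvs.subspace W \<and> (\<forall>i<n. \<forall>j<n. preserves (opE i j) W \<and> preserves (opS i j) W \<and> preserves (opT i j) W)"
  unfolding op_closed_def preserves_def by blast

lemma subspace_ker_D_parity: "cvs.subspace (ker_D_parity n l p)"
  using subspace_ker_D[of n l] unfolding ker_D_parity_def by (auto simp: cvs.subspace_def)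

text \<open>Up to sign and a scalar \<open>Eu n\<close> is the commutator of \<open>Dp n\<close> and
  \<open>Xp n\<close>, so whatever commutes with these two keeps the degree.\<close>

lemma op_preserves_ker_D:
  assumes "preserves A (PC n)" "comm A (Xp n) = 0" "comm A (Dp n) = 0" "w \<in> ker_D n l"
  shows "A \<star> w \<in> ker_D n l"
proof -
  have "comm A (Eu n) = 0"
  proof -
    have c: "A * Xp n = Xp n * A" "A * Dp n = Dp n * A" using assms(2,3) by (simp_all add: comm_def)
    have "Eu n = - comm (Dp n) (Xp n) - of_nat n" by (simp add: Dp_Xp)
    then show ?thesis unfolding comm_def
      by (simp add: left_diff_distrib right_diff_distrib mult_of_nat_commute)
        (metis (no_types, opaque_lifting) c mult.assoc)
  qed
  then have "Eu n \<star> A \<star> w = A \<star> Eu n \<star> w" "Dp n \<star> A \<star> w = A \<star> Dp n \<star> w"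
    using comm_app[of A "Eu n" w] comm_app[of A "Dp n" w] assms(3) by simp_all
  then show ?thesis using assms(1,4) by (simp add: ker_D_def PC_deg_iff preserves_def)
qed

lemma ker_D_parity_op:
  assumes "i < n" "j < n" "w \<in> ker_D_parity n l p"
  shows "opE i j \<star> w \<in> ker_D_parity n l p" "opS i j \<star> w \<in> ker_D_parity n l p" "opT i j \<star> w \<in> ker_D_parity n l p"
proof -
  have *: "A \<star> w \<in> ker_D_parity n l p" if "preserves A (PC n)" "comm A (Xp n) = 0" "comm A (Dp n) = 0" "ev n * A = A * ev n" for A
  proof -
    have "ev n \<star> A \<star> w = A \<star> ev n \<star> w" using that(4) by (simp flip: app_simps(6))
    then show ?thesis using assms(3) op_preserves_ker_D[OF that(1-3)] by (simp add: ker_D_parity_def)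
  qed
  show "opE i j \<star> w \<in> ker_D_parity n l p" "opS i j \<star> w \<in> ker_D_parity n l p" "opT i j \<star> w \<in> ker_D_parity n l p"
    using assms(1,2) by (auto intro!: * preserves_PC_ops opE_Xp opE_Dp opS_Xp opS_Dp opT_Xp opT_Dp ev_ops)
qed

lemma op_closed_ker_D_parity: "op_closed n (ker_D_parity n l p)"
  unfolding op_closed_def using subspace_ker_D_parity ker_D_parity_op by auto

text \<open>As n >= 2, the variable q_n of the odd vector differs from q_1, so d/dz_1 d/dq_1 kills
  it; all other terms of \<open>Dp\<close> involve a derivative in an absent variable.\<close>

lemma hw_mem_ker_D_parity: assumes "n \<ge> 2" shows "single (hw n l p) 1 \<in> ker_D_parity n l p"
proof -
  let ?v = "single (hw n l p) (1 :: complex)"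
  have mon: "hw n l p \<in> mons n" "xdeg n (hw n l p) = l" "evenq n (hw n l p) = p"
    using assms by (auto simp: hw_def mons_def xdeg_def evenq_def lookup_single when_def)
  have "xd (2*k) \<star> ?v = 0" for k by (simp add: hw_def single_app lookup_single)
  moreover have "xd (2*k+1) \<star> qd k \<star> ?v = 0" if "k < n" for k
    using that assms by (cases "k = 0") (auto simp: hw_def single_app lookup_single when_def)
  ultimately have "Dp n \<star> ?v = 0"
    by (simp add: Dp_def sum_app sum_subtractf flip: weyl_app(2))
  moreover have "ev n \<star> ?v = (if p then ?v else 0)"
    by (rule poly_mapping_eqI) (use mon(3) in \<open>auto simp: coef_keep lookup_single when_def\<close>)
  ultimately show ?thesis using mon by (simp add: ker_D_parity_def ker_D_def PC_deg_eq)
qed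

text \<open>A vector of maximal height is killed by all raising operators. Only these and the Cartan
  part are asked to preserve \<open>U\<close>, so that the result also applies to an orthogonal
  complement.\<close>

lemma raising_closed_contains_hw:
  assumes n: "n \<ge> 2" and U: "cvs.subspace U" "U \<subseteq> ker_D_parity n l p" "U \<noteq> {0}"
    and S: "\<And>i j. i < n \<Longrightarrow> j < n \<Longrightarrow> preserves (opS i j) U"
    and E: "\<And>i j. i \<le> j \<Longrightarrow> j < n \<Longrightarrow> preserves (opE i j) U"
  shows "single (hw n l p) 1 \<in> U"
proof -
  define H where "H h \<longleftrightarrow> (\<exists>w\<in>U. w \<noteq> 0 \<and> height_op n \<star> w = of_int h *\<^sub>c w)" for h
  have UP: "w \<in> PC_deg n l" if "w \<in> U" for w using that U(2) by (auto simp: ker_D_parity_def ker_D_def)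
  have bound: "h \<le> int n * int l" if Hh: "H h" for h
  proof -
    obtain w where w: "w \<in> U" "w \<noteq> 0" "height_op n \<star> w = of_int h *\<^sub>c w" using Hh unfolding H_def by blast
    then obtain s where "s \<in> supp w" by (metis keys_eq_empty ex_in_conv)
    then have "height n s = h" "xdeg n s = l"
      using w(3) UP[OF w(1)] unfolding diagonal_eigen_iff[OF diagonal_height] by (auto simp: PC_deg_eq)
    then show ?thesis using height_le by blast
  qed
  have "\<exists>h. H h"
  proof -
    obtain w where w: "w \<in> U" "w \<noteq> 0" using U cvs.subspace_0[OF U(1)] by blast
    then obtain s where s: "s \<in> supp w" by (metis keys_eq_empty ex_in_conv)
    let ?w = "keep (\<lambda>t. complex_of_int (height n t) = of_int (height n s)) \<star> w"
    have "preserves (height_op n) U"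
      unfolding height_op_def using E by (intro preserves_sum preserves_simps U(1)) auto
    then have "?w \<in> U" by (rule diagonal_component[OF diagonal_height U(1) _ w(1)])
    moreover have "s \<in> supp ?w" using s by (simp add: supp_keep)
    then have "?w \<noteq> 0" by auto
    moreover have "height_op n \<star> ?w = of_int (height n s) *\<^sub>c ?w"
      unfolding diagonal_eigen_iff[OF diagonal_height] by (simp add: supp_keep)
    ultimately show ?thesis unfolding H_def by blast
  qed
  \<comment> \<open>The maximal height is found as the minimal distance to the bound
    \<open>int n * int l\<close>.\<close>
  then obtain h where h: "H h" and least: "\<And>h'. H h' \<Longrightarrow> nat (int n * int l - h) \<le> nat (int n * int l - h')"
    using ex_has_least_nat[of H _ "\<lambda>h. nat (int n * int l - h)"] by blast
  have max: "h' \<le> h" if "H h'" for h'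
  proof -
    have "nat (int n * int l - h) \<le> nat (int n * int l - h')"
      by (rule least[OF that])
    then show ?thesis using bound[OF that] by (simp add: nat_le_eq_zle)
  qed
  obtain w where w: "w \<in> U" "w \<noteq> 0" "height_op n \<star> w = of_int h *\<^sub>c w" using h unfolding H_def by blast
  have kill: "A \<star> w = 0" if "preserves A U" "comm (height_op n) A = sc (of_int d) * A" "d > 0" for A d
  proof (rule ccontr)
    assume "A \<star> w \<noteq> 0"
    moreover have "height_op n \<star> A \<star> w = of_int (h + d) *\<^sub>c (A \<star> w)"
      using comm_app[of "height_op n" A w] that(2) w(3) by (simp add: cvs.scale_left_distrib)
    ultimately have "H (h + d)" using that(1) w(1) unfolding H_def preserves_def by blast
    then show False using max that(3) by fastforce
  qed
  have "w \<in> ker_D n l" using w(1) U(2) by (auto simp: ker_D_parity_def)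
  then have "supp w \<subseteq> {(single 1 l, 0), (single 1 l, single (n-1) 1)}"
    by (rule highest_weight_supp[OF n], intro kill[OF S comm_height(2)], simp_all)
      (intro kill[OF E comm_height(1)], simp_all)
  \<comment> \<open>Parity excludes one of the two candidate monomials.\<close>
  moreover have "evenq n s = p" if "s \<in> supp w" for s
  proof -
    have "ev n \<star> w = (if p then w else 0)" using w(1) U(2) by (auto simp: ker_D_parity_def)
    then have "coef (ev n \<star> w) s = coef (if p then w else 0) s" by simp
    then show ?thesis using that by (auto simp: coef_keep in_keys_iff split: if_splits)
  qed
  moreover have "evenq n (single 1 l, 0)" "\<not> evenq n (single 1 l, single (n-1) 1)"
    using n by (auto simp: evenq_def lookup_single when_def)
  ultimately have "supp w \<subseteq> {hw n l p}" by (auto simp: hw_def)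
  then have "w = coef w (hw n l p) *\<^sub>c single (hw n l p) 1"
    by (intro poly_mapping_eqI) (auto simp: lookup_single when_def in_keys_iff)
  moreover from this have "coef w (hw n l p) \<noteq> 0" using w(2) by auto
  ultimately have "single (hw n l p) 1 = (1 / coef w (hw n l p)) *\<^sub>c w"
    by (metis cvs.scale_one cvs.scale_scale nonzero_divide_eq_eq)
  then show ?thesis using U(1) w(1) by (metis cvs.subspace_scale)
qed

section \<open>Weight components\<close>

definition wvec :: "nat \<Rightarrow> monom \<times> monom \<Rightarrow> complex vec" where
  "wvec n s = vec n (\<lambda>k. of_int (wt k s) - 1/2)"

lemma wvec_carrier [simp]: "wvec n s \<in> carrier_vec n"
  by (simp add: wvec_def)

lemma wvec_index: "k < n \<Longrightarrow> wvec n s $ k = of_int (wt k s) - 1/2"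
  by (simp add: wvec_def)

lemma wvec_eq_iff: "wvec n s = wvec n t \<longleftrightarrow> (\<forall>k<n. wt k s = wt k t)"
  by (auto simp: vec_eq_iff wvec_def)

text \<open>The Cartan elements are used one coordinate at a time, each projecting the component
  obtained so far to one of its eigenspaces. A vector \<mu> of the wrong dimension gives the zero
  component.\<close>

lemma op_closed_component:
  assumes U: "op_closed n U" "F \<in> U"
  shows "keep (\<lambda>s. wvec n s = \<mu>) \<star> F \<in> U"
proof (cases "\<mu> \<in> carrier_vec n")
  case True
  have sub: "cvs.subspace U" using U(1) by (simp add: op_closed_def)
  have "keep (\<lambda>s. \<forall>k<r. wvec n s $ k = \<mu> $ k) \<star> F \<in> U" if "r \<le> n" for r
    using that
  proof (induction r)
    case 0
    have "keep (\<lambda>s. True) \<star> F = F" by (rule poly_mapping_eqI) (simp add: coef_keep)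
    then show ?case using U(2) by simp
  next
    case (Suc r)
    let ?F = "keep (\<lambda>s. \<forall>k<r. wvec n s $ k = \<mu> $ k) \<star> F"
    have "preserves (opE r r) U" using U(1) Suc.prems by (simp add: op_preserves)
    then have "keep (\<lambda>s. - of_int (wt r s) = - (\<mu> $ r + 1/2)) \<star> ?F \<in> U"
      using Suc by (intro diagonal_component[OF diagonal_opE sub]) auto
    also have "keep (\<lambda>s. - of_int (wt r s) = - (\<mu> $ r + 1/2)) \<star> ?F = keep (\<lambda>s. \<forall>k<Suc r. wvec n s $ k = \<mu> $ k) \<star> F"
      using Suc.prems by (intro poly_mapping_eqI) (auto simp: coef_keep less_Suc_eq wvec_index algebra_simps)
    finally show ?case .
  qed
  then have "keep (\<lambda>s. \<forall>k<n. wvec n s $ k = \<mu> $ k) \<star> F \<in> U" by simp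
  moreover have "(\<lambda>s. \<forall>k<n. wvec n s $ k = \<mu> $ k) = (\<lambda>s. wvec n s = \<mu>)"
    using True by (auto simp: vec_eq_iff wvec_def fun_eq_iff)
  ultimately show ?thesis by simp
next
  case False
  then have "keep (\<lambda>s. wvec n s = \<mu>) \<star> F = 0"
    by (intro poly_mapping_eqI) (auto simp: coef_keep)
  then show ?thesis using U cvs.subspace_0 by (auto simp: op_closed_def)
qed

lemma sum_components:
  "F = (\<Sum>\<mu>\<in>f ` supp F. keep (\<lambda>s. f s = \<mu>) \<star> F)"
proof (rule poly_mapping_eqI)
  fix s
  have "coef (\<Sum>\<mu>\<in>f ` supp F. keep (\<lambda>s. f s = \<mu>) \<star> F) s = (\<Sum>\<mu>\<in>f ` supp F. if f s = \<mu> then coef F s else 0)"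
    by (simp add: lookup_sum coef_keep)
  also have "\<dots> = coef F s" by (auto simp: in_keys_iff)
  finally show "coef F s = coef (\<Sum>\<mu>\<in>f ` supp F. keep (\<lambda>s. f s = \<mu>) \<star> F) s" ..
qed

lemma finite_bounded_monoms: "finite {m :: monom. supp m \<subseteq> {..<N} \<and> (\<forall>i. coef m i \<le> B)}"
proof (rule finite_imageD)
  have "finite {f. \<forall>i. (i \<in> {..<N} \<longrightarrow> f i \<in> {..B}) \<and> (i \<notin> {..<N} \<longrightarrow> f i = 0)}"
    by (rule finite_set_of_finite_funs) auto
  then show "finite (coef ` {m. supp m \<subseteq> {..<N} \<and> (\<forall>i. coef m i \<le> B)})"
    by (rule rev_finite_subset) (auto simp: in_keys_iff)
  show "inj_on coef {m :: monom. supp m \<subseteq> {..<N} \<and> (\<forall>i. coef m i \<le> B)}"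
    by (rule inj_onI, rule poly_mapping_eqI) simp
qed

text \<open>The degree bounds the x-exponents, and a prescribed weight then bounds each q-exponent.
  Thus the weight spaces in a fixed degree are finite dimensional.\<close>

lemma finite_weight_monomials: "finite {s \<in> mons n. xdeg n s = l \<and> wvec n s = \<mu>}" (is "finite ?S")
proof (cases "?S = {}")
  case False
  then obtain s0 where s0: "wvec n s0 = \<mu>" by blast
  define B where "B = l + (\<Sum>k<n. nat \<bar>wt k s0\<bar>)"
  have "?S \<subseteq> {m. supp m \<subseteq> {..<2*n} \<and> (\<forall>i. coef m i \<le> B)} \<times> {a. supp a \<subseteq> {..<n} \<and> (\<forall>i. coef a i \<le> B)}"
  proof
    fix s assume s: "s \<in> ?S"
    obtain m a where ma: "s = (m, a)" by fastforce
    have supp: "supp m \<subseteq> {..<2*n}" "supp a \<subseteq> {..<n}" and deg: "(\<Sum>i<2*n. coef m i) = l"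
      using s by (auto simp: ma mons_def xdeg_def)
    have ml: "coef m i \<le> l" for i
    proof (cases "i < 2*n")
      case True
      then show ?thesis unfolding deg[symmetric] by (intro member_le_sum) auto
    next
      case False
      then have "i \<notin> supp m" using supp(1) by auto
      then show ?thesis by (simp add: in_keys_iff)
    qed
    have al: "coef a k \<le> B" for k
    proof (cases "k < n")
      case True
      then have "wt k s0 = wt k s" using s s0 wvec_eq_iff[of n s0 s] by auto
      then have "int (coef a k) \<le> int (coef m (2*k+1)) + \<bar>wt k s0\<bar>" by (simp add: wt_def ma)
      moreover have "nat \<bar>wt k s0\<bar> \<le> (\<Sum>k<n. nat \<bar>wt k s0\<bar>)"
        using True by (intro member_le_sum[of k "{..<n}" "\<lambda>k. nat \<bar>wt k s0\<bar>"]) auto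
      ultimately show ?thesis using ml[of "2*k+1"] unfolding B_def by linarith
    next
      case False
      then have "k \<notin> supp a" using supp(2) by auto
      then show ?thesis by (simp add: in_keys_iff)
    qed
    show "s \<in> {m. supp m \<subseteq> {..<2*n} \<and> (\<forall>i. coef m i \<le> B)} \<times> {a. supp a \<subseteq> {..<n} \<and> (\<forall>i. coef a i \<le> B)}"
      using ml al supp by (auto simp: ma B_def intro: trans_le_add1)
  qed
  then show ?thesis by (rule finite_subset) (intro finite_cartesian_product finite_bounded_monoms)
qed (simp only: finite.emptyI)

lemma separating_functional:
  assumes "cvs.subspace U" "x \<notin> U"
  obtains \<phi> :: "('a \<Rightarrow>\<^sub>0 complex) \<Rightarrow> complex" where
    "Vector_Spaces.linear cscale (*) \<phi>" "\<And>u. u \<in> U \<Longrightarrow> \<phi> u = 0" "\<phi> x = 1"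
proof -
  interpret vector_space_pair "cscale :: complex \<Rightarrow> ('a \<Rightarrow>\<^sub>0 complex) \<Rightarrow> _" "(*) :: complex \<Rightarrow> complex \<Rightarrow> complex"
    by unfold_locales (auto simp: algebra_simps)
  obtain B where B: "B \<subseteq> U" "cvs.independent B" "U \<subseteq> cvs.span B"
    using cvs.maximal_independent_subset[of U] by blast
  have "cvs.span B = U" using B assms(1) by (metis cvs.span_minimal subset_antisym)
  then have "cvs.independent (insert x B)" using assms(2) B(2) by (simp add: cvs.independent_insertI)
  from linear_independent_extend[OF this, of "\<lambda>y. if y = x then 1 else 0"]
  obtain \<phi> where \<phi>: "Vector_Spaces.linear cscale (*) \<phi>" "\<forall>y\<in>insert x B. \<phi> y = (if y = x then 1 else 0)" by blast
  have "\<phi> u = 0" if "u \<in> U" for u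
  proof (rule linear_eq_0_on_span[OF \<phi>(1)])
    show "\<phi> b = 0" if "b \<in> B" for b using \<phi>(2) that B(1) assms(2) by auto
    show "u \<in> cvs.span B" using \<open>u \<in> U\<close> B(3) by blast
  qed
  then show ?thesis using that \<phi> by simp
qed

text \<open>
  If the submodule generated by the highest weight vector were proper, then its orthogonal
  complement with respect to the contravariant form would be nonzero and closed under the raising
  operators, so it would contain that vector, which is not isotropic. Passing to a single weight
  makes the separating functional finitely supported, hence represented by the form.
\<close>

lemma ker_D_parity_subset:
  assumes n: "n \<ge> 2" and U: "op_closed n U" "U \<subseteq> ker_D_parity n l p" and v: "single (hw n l p) 1 \<in> U"
  shows "ker_D_parity n l p \<subseteq> U"
proof (rule ccontr)
  assume "\<not> ker_D_parity n l p \<subseteq> U"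
  then obtain F where F: "F \<in> ker_D_parity n l p" "F \<notin> U" by blast
  have subU: "cvs.subspace U" using U(1) by (simp add: op_closed_def)
  have KPdeg: "w \<in> PC_deg n l" "Dp n \<star> w = 0" if "w \<in> ker_D_parity n l p" for w
    using that by (auto simp: ker_D_parity_def ker_D_def)
  \<comment> \<open>If all weight components of \<open>F\<close> were in \<open>U\<close>, so would
    be their sum.\<close>
  obtain \<mu> where k0: "keep (\<lambda>s. wvec n s = \<mu>) \<star> F \<notin> U"
    using F(2) sum_components[of F "wvec n"] cvs.subspace_sum[OF subU] by metis
  define P where "P = keep (\<lambda>s. wvec n s = \<mu>)"
  define x where "x = P \<star> F"
  have x: "x \<in> ker_D_parity n l p" "x \<notin> U"
    using op_closed_component[OF op_closed_ker_D_parity F(1)] k0 by (auto simp: x_def P_def)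
  define S where "S = {s \<in> mons n. xdeg n s = l \<and> wvec n s = \<mu>}"
  have finS: "finite S" unfolding S_def by (rule finite_weight_monomials)
  have suppS: "supp (P \<star> w) \<subseteq> S" if "w \<in> ker_D_parity n l p" for w
    using KPdeg(1)[OF that] by (auto simp: P_def S_def supp_keep PC_deg_eq)
  from separating_functional[OF subU x(2)] obtain \<phi> where
    \<phi>: "Vector_Spaces.linear cscale (*) \<phi>" "\<And>u. u \<in> U \<Longrightarrow> \<phi> u = 0" "\<phi> x = 1" by blast
  interpret \<phi>: Vector_Spaces.linear cscale "(*)" \<phi> by fact
  \<comment> \<open>Dividing by \<open>bw\<close> makes \<open>g\<close> represent \<phi> composed
    with \<open>P\<close>; the restriction to one weight keeps the sum finite.\<close>
  define g where "g = (\<Sum>s\<in>S. single s (\<phi> (single s 1) / bw s))"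
  have coef_g: "coef g s = (if s \<in> S then \<phi> (single s 1) / bw s else 0)" for s
    using finS by (simp add: g_def lookup_sum lookup_single when_def)
  have suppg: "supp g \<subseteq> S" by (auto simp: in_keys_iff coef_g split: if_splits)
  have form_g: "form w g = \<phi> (P \<star> w)" if "w \<in> ker_D_parity n l p" for w
  proof -
    have "form w g = (\<Sum>s\<in>S. bw s * coef g s * coef w s)"
      unfolding form_commute[of w] by (rule form_superset[OF finS suppg])
    also have "\<dots> = (\<Sum>s\<in>S. coef (P \<star> w) s * \<phi> (single s 1))"
      using bw_nonzero by (intro sum.cong refl) (auto simp: coef_g P_def coef_keep S_def)
    also have "\<dots> = (\<Sum>s\<in>supp (P \<star> w). coef (P \<star> w) s * \<phi> (single s 1))"
      by (rule sum.mono_neutral_right[OF finS suppS[OF that]]) (auto simp: in_keys_iff)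
    also have "\<dots> = \<phi> (P \<star> w)"
      by (subst (3) poly_mapping_sum_single) (simp add: \<phi>.sum \<phi>.scale)
    finally show ?thesis .
  qed
  have "g \<in> PC_deg n l" using suppg by (auto simp: PC_deg_eq S_def)
  \<comment> \<open>The summands with \<open>j < l\<close> lie in the image of \<open>Xp\<close> and
    are orthogonal to the kernel of \<open>Dp\<close>, so there the last summand \<open>m l\<close>
    represents the same functional as \<open>g\<close>.\<close>
  then obtain m where m: "\<And>j. j \<le> l \<Longrightarrow> m j \<in> ker_D n j" "g = (\<Sum>j\<le>l. Xp n ^ (l - j) \<star> m j)"
    using fischer[of n g l] n by auto
  have form_m: "form w g = form w (m l)" if "w \<in> ker_D_parity n l p" for w
  proof -
    have "form (Xp n ^ (l - j) \<star> m j) w = 0" if "j < l" for j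
    proof -
      have "Xp n ^ (l - j) \<star> m j = Xp n \<star> Xp n ^ (l - Suc j) \<star> m j"
        using that by (metis Suc_diff_Suc app_simps(6) power_Suc)
      then show ?thesis
        using adj_Xp[of n] KPdeg(2)[OF \<open>w \<in> ker_D_parity n l p\<close>] by (simp add: adj_def form_zero_right)
    qed
    then have "form (\<Sum>j<l. Xp n ^ (l - j) \<star> m j) w = 0" by (simp add: form_sum_left)
    then show ?thesis
      unfolding m(2) form_commute[of w] by (simp add: form_add_left lessThan_Suc_atMost[symmetric])
  qed
  \<comment> \<open>Projection to the parity \<open>p\<close>; since \<open>ev n\<close> is
    self-adjoint, pairings with \<open>ker_D_parity n l p\<close> do not change.\<close>
  define m' where "m' = (if p then ev n \<star> m l else m l - (ev n \<star> m l))"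
  have "ev n \<star> m l \<in> ker_D n l"
  proof -
    have "supp (ev n \<star> m l) \<subseteq> supp (m l)" by (auto simp: supp_keep)
    moreover have "Dp n \<star> ev n \<star> m l = (Dp n \<star> m l) - (ev n \<star> Dp n \<star> m l)"
      unfolding app_simps(6)[symmetric] ev_ops(4) by simp
    ultimately show ?thesis using m(1)[of l] by (auto simp: ker_D_def PC_deg_eq)
  qed
  moreover have "ev n \<star> ev n \<star> m l = ev n \<star> m l"
    by (rule poly_mapping_eqI) (simp add: coef_keep)
  ultimately have m'K: "m' \<in> ker_D_parity n l p"
    using m(1)[of l] cvs.subspace_diff[OF subspace_ker_D] by (auto simp: m'_def ker_D_parity_def)
  have form_m': "form w m' = form w (m l)" if "w \<in> ker_D_parity n l p" for w
  proof -
    have e: "ev n \<star> w = (if p then w else 0)" using that by (simp add: ker_D_parity_def)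
    have "form w (ev n \<star> m l) = form (ev n \<star> w) (m l)" using adj_keep by (simp add: adj_def)
    then have "form w (ev n \<star> m l) = (if p then form w (m l) else 0)" by (simp add: e form_zero_left)
    moreover have "form w (m l - (ev n \<star> m l)) = form w (m l) - form w (ev n \<star> m l)"
      using form_add_right[of w "m l - (ev n \<star> m l)" "ev n \<star> m l"] by simp
    ultimately show ?thesis by (simp add: m'_def)
  qed
  define U' where "U' = {w \<in> ker_D_parity n l p. \<forall>u\<in>U. form u w = 0}"
  \<comment> \<open>Adjointness exchanges raising and lowering operators, so closure of
    \<open>U\<close> under the latter gives closure of its complement \<open>U'\<close> under the
    former.\<close>
  have presU': "preserves A U'" if A: "adj B A" "preserves A (ker_D_parity n l p)" "preserves B U" for A B
    unfolding preserves_def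
  proof
    fix w assume w: "w \<in> U'"
    have "form u (A \<star> w) = 0" if "u \<in> U" for u
    proof -
      have "form u (A \<star> w) = form (B \<star> u) w" using A(1) by (simp add: adj_def)
      moreover have "B \<star> u \<in> U" using A(3) that by (simp add: preserves_def)
      ultimately show ?thesis using w by (simp add: U'_def)
    qed
    then show "A \<star> w \<in> U'" using w A(2) by (simp add: U'_def preserves_def)
  qed
  have "m' \<in> U'"
  proof -
    have "form u m' = 0" if "u \<in> U" for u
    proof -
      have "P \<star> u \<in> U" using op_closed_component[OF U(1) that] by (simp add: P_def)
      moreover have "u \<in> ker_D_parity n l p" using that U(2) by blast
      ultimately show ?thesis using form_m' form_m form_g \<phi>(2) by metis
    qed
    then show ?thesis using m'K by (simp add: U'_def)
  qed
  moreover have "m' \<noteq> 0"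
  proof -
    have "P \<star> x = x" by (rule poly_mapping_eqI) (simp add: x_def P_def coef_keep)
    then have "form x m' = 1" using form_m'[OF x(1)] form_m[OF x(1)] form_g[OF x(1)] \<phi>(3) by simp
    then show ?thesis by (auto simp: form_zero_right)
  qed
  moreover have "cvs.subspace U'"
    using subspace_ker_D_parity[of n l p] unfolding U'_def
    by (auto simp: cvs.subspace_def form_add_right form_scale_right form_zero_right)
  ultimately have "single (hw n l p) 1 \<in> U'"
  proof (intro raising_closed_contains_hw[OF n])
    have PU: "preserves (opE i j) U" "preserves (- opT i j) U" if "i < n" "j < n" for i j
      using U(1) that preserves_simps(3)[OF subU] by (auto simp: op_preserves)
    have PK: "preserves (opE i j) (ker_D_parity n l p)" "preserves (opS i j) (ker_D_parity n l p)" if "i < n" "j < n" for i j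
      using ker_D_parity_op that by (auto simp: preserves_def)
    show "preserves (opE i j) U'" if "i \<le> j" "j < n" for i j
      using that presU'[OF adj_opE[of j i] PK(1) PU(1)] by simp
    have "adj (- opT i j) (opS i j)" for i j
      using adj_simps(4)[OF adj_opT[of i j], of "-1"] by simp
    then show "preserves (opS i j) U'" if "i < n" "j < n" for i j
      using that presU'[OF _ PK(2)[OF that] PU(2)[OF that]] by blast
    show "U' \<subseteq> ker_D_parity n l p" by (auto simp: U'_def)
  qed auto
  \<comment> \<open>The highest weight vector lies in \<open>U\<close> and in its complement, so it
    would be orthogonal to itself.\<close>
  then have "form (single (hw n l p) 1) (single (hw n l p) 1) = 0" using v by (simp add: U'_def)
  then show False using bw_nonzero by (simp add: form_single)
qed

lemma simple_closed_ker_D_parity: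
  assumes n: "n \<ge> 2" and U: "op_closed n U" "U \<subseteq> ker_D_parity n l p" "U \<noteq> {0}"
  shows "U = ker_D_parity n l p"
proof -
  have "single (hw n l p) 1 \<in> U"
    using U by (intro raising_closed_contains_hw[OF n]) (auto simp: op_preserves)
  then show ?thesis using ker_D_parity_subset[OF n U(1,2)] U(2) by blast
qed

section \<open>Identification of the monogenics\<close>

definition hweight :: "nat \<Rightarrow> nat \<Rightarrow> bool \<Rightarrow> complex vec" where
  "hweight n l p = (if p then of_nat l \<cdot>\<^sub>v fund_weight n 1 - (1/2) \<cdot>\<^sub>v fund_weight n n
     else of_nat l \<cdot>\<^sub>v fund_weight n 1 + fund_weight n (n-1) - (3/2) \<cdot>\<^sub>v fund_weight n n)"

lemma wt_hw:
  assumes "n \<ge> 2"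
  shows "wt i (hw n l p) = (if i = 0 then int l else 0) - (if \<not> p \<and> i = n - 1 then 1 else 0)"
proof -
  have "2 * i + 1 = 1 \<longleftrightarrow> i = 0" "2 * i \<noteq> 1" by presburger+
  then show ?thesis using assms by (auto simp: wt_def hw_def lookup_single when_def eq_commute[of "Suc 0"] eq_commute[of "n - Suc 0"] del: One_nat_def)
qed

lemma hweight_index:
  assumes "n \<ge> 2" "i < n"
  shows "hweight n l p $ i = of_int (wt i (hw n l p)) - 1/2"
  unfolding wt_hw[OF assms(1)] using assms by (auto simp: hweight_def fund_weight_def)

text \<open>The first weight says that the exponent of z_1 is l plus those of y_1 and q_1. As the
  total degree in x is l, nothing but z_1^l is left in x, and the weights then give the exponents in
  q.\<close>

lemma hw_unique:
  assumes n: "n \<ge> 2" and s: "s \<in> mons n" "xdeg n s = l" and w: "\<And>i. i < n \<Longrightarrow> wt i s = wt i (hw n l p)"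
  shows "s = hw n l p"
proof -
  obtain m a where ma: "s = (m, a)" by fastforce
  have supp: "supp m \<subseteq> {..<2*n}" "supp a \<subseteq> {..<n}" and deg: "(\<Sum>i<2*n. coef m i) = l"
    using s by (auto simp: ma mons_def xdeg_def)
  have w0: "int (coef m 1) = int l + int (coef m 0) + int (coef a 0)"
    using w[of 0] n unfolding wt_hw[OF n] by (simp add: wt_def ma)
  have two: "coef m i + coef m 1 \<le> l" if "i < 2*n" "i \<noteq> 1" for i
  proof -
    have "(\<Sum>i\<in>{i, 1}. coef m i) \<le> (\<Sum>i<2*n. coef m i)" using that n by (intro sum_mono2) auto
    then show ?thesis using that deg by simp
  qed
  have m1: "coef m 1 = l" and a0: "coef a 0 = 0" using w0 two[of 0] n by auto
  have "coef m i = 0" if "i \<noteq> 1" for i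
  proof (cases "i < 2*n")
    case True then show ?thesis using two[OF True that] m1 by simp
  next
    case False
    then have "i \<notin> supp m" using supp(1) by auto
    then show ?thesis by (simp add: in_keys_iff)
  qed
  then have m: "m = single 1 l" using m1 by (intro poly_mapping_eqI) (auto simp: lookup_single when_def)
  have "coef a i = (if \<not> p \<and> i = n - 1 then 1 else 0)" for i
  proof (cases "i < n")
    case True
    have "2 * i + 1 = 1 \<longleftrightarrow> i = 0" "2 * i \<noteq> 1" by presburger+
    then show ?thesis using w[OF True] a0 n unfolding wt_hw[OF n]
      by (cases "i = 0") (auto simp: wt_def ma m lookup_single split: if_splits)
  next
    case False
    then have "i \<notin> supp a" using supp(2) by auto
    then show ?thesis using False n by (auto simp: in_keys_iff)
  qed
  then have "a = (if p then 0 else single (n - 1) 1)"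
    by (intro poly_mapping_eqI) (auto simp: lookup_single when_def)
  then show ?thesis by (simp add: ma m hw_def)
qed

lemma weight_space_eq:
  "weight_space n W \<mu> = {w \<in> W. \<forall>s\<in>supp w. \<forall>i<n. of_int (wt i s) - 1/2 = \<mu> $ i}"
proof -
  have "sp_act n (cartan n i) w = c *\<^sub>c w \<longleftrightarrow> (\<forall>s\<in>supp w. of_int (wt i s) - 1/2 = c)" if "i < n" for i w c
  proof -
    have d: "diagonal (- (opE i i + sc (1/2))) (\<lambda>s. - (- of_int (wt i s) + 1/2))"
      by (intro diagonal_simps diagonal_opE)
    show ?thesis
      unfolding sp_act_app[OF cartan_sp] sp_op_cartan[OF that] diagonal_eigen_iff[OF d] by simp
  qed
  then show ?thesis unfolding weight_space_def by auto
qed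

section \<open>Root spaces of the simple roots\<close>

lemma cartan_mult:
  assumes A: "A \<in> carrier_mat (2*n) (2*n)" and rc: "r < 2*n" "c < 2*n" and k: "k < n"
  defines "d \<equiv> \<lambda>r. if r = 2*k then 1 else if r = 2*k+1 then -1 else (0::real)"
  shows "(cartan n k * A - A * cartan n k) $$ (r, c) = (d r - d c) * A $$ (r, c)"
proof -
  have *: "cartan n k = mat (2*n) (2*n) (\<lambda>(r, c). if r = c then d r else 0)"
    unfolding cartan_def d_def by (intro eq_matI) auto
  have "(cartan n k * A) $$ (r, c) = (\<Sum>s<2*n. (if r = s then d r else 0) * A $$ (s, c))"
    unfolding * using A rc by (simp add: scalar_prod_def lessThan_atLeast0)
  also have "\<dots> = (\<Sum>s<2*n. if r = s then d r * A $$ (s, c) else 0)" by (intro sum.cong) auto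
  also have "\<dots> = d r * A $$ (r, c)" using rc by simp
  finally have 1: "(cartan n k * A) $$ (r, c) = d r * A $$ (r, c)" .
  have "(A * cartan n k) $$ (r, c) = (\<Sum>s<2*n. A $$ (r, s) * (if s = c then d s else 0))"
    unfolding * using A rc by (simp add: scalar_prod_def lessThan_atLeast0)
  also have "\<dots> = (\<Sum>s<2*n. if s = c then A $$ (r, s) * d s else 0)" by (intro sum.cong) auto
  also have "\<dots> = d c * A $$ (r, c)" using rc by simp
  finally have 2: "(A * cartan n k) $$ (r, c) = d c * A $$ (r, c)" .
  have "dim_row (A * cartan n k) = 2*n" "dim_col (A * cartan n k) = 2*n" using A by (auto simp: cartan_def)
  then show ?thesis using rc 1 2 by (simp add: left_diff_distrib)
qed

text \<open>The entry (2a+1, 2b) belongs to -\<epsilon>_a - \<epsilon>_b, which has no positive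
  coordinate, and the entry (2a, 2b) to \<epsilon>_a - \<epsilon>_b, which is not a positive root
  for b <= a. Neither can equal a simple root.\<close>

lemma simple_root_space_entries:
  assumes \<alpha>: "\<alpha> \<in> simple_roots n" and A: "A \<in> root_space n \<alpha>" and ab: "a < n" "b < n"
  shows "A $$ (2*a+1, 2*b) = 0" "b \<le> a \<Longrightarrow> A $$ (2*a, 2*b) = 0"
proof -
  have C: "A \<in> carrier_mat (2*n) (2*n)" using A by (auto simp: root_space_def sp_def)
  have eq: "((if r = 2*k then 1 else if r = 2*k+1 then -1 else 0) - (if c = 2*k then 1 else if c = 2*k+1 then -1 else 0)) * A $$ (r, c)
      = \<alpha> $ k * A $$ (r, c)" if "r < 2*n" "c < 2*n" "k < n" for r c k
  proof -
    have "(cartan n k * A - A * cartan n k) $$ (r, c) = (\<alpha> $ k \<cdot>\<^sub>m A) $$ (r, c)"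
      using A that by (simp add: root_space_def)
    then show ?thesis using that C by (simp add: cartan_mult[OF C that] del: index_minus_mat)
  qed
  have b: "2*a < 2*n" "2*a+1 < 2*n" "2*b < 2*n" using ab by auto
  have T: "(- of_bool (a = k) - of_bool (b = k)) * A $$ (2*a+1, 2*b) = \<alpha> $ k * A $$ (2*a+1, 2*b)"
    and E: "(of_bool (a = k) - of_bool (b = k)) * A $$ (2*a, 2*b) = \<alpha> $ k * A $$ (2*a, 2*b)" if "k < n" for k
    using eq[OF b(2,3) that] eq[OF b(1,3) that]
    by (auto simp: Suc_double_not_eq_double double_not_eq_Suc_double split: if_splits)
  from \<alpha> consider i where "i + 1 < n" "\<alpha> = unit_vec n i - unit_vec n (i+1)" | "\<alpha> = 2 \<cdot>\<^sub>v unit_vec n (n-1)"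
    unfolding simple_roots_def by blast
  then have "A $$ (2*a+1, 2*b) = 0 \<and> (b \<le> a \<longrightarrow> A $$ (2*a, 2*b) = 0)"
  proof cases
    case 1
    then have "\<alpha> $ i = 1" "\<alpha> $ (i+1) = -1" by simp_all
    then show ?thesis
      using T[of i] E[of i] E[of "i+1"] 1(1) by (auto simp: of_bool_def split: if_splits)
  next
    case 2
    then have "\<alpha> $ (n-1) = 2" using ab by simp
    then show ?thesis
      using T[of "n-1"] E[of "n-1"] ab by (auto simp: of_bool_def split: if_splits)
  qed
  then show "A $$ (2*a+1, 2*b) = 0" "b \<le> a \<Longrightarrow> A $$ (2*a, 2*b) = 0" by blast+
qed

text \<open>By the shape of the simple root spaces only \<open>opS i j\<close>, and
  \<open>opE i j\<close> with \<open>i < j\<close>, occur in the action of \<open>A\<close>.\<close>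

lemma hw_killed:
  assumes n: "n \<ge> 2" and \<alpha>: "\<alpha> \<in> simple_roots n" and A: "A \<in> root_space n \<alpha>"
  shows "sp_act n A (single (hw n l p) 1) = 0"
proof -
  let ?v = "single (hw n l p) (1 :: complex)"
  have y: "xd (2*k) \<star> ?v = 0" for k by (simp add: hw_def single_app lookup_single)
  have z: "xd (2*k+1) \<star> ?v = 0" if "0 < k" for k using that by (simp add: hw_def single_app lookup_single)
  have q: "qd k \<star> ?v = 0" if "k < n - 1" for k using that by (simp add: hw_def single_app lookup_single)
  have qq: "qd i \<star> qd j \<star> ?v = 0" for i j
    by (simp add: hw_def single_app lookup_single lookup_minus when_def)
  have S: "opS i j \<star> ?v = 0" for i j by (simp add: opS_def y qq)
  have E: "opE i j \<star> ?v = 0" if "i < j" "j < n" for i j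
    using that y z[of j] q[of i] by (simp add: opE_def)
  have "A \<in> sp n" using A by (simp add: root_space_def)
  then have "sp_act n A ?v = sp_op n A \<star> ?v" by (rule sp_act_app)
  also have "\<dots> = 0"
    unfolding sp_op_def sum_app
  proof (intro sum.neutral ballI)
    fix i j assume "i \<in> {..<n}" "j \<in> {..<n}"
    then have ij: "i < n" "j < n" by auto
    show "(sc (A $$ (2*i, 2*j+1) / 2) * opS i j - sc (A $$ (2*i, 2*j)) * (opE i j + sc (of_bool (i = j) / 2))
        - sc (A $$ (2*i+1, 2*j) / 2) * opT i j) \<star> ?v = 0"
      unfolding simple_root_space_entries(1)[OF \<alpha> A ij]
      using simple_root_space_entries(2)[OF \<alpha> A ij] E ij(2) S by (cases "i < j") auto
  qed
  finally show ?thesis .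
qed

lemma hw_weight_space:
  assumes "n \<ge> 2"
  shows "single (hw n l p) 1 \<in> weight_space n (ker_D_parity n l p) (hweight n l p)"
  unfolding weight_space_eq using hw_mem_ker_D_parity[OF assms] hweight_index[OF assms] by simp

lemma ker_D_parity_is_L: assumes n: "n \<ge> 2" shows "is_L n (hweight n l p) (ker_D_parity n l p)"
proof -
  have sub: "sp_submodule n (ker_D_parity n l p)" unfolding sp_submodule_iff by (rule op_closed_ker_D_parity)
  have v0: "single (hw n l p) (1::complex) \<noteq> 0" by (metis lookup_single_eq lookup_zero one_neq_zero)
  have "simple_sp_module n (ker_D_parity n l p)"
    unfolding simple_sp_module_def sp_submodule_iff
    using op_closed_ker_D_parity simple_closed_ker_D_parity[OF n] hw_mem_ker_D_parity[OF n, of l p] v0 by blast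
  moreover have "ker_D_parity n l p \<subseteq> U" if "sp_submodule n U" "single (hw n l p) 1 \<in> U" for U
  proof -
    have "op_closed n (U \<inter> ker_D_parity n l p)"
      using that(1) op_closed_ker_D_parity[of n l p] unfolding sp_submodule_iff op_closed_def
      by (auto intro: cvs.subspace_inter)
    then show ?thesis using ker_D_parity_subset[OF n _ _ IntI[OF that(2) hw_mem_ker_D_parity[OF n]]] by blast
  qed
  then have "highest_weight_module n (hweight n l p) (ker_D_parity n l p)"
    unfolding highest_weight_module_def
    by (intro conjI sub bexI[OF _ hw_weight_space[OF n]] v0 ballI allI impI hw_killed[OF n]) auto
  ultimately show ?thesis by (simp add: is_L_def)
qed

text \<open>The generator of a competing module \<open>W\<close> is a multiple of the same monomial;
  each of the two modules therefore contains a generator of the other.\<close>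

lemma ker_D_parity_unique:
  assumes n: "n \<ge> 2" and W: "W \<subseteq> PC_deg n l" "is_L n (hweight n l p) W"
  shows "W = ker_D_parity n l p"
proof -
  have sub: "sp_submodule n W" using W(2) by (simp add: is_L_def highest_weight_module_def)
  then have subW: "cvs.subspace W" by (simp add: sp_submodule_def)
  obtain v where v: "v \<in> weight_space n W (hweight n l p)" "v \<noteq> 0"
    "\<forall>U. sp_submodule n U \<and> v \<in> U \<longrightarrow> W \<subseteq> U"
    using W(2) unfolding is_L_def highest_weight_module_def by blast
  have vW: "v \<in> W" using v(1) by (simp add: weight_space_def)
  have key: "s = hw n l p" if s: "s \<in> supp v" for s
  proof (rule hw_unique[OF n])
    show "s \<in> mons n" "xdeg n s = l" using s vW W(1) by (auto simp: PC_deg_eq)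
    fix i assume "i < n"
    then have "complex_of_int (wt i s) - 1/2 = of_int (wt i (hw n l p)) - 1/2"
      using v(1) s hweight_index[OF n] unfolding weight_space_eq by simp
    then show "wt i s = wt i (hw n l p)" by simp
  qed
  have eq: "v = coef v (hw n l p) *\<^sub>c single (hw n l p) 1"
  proof (rule poly_mapping_eqI)
    fix s show "coef v s = coef (coef v (hw n l p) *\<^sub>c single (hw n l p) 1) s"
    proof (cases "s = hw n l p")
      case False
      then have "s \<notin> supp v" using key by blast
      then show ?thesis using False by (simp add: in_keys_iff lookup_single)
    qed simp
  qed
  then have nz: "coef v (hw n l p) \<noteq> 0" using v(2) by auto
  have "v \<in> ker_D_parity n l p" by (subst eq) (intro cvs.subspace_scale subspace_ker_D_parity hw_mem_ker_D_parity n)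
  then have "W \<subseteq> ker_D_parity n l p" using v(3) op_closed_ker_D_parity sp_submodule_iff by blast
  moreover have "single (hw n l p) 1 = (1 / coef v (hw n l p)) *\<^sub>c v"
    by (subst (2) eq) (use nz in simp)
  then have "single (hw n l p) 1 \<in> W" using vW subW by (metis cvs.subspace_scale)
  ultimately show ?thesis
    using ker_D_parity_subset[OF n] sub unfolding sp_submodule_iff by blast
qed

lemma ker_D_parity_PC_deg: "ker_D_parity n l p \<subseteq> PC_deg n l"
  by (auto simp: ker_D_parity_def ker_D_def)

lemma monogenic_plus_eq: assumes "n \<ge> 2" shows "monogenic_plus n l = ker_D_parity n l True"
  unfolding monogenic_plus_def using ker_D_parity_is_L[OF assms, of l True] ker_D_parity_unique[OF assms, of _ l True] ker_D_parity_PC_deg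
  by (intro the_equality) (auto simp: hweight_def)

lemma monogenic_minus_eq: assumes "n \<ge> 2" shows "monogenic_minus n l = ker_D_parity n l False"
  unfolding monogenic_minus_def using ker_D_parity_is_L[OF assms, of l False] ker_D_parity_unique[OF assms, of _ l False] ker_D_parity_PC_deg
  by (intro the_equality) (auto simp: hweight_def)

lemma ker_D_parity_sum: "is_direct_sum2 (ker_D_parity n l True) (ker_D_parity n l False) (ker_D n l)"
  unfolding is_direct_sum2_def
proof (intro conjI subspace_ker_D_parity)
  have "\<exists>a b. F = a + b \<and> a \<in> ker_D_parity n l True \<and> b \<in> ker_D_parity n l False" if F: "F \<in> ker_D n l" for F
  proof (intro exI conjI)
    have evF: "ev n \<star> F \<in> ker_D n l"
    proof -
      have "supp (ev n \<star> F) \<subseteq> supp F" by (auto simp: supp_keep)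
      moreover have "Dp n \<star> ev n \<star> F = (Dp n \<star> F) - (ev n \<star> Dp n \<star> F)"
        unfolding app_simps(6)[symmetric] ev_ops(4) by simp
      ultimately show ?thesis using F by (auto simp: ker_D_def PC_deg_eq)
    qed
    have idem: "ev n \<star> ev n \<star> F = ev n \<star> F" by (rule poly_mapping_eqI) (simp add: coef_keep)
    show "F = (ev n \<star> F) + (F - (ev n \<star> F))" by simp
    show "ev n \<star> F \<in> ker_D_parity n l True" "F - (ev n \<star> F) \<in> ker_D_parity n l False"
      using evF F idem cvs.subspace_diff[OF subspace_ker_D] by (auto simp: ker_D_parity_def)
  qed
  then show "ker_D n l = {a + b |a b. a \<in> ker_D_parity n l True \<and> b \<in> ker_D_parity n l False}"
    using cvs.subspace_add[OF subspace_ker_D] by (auto simp: ker_D_parity_def)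
  show "ker_D_parity n l True \<inter> ker_D_parity n l False = {0}"
    using cvs.subspace_0[OF subspace_ker_D_parity] by (auto simp: ker_D_parity_def)
qed

lemma monogenic_eq: assumes "n \<ge> 2" shows "monogenic n l = ker_D n l"
  using ker_D_parity_sum[of n l]
  by (simp add: monogenic_def monogenic_plus_eq[OF assms] monogenic_minus_eq[OF assms] is_direct_sum2_def)

section \<open>Direct sum decompositions\<close>

lemma eigenvectors_independent:
  assumes "finite J" "inj_on c J" "\<And>j. j \<in> J \<Longrightarrow> T \<star> w j = c j *\<^sub>c w j" "(\<Sum>j\<in>J. w j) = 0"
  shows "\<forall>j\<in>J. w j = 0"
  using assms
proof (induction J arbitrary: w rule: finite_induct)
  case (insert i J)
  have "(\<Sum>j\<in>insert i J. (T - sc (c i)) \<star> w j) = 0"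
    by (simp only: app_sum[symmetric] insert.prems(3) app_zero)
  moreover have "(T - sc (c i)) \<star> w j = (c j - c i) *\<^sub>c w j" if "j \<in> insert i J" for j
    using insert.prems(2)[OF that] by (simp add: cvs.scale_left_diff_distrib)
  ultimately have "(\<Sum>j\<in>insert i J. (c j - c i) *\<^sub>c w j) = 0" by simp
  then have "(\<Sum>j\<in>J. (c j - c i) *\<^sub>c w j) = 0" using insert.hyps by simp
  then have "\<forall>j\<in>J. (c j - c i) *\<^sub>c w j = 0"
    using insert.prems(1,2) by (intro insert.IH) (auto simp: mult.commute)
  moreover have "c j \<noteq> c i" if "j \<in> J" for j using insert.prems(1) insert.hyps(2) that by (auto simp: inj_on_def)
  ultimately have "\<forall>j\<in>J. w j = 0" by auto
  then show ?case using insert.prems(3) insert.hyps by simp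
qed simp

text \<open>Directness comes from distinct eigenvalues of one operator \<open>T\<close>: the Casimir
  operator separates the index l, the Euler operator the index j within a tower.\<close>

lemma is_direct_sum_eigenI:
  assumes "\<And>i. i \<in> I \<Longrightarrow> cvs.subspace (W i)" "U = cvs.span (\<Union>i\<in>I. W i)"
    "\<And>i w. i \<in> I \<Longrightarrow> w \<in> W i \<Longrightarrow> T \<star> w = c i *\<^sub>c w" "inj_on c I"
  shows "is_direct_sum I W U"
  unfolding is_direct_sum_def
proof (intro conjI allI impI)
  fix J w assume J: "finite J \<and> J \<subseteq> I \<and> (\<forall>j\<in>J. w j \<in> W j) \<and> (\<Sum>j\<in>J. w j) = 0"
  show "\<forall>j\<in>J. w j = 0"
  proof (rule eigenvectors_independent)
    show "inj_on c J" using assms(4) J by (blast intro: inj_on_subset)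
    show "T \<star> w j = c j *\<^sub>c w j" if "j \<in> J" for j using J that assms(3) by blast
  qed (use J in auto)
qed (use assms in auto)

lemma weight_moduleI: assumes W: "op_closed n W" shows "weight_module n W"
proof -
  have sub: "cvs.subspace W" using W by (simp add: op_closed_def)
  have ws: "weight_space n W \<mu> = {w \<in> W. \<forall>s\<in>supp w. wvec n s = \<mu>}" if "\<mu> \<in> carrier_vec n" for \<mu>
  proof -
    have "(\<forall>i<n. of_int (wt i s) - 1/2 = \<mu> $ i) \<longleftrightarrow> wvec n s = \<mu>" for s
      using that by (auto simp: vec_eq_iff wvec_def)
    then show ?thesis unfolding weight_space_eq by simp
  qed
  have "is_direct_sum (carrier_vec n) (weight_space n W) W"
    unfolding is_direct_sum_def
  proof (intro conjI ballI allI impI)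
    fix \<mu> :: "complex vec" assume "\<mu> \<in> carrier_vec n"
    have "weight_space n W \<mu> = W \<inter> {w. supp w \<subseteq> {s. wvec n s = \<mu>}}"
      unfolding ws[OF \<open>\<mu> \<in> carrier_vec n\<close>] by auto
    then show "cvs.subspace (weight_space n W \<mu>)" using cvs.subspace_inter[OF sub subspace_supp] by simp
  next
    show "W = cvs.span (\<Union>\<mu>\<in>carrier_vec n. weight_space n W \<mu>)"
    proof
      show "cvs.span (\<Union>\<mu>\<in>carrier_vec n. weight_space n W \<mu>) \<subseteq> W"
        by (rule cvs.span_minimal[OF _ sub]) (auto simp: weight_space_def)
      show "W \<subseteq> cvs.span (\<Union>\<mu>\<in>carrier_vec n. weight_space n W \<mu>)"
      proof
        fix F assume F: "F \<in> W"
        have "keep (\<lambda>s. wvec n s = \<mu>) \<star> F \<in> cvs.span (\<Union>\<mu>\<in>carrier_vec n. weight_space n W \<mu>)"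
          if "\<mu> \<in> wvec n ` supp F" for \<mu>
        proof (rule cvs.span_base)
          have "\<mu> \<in> carrier_vec n" using that by auto
          moreover have "keep (\<lambda>s. wvec n s = \<mu>) \<star> F \<in> weight_space n W \<mu>"
            unfolding ws[OF \<open>\<mu> \<in> carrier_vec n\<close>] using op_closed_component[OF W F] by (auto simp: supp_keep)
          ultimately show "keep (\<lambda>s. wvec n s = \<mu>) \<star> F \<in> (\<Union>\<mu>\<in>carrier_vec n. weight_space n W \<mu>)" by blast
        qed
        then show "F \<in> cvs.span (\<Union>\<mu>\<in>carrier_vec n. weight_space n W \<mu>)"
          by (subst sum_components[of F "wvec n"]) (rule cvs.span_sum)
      qed
    qed
  next
    fix J w \<mu> assume J: "finite J \<and> J \<subseteq> carrier_vec n \<and> (\<forall>j\<in>J. w j \<in> weight_space n W j) \<and> (\<Sum>j\<in>J. w j) = 0" and \<mu>: "\<mu> \<in> J"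
    show "w \<mu> = 0"
    proof (rule poly_mapping_eqI)
      fix s
      have *: "wvec n s = \<nu>" if "\<nu> \<in> J" "s \<in> supp (w \<nu>)" for \<nu>
        using J that ws[of \<nu>] by auto
      show "coef (w \<mu>) s = coef 0 s"
      proof (rule ccontr)
        assume "coef (w \<mu>) s \<noteq> coef 0 s"
        then have s: "s \<in> supp (w \<mu>)" by (simp add: in_keys_iff)
        \<comment> \<open>At the monomial \<open>s\<close> only the summand with index
          \<open>wvec n s\<close> contributes.\<close>
        have "coef (\<Sum>j\<in>J. w j) s = (\<Sum>j\<in>J. if j = \<mu> then coef (w \<mu>) s else 0)"
          unfolding lookup_sum using *[OF \<mu> s] * by (intro sum.cong refl) (auto simp: in_keys_iff)
        then show False using J \<mu> s by (simp add: in_keys_iff)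
      qed
    qed
  qed
  then show ?thesis using W by (simp add: weight_module_def sp_submodule_iff)
qed

lemma X_s_funpow: "(X_s n ^^ j) F = \<i> ^ j *\<^sub>c (Xp n ^ j \<star> F)"
  by (induction j) (simp_all add: X_s_app)

text \<open>The factor i^j between the powers of \<open>X_s\<close> and \<open>Xp\<close> is
  absorbed by the subspace \<open>M\<close>.\<close>

lemma X_image_eq: assumes "cvs.subspace M" shows "X_image n j M = app (Xp n ^ j) ` M"
proof -
  have "(X_s n ^^ j) m \<in> app (Xp n ^ j) ` M" if "m \<in> M" for m
    using cvs.subspace_scale[OF assms that, of "\<i> ^ j"] by (auto simp: X_s_funpow simp flip: app_simps(2))
  moreover have "Xp n ^ j \<star> m \<in> (X_s n ^^ j) ` M" if "m \<in> M" for m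
  proof -
    have "Xp n ^ j \<star> m = (X_s n ^^ j) ((1 / \<i> ^ j) *\<^sub>c m)" by (simp add: X_s_funpow)
    then show ?thesis using cvs.subspace_scale[OF assms that] by blast
  qed
  ultimately show ?thesis unfolding X_image_def by blast
qed

lemma subspace_image: "cvs.subspace M \<Longrightarrow> cvs.subspace (app A ` M)"
proof (rule cvs.subspaceI)
  assume M: "cvs.subspace M"
  show "0 \<in> app A ` M" using cvs.subspace_0[OF M] by (metis app_zero imageI)
  fix x y c assume "x \<in> app A ` M"
  then obtain x' where x: "x' \<in> M" "x = A \<star> x'" by blast
  show "c *\<^sub>c x \<in> app A ` M" using cvs.subspace_scale[OF M x(1), of c] x(2) by (metis app_simps(2) imageI)
  assume "y \<in> app A ` M"
  then obtain y' where y: "y' \<in> M" "y = A \<star> y'" by blast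
  show "x + y \<in> app A ` M" using cvs.subspace_add[OF M x(1) y(1)] x(2) y(2) by (metis app_simps(1) imageI)
qed

lemma op_Xp_pow:
  assumes "i < n" "j < n"
  shows "opE i j \<star> Xp n ^ r \<star> F = Xp n ^ r \<star> opE i j \<star> F" "opS i j \<star> Xp n ^ r \<star> F = Xp n ^ r \<star> opS i j \<star> F"
    "opT i j \<star> Xp n ^ r \<star> F = Xp n ^ r \<star> opT i j \<star> F"
proof -
  have *: "A \<star> Xp n ^ r \<star> F = Xp n ^ r \<star> A \<star> F" if "comm A (Xp n) = 0" for A
  proof (induction r)
    case (Suc r)
    then show ?case using comm_app[of A "Xp n" "Xp n ^ r \<star> F"] that by simp
  qed simp
  show "opE i j \<star> Xp n ^ r \<star> F = Xp n ^ r \<star> opE i j \<star> F" "opS i j \<star> Xp n ^ r \<star> F = Xp n ^ r \<star> opS i j \<star> F"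
    "opT i j \<star> Xp n ^ r \<star> F = Xp n ^ r \<star> opT i j \<star> F"
    by (intro * opE_Xp opS_Xp opT_Xp assms)+
qed

lemma op_closed_image: "op_closed n W \<Longrightarrow> op_closed n (app (Xp n ^ r) ` W)"
  unfolding op_closed_def by (auto simp: op_Xp_pow subspace_image)

text \<open>\<open>Xp n ^ r\<close> commutes with the root vectors and is injective on the kernel of
  \<open>Dp\<close>, so simplicity is inherited through the preimage \<open>V\<close> of a
  submodule.\<close>

lemma simple_image:
  assumes n: "n \<ge> 2"
  shows "simple_sp_module n (app (Xp n ^ r) ` ker_D_parity n l p)"
  unfolding simple_sp_module_def sp_submodule_iff
proof (intro conjI allI impI)
  show "op_closed n (app (Xp n ^ r) ` ker_D_parity n l p)" by (rule op_closed_image[OF op_closed_ker_D_parity])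
  have inj: "F = 0" if "F \<in> ker_D_parity n l p" "Xp n ^ r \<star> F = 0" for F
    using Xp_pow_inj[of n F l r] that n by (auto simp: ker_D_parity_def)
  have "single (hw n l p) (1::complex) \<noteq> 0" by (metis lookup_single_eq lookup_zero one_neq_zero)
  then show "app (Xp n ^ r) ` ker_D_parity n l p \<noteq> {0}" using inj hw_mem_ker_D_parity[OF n] by blast
  fix U assume U: "op_closed n U \<and> U \<subseteq> app (Xp n ^ r) ` ker_D_parity n l p"
  define V where "V = {w \<in> ker_D_parity n l p. Xp n ^ r \<star> w \<in> U}"
  have UV: "U = app (Xp n ^ r) ` V" using U by (auto simp: V_def)
  have "op_closed n V"
    using U ker_D_parity_op subspace_ker_D_parity[of n l p] unfolding op_closed_def V_def
    by (auto simp: cvs.subspace_def simp flip: op_Xp_pow)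
  then have "V = {0} \<or> V = ker_D_parity n l p" using simple_closed_ker_D_parity[OF n, of V l p] by (auto simp: V_def)
  then show "U = {0} \<or> U = app (Xp n ^ r) ` ker_D_parity n l p" unfolding UV by auto
qed

lemma image_direct_sum2:
  assumes "n > 0"
  shows "is_direct_sum2 (app (Xp n ^ r) ` ker_D_parity n l True) (app (Xp n ^ r) ` ker_D_parity n l False) (app (Xp n ^ r) ` ker_D n l)"
  unfolding is_direct_sum2_def
proof (intro conjI subspace_image subspace_ker_D_parity)
  have K: "ker_D n l = {a + b |a b. a \<in> ker_D_parity n l True \<and> b \<in> ker_D_parity n l False}" and disj: "ker_D_parity n l True \<inter> ker_D_parity n l False = {0}"
    using ker_D_parity_sum[of n l] by (auto simp: is_direct_sum2_def)
  show "app (Xp n ^ r) ` ker_D n l = {a + b |a b. a \<in> app (Xp n ^ r) ` ker_D_parity n l True \<and> b \<in> app (Xp n ^ r) ` ker_D_parity n l False}"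
    unfolding K by (auto simp: image_iff) (metis app_simps(1))+
  have "Xp n ^ r \<star> a = 0" if "a \<in> ker_D_parity n l True" "b \<in> ker_D_parity n l False" "Xp n ^ r \<star> a = Xp n ^ r \<star> b" for a b
  proof -
    have "a - b \<in> ker_D n l" using that cvs.subspace_diff[OF subspace_ker_D] by (auto simp: ker_D_parity_def)
    then have "a - b = 0" by (rule Xp_pow_inj[OF assms, where j = r]) (simp add: that(3))
    then have "a = 0" using that(1,2) disj by auto
    then show ?thesis by simp
  qed
  then show "app (Xp n ^ r) ` ker_D_parity n l True \<inter> app (Xp n ^ r) ` ker_D_parity n l False = {0}"
    using cvs.subspace_0[OF subspace_image[OF subspace_ker_D_parity]] by auto
qed

definition casimir_value :: "nat \<Rightarrow> nat \<Rightarrow> complex" where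
  "casimir_value n l = of_nat ((l + n) * (l + n) - (l + n))"

text \<open>x (x - 1) is strictly increasing for x >= 1, and n > 0 places l + n in that
  range.\<close>

lemma inj_casimir_value: assumes "n > 0" shows "inj (casimir_value n)"
proof (rule injI)
  have *: "(l + n) * (l + n) - (l + n) < (l' + n) * (l' + n) - (l' + n)" if "l < l'" for l l'
  proof -
    have "(l + n) * (l + n - 1) < (l' + n) * (l' + n - 1)"
      using that assms by (intro mult_strict_mono) auto
    then show ?thesis by (simp add: right_diff_distrib')
  qed
  fix x y assume "casimir_value n x = casimir_value n y"
  then show "x = y" using *[of x y] *[of y x] unfolding casimir_value_def of_nat_eq_iff
    by (cases x y rule: linorder_cases) auto
qed

abbreviation tower :: "nat \<Rightarrow> nat \<Rightarrow> spinor_pol set" where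
  "tower n l \<equiv> cvs.span (\<Union>j. app (Xp n ^ j) ` ker_D n l)"

lemma tower_casimir: assumes "F \<in> tower n l" shows "casimir n \<star> F = casimir_value n l *\<^sub>c F"
proof -
  have "cvs.subspace {F. casimir n \<star> F = casimir_value n l *\<^sub>c F}"
    by (auto simp: cvs.subspace_def cvs.scale_right_distrib mult.commute)
  then have "tower n l \<subseteq> {F. casimir n \<star> F = casimir_value n l *\<^sub>c F}"
    by (rule cvs.span_minimal[rotated]) (auto simp: casimir_ker_D casimir_value_def)
  then show ?thesis using assms by blast
qed

lemma PC_deg_decomposition:
  assumes "n > 0"
  shows "is_direct_sum {..k} (\<lambda>l. app (Xp n ^ (k - l)) ` ker_D n l) (PC_deg n k)"
proof (rule is_direct_sum_eigenI)
  show "casimir n \<star> w = casimir_value n l *\<^sub>c w" if "w \<in> app (Xp n ^ (k - l)) ` ker_D n l" for l w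
    using that by (auto simp: casimir_ker_D casimir_value_def)
  show "inj_on (casimir_value n) {..k}" using inj_casimir_value[OF assms] by (rule inj_on_subset) auto
  show "PC_deg n k = cvs.span (\<Union>l\<in>{..k}. app (Xp n ^ (k - l)) ` ker_D n l)" (is "_ = cvs.span ?S")
  proof
    show "cvs.span ?S \<subseteq> PC_deg n k"
    proof (rule cvs.span_minimal[OF _ subspace_PC_deg])
      have "Xp n ^ (k - l) \<star> F \<in> PC_deg n k" if "l \<le> k" "F \<in> ker_D n l" for l F
        using Xp_pow_PC_deg[of F n l "k - l"] that by (simp add: ker_D_def)
      then show "?S \<subseteq> PC_deg n k" by auto
    qed
    show "PC_deg n k \<subseteq> cvs.span ?S"
    proof
      fix F assume "F \<in> PC_deg n k"
      from fischer[OF assms this] obtain m where "\<And>l. l \<le> k \<Longrightarrow> m l \<in> ker_D n l" "F = (\<Sum>l\<le>k. Xp n ^ (k - l) \<star> m l)"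
        by blast
      then show "F \<in> cvs.span ?S"
        by (simp only:) (intro cvs.span_sum cvs.span_base UN_I imageI, auto)
    qed
  qed
qed (intro subspace_image subspace_ker_D)

lemma PC_decomposition:
  assumes "n > 0"
  shows "is_direct_sum UNIV (tower n) (PC n)"
proof (rule is_direct_sum_eigenI)
  show "PC n = cvs.span (\<Union>l\<in>UNIV. tower n l)" (is "_ = cvs.span ?S")
  proof
    have sub: "tower n l \<subseteq> PC n" for l
    proof (rule cvs.span_minimal[OF _ subspace_PC])
      have "Xp n ^ j \<star> F \<in> PC n" if "F \<in> ker_D n l" for j F
        using Xp_pow_PC_deg[of F n l j] that by (simp add: ker_D_def PC_deg_iff)
      then show "(\<Union>j. app (Xp n ^ j) ` ker_D n l) \<subseteq> PC n" by auto
    qed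
    then show "cvs.span ?S \<subseteq> PC n" by (intro cvs.span_minimal subspace_PC) auto
    \<comment> \<open>Monomials are homogeneous and span, so the decompositions of the single
      degrees suffice.\<close>
    have "single s 1 \<in> cvs.span ?S" if "s \<in> mons n" for s
    proof -
      have "single s 1 \<in> PC_deg n (xdeg n s)" using that by (simp add: PC_deg_eq)
      also have "\<dots> = cvs.span (\<Union>l\<in>{..xdeg n s}. app (Xp n ^ (xdeg n s - l)) ` ker_D n l)"
        using PC_deg_decomposition[OF assms] by (simp add: is_direct_sum_def)
      also have "\<dots> \<subseteq> cvs.span ?S"
        by (intro cvs.span_mono) (auto intro!: exI cvs.span_base)
      finally show ?thesis .
    qed
    then have "F \<in> cvs.span ?S" if "F \<in> PC n" for F
      using that by (intro subspace_mem_supp[OF cvs.subspace_span, of F]) (auto simp only: PC_eq mem_Collect_eq)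
    then show "PC n \<subseteq> cvs.span ?S" by blast
  qed
qed (use tower_casimir inj_casimir_value[OF assms] in auto)

lemma tower_decomposition: "is_direct_sum UNIV (\<lambda>j. app (Xp n ^ j) ` ker_D n l) (tower n l)"
proof (rule is_direct_sum_eigenI)
  show "Eu n \<star> w = of_nat (l + j) *\<^sub>c w" if "w \<in> app (Xp n ^ j) ` ker_D n l" for j w
    using that Xp_pow_PC_deg[of _ n l j] by (auto simp: ker_D_def PC_deg_iff simp del: of_nat_add)
  show "inj (\<lambda>j. of_nat (l + j) :: complex)" by (auto simp: inj_on_def simp del: of_nat_add)
qed (auto intro: subspace_image subspace_ker_D)

lemma tower_lowest_weight: "lowest_weight_sl2_module_generated_by n (tower n l) (ker_D n l)"
proof -
  have sub: "cvs.subspace (tower n l)" by (rule cvs.subspace_span)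
  have pres: "preserves A (tower n l)" if "\<And>j F. F \<in> ker_D n l \<Longrightarrow> A \<star> Xp n ^ j \<star> F \<in> tower n l" for A
  proof -
    have "cvs.subspace {F. A \<star> F \<in> tower n l}"
      using sub by (auto simp: cvs.subspace_def)
    then have "tower n l \<subseteq> {F. A \<star> F \<in> tower n l}"
      by (rule cvs.span_minimal[rotated]) (use that in auto)
    then show ?thesis by (auto simp: preserves_def)
  qed
  have base: "Xp n ^ j \<star> F \<in> tower n l" if "F \<in> ker_D n l" for j F
    using that by (intro cvs.span_base) blast
  have X: "preserves (Xp n) (tower n l)"
    by (rule pres) (metis app_simps(6) base power_Suc)
  have D: "preserves (Dp n) (tower n l)"
  proof (rule pres)
    fix j F assume F: "F \<in> ker_D n l"
    show "Dp n \<star> Xp n ^ j \<star> F \<in> tower n l"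
    proof (cases j)
      case 0
      then show ?thesis using F cvs.subspace_0[OF sub] by (simp add: ker_D_def)
    next
      case (Suc i)
      then show ?thesis using Dp_Xp_pow[OF F, of i] cvs.subspace_scale[OF sub base[OF F]] by metis
    qed
  qed
  \<comment> \<open>Stability under the Euler operator follows from that under \<open>Xp n\<close>
    and \<open>Dp n\<close> through their commutator.\<close>
  have "preserves (Eu n) (tower n l)"
  proof -
    have "preserves (- comm (Dp n) (Xp n) - of_nat n) (tower n l)"
      unfolding comm_def sc_simps(7)[symmetric] by (intro preserves_simps[OF sub] X D)
    then show ?thesis by (simp add: Dp_Xp)
  qed
  then have h: "preserves (Eu n + of_nat n) (tower n l)"
    unfolding sc_simps(7)[symmetric] by (intro preserves_simps[OF sub])
  have "sl2_submodule n (tower n l)"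
    using sub X D h cvs.subspace_scale[OF sub]
    unfolding sl2_submodule_def preserves_def X_s_app D_s_app euler_shift_app by blast
  moreover have "ker_D n l \<subseteq> tower n l" using base[of _ 0] by auto
  moreover have "tower n l \<subseteq> U'" if U': "sl2_submodule n U'" "ker_D n l \<subseteq> U'" for U'
  proof -
    have sU': "cvs.subspace U'" using U'(1) by (simp add: sl2_submodule_def)
    \<comment> \<open>Closure under \<open>X_s\<close> alone forces the whole tower over the kernel
      into \<open>U'\<close>.\<close>
    have "(X_s n ^^ j) F \<in> U'" if "F \<in> ker_D n l" for j F
      using that U' by (induction j) (auto simp: sl2_submodule_def)
    then have "X_image n j (ker_D n l) \<subseteq> U'" for j by (auto simp: X_image_def)
    then show ?thesis unfolding X_image_eq[OF subspace_ker_D] by (intro cvs.span_minimal sU') auto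
  qed
  moreover have "D_s n m = 0" if "m \<in> ker_D n l" for m using that by (simp add: D_s_app ker_D_def)
  moreover have "euler_shift n m = of_nat (l + n) *\<^sub>c m" if "m \<in> ker_D n l" for m
    using that by (simp add: euler_shift_app ker_D_def PC_deg_iff cvs.scale_left_distrib flip: sc_simps(7))
  ultimately show ?thesis
    unfolding lowest_weight_sl2_module_generated_by_def using subspace_ker_D by blast
qed

theorem theorem5p4:
  fixes n :: nat
  assumes "n \<ge> 2"
  shows "
    (is_direct_sum UNIV (\<lambda>l. X_tower n (monogenic n l)) (PC n)) \<and>
    (\<forall>l. is_direct_sum UNIV (\<lambda>j. X_image n j (monogenic n l)) (X_tower n (monogenic n l))) \<and>
    (\<forall>l. is_direct_sum2 (monogenic_plus n l) (monogenic_minus n l) (monogenic n l)) \<and>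
    (\<forall>l j. is_direct_sum2 (X_image n j (monogenic_plus n l)) (X_image n j (monogenic_minus n l))
            (X_image n j (monogenic n l))) \<and>
    (\<forall>l j. simple_sp_module n (X_image n j (monogenic_plus n l)) \<and>
            weight_module n (X_image n j (monogenic_plus n l))) \<and>
    (\<forall>l j. simple_sp_module n (X_image n j (monogenic_minus n l)) \<and>
            weight_module n (X_image n j (monogenic_minus n l))) \<and>
    (\<forall>k. is_direct_sum {..k} (\<lambda>l. X_image n (k - l) (monogenic n l)) (PC_deg n k)) \<and>
    (\<forall>l. lowest_weight_sl2_module_generated_by n (X_tower n (monogenic n l)) (monogenic n l))"
proof -
  have n: "n > 0" using assms by simp
  show ?thesis
    unfolding monogenic_plus_eq[OF assms] monogenic_minus_eq[OF assms] monogenic_eq[OF assms]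
      X_tower_def X_image_eq[OF subspace_ker_D] X_image_eq[OF subspace_ker_D_parity]
    using PC_decomposition[OF n] tower_decomposition ker_D_parity_sum image_direct_sum2[OF n]
      simple_image[OF assms] weight_moduleI[OF op_closed_image[OF op_closed_ker_D_parity]]
      PC_deg_decomposition[OF n] tower_lowest_weight
    by blast
qed

end
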